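(* Let $\mathfrak{Q}=\mathfrak{Q}_1\otimes\mathfrak{Q}_2$ be a nonzero doubly commuting quotient module of $H^2(\mathbb{D}^2)$, where $\mathfrak{Q}_1,\mathfrak{Q}_2$ are quotient modules of $H^2(\mathbb{D})$. Then $\mathfrak{Q}$ is $\varphi$-doubly commuting if and only if one of the following holds: (i) $\mathfrak{Q}_1=H^2(\mathbb{D})$ and $\mathfrak{Q}_2=H^2(\mathbb{D})\ominus f_a(w)H^2(\mathbb{D})$ for some $a\in\mathbb{D}$; (ii) $\mathfrak{Q}_1=H^2(\mathbb{D})\ominus f_0(z)H^2(\mathbb{D})$ and $\mathfrak{Q}_2=H^2(\mathbb{D})$; (iii) $\mathfrak{Q}_1=H^2(\mathbb{D})\ominus\theta_1(z)H^2(\mathbb{D})$ and $\mathfrak{Q}_2=H^2(\mathbb{D})\ominus\theta_2(w)H^2(\mathbb{D})$, where either $\theta_1=f_0$ and $\theta_2$ is an arbitrary inner function on $\mathbb{D}$, or $\theta_1$ is an arbitrary inner function on $\mathbb{D}$ and $\theta_2=f_a$ for some $a\in\mathbb{D}$.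
   Context: $H^2(\mathbb{D}^2)\cong H^2(\mathbb{D})\otimes H^2(\mathbb{D})$ is the Hardy space of the bidisc, with $z^mw^n$ identified with $z^m\otimes w^n$; $M_1,M_2$ are multiplication by $z$ and $w$ on it. A quotient module of $H^2(\mathbb{D}^2)$ is a closed subspace $\mathfrak{Q}$ invariant under $M_1^*$ and $M_2^*$; a quotient module of $H^2(\mathbb{D})$ is a closed subspace invariant under the backward shift (adjoint of multiplication by the coordinate). Put $Q_i=P_{\mathfrak{Q}}M_i|_{\mathfrak{Q}}$, $i=1,2$, with $P_{\mathfrak Q}$ the orthogonal projection onto $\mathfrak{Q}$. $\mathfrak{Q}$ is doubly commuting if $Q_1^*Q_2=Q_2Q_1^*$, and $\varphi$-doubly commuting if $Q_1Q_2Q_2^*=Q_2^*Q_1Q_2$. For $a\in\mathbb{D}$, $f_a$ denotes the disc automorphism $f_a(z)=c\frac{z-a}{1-\bar az}$ with $c\in\mathbb{T}$ some unimodular constant (so $f_0(z)=cz$). $\ominus$ denotes orthogonal complement. *)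

theory Defs
  imports "HOL-Analysis.Analysis"
begin

section \<open>Complex inner product spaces\<close>

text \<open>The form \<^term>\<open>cinner\<close> is linear in its first and antilinear in its second argument. Norm and
  topology are those of the class \<^class>\<open>real_inner\<close> for the real part of this form.\<close>

class complex_inner = real_inner +
  fixes scaleC :: "complex \<Rightarrow> 'a \<Rightarrow> 'a" (infixr \<open>*\<^sub>C\<close> 75)
    and cinner :: "'a \<Rightarrow> 'a \<Rightarrow> complex"
  assumes scaleC_add_right: "c *\<^sub>C (x + y) = c *\<^sub>C x + c *\<^sub>C y"
    and scaleC_add_left: "(c + d) *\<^sub>C x = c *\<^sub>C x + d *\<^sub>C x"
    and scaleC_scaleC: "c *\<^sub>C (d *\<^sub>C x) = (c * d) *\<^sub>C x"
    and scaleC_one: "1 *\<^sub>C x = x"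
    and scaleR_eq_scaleC: "r *\<^sub>R x = of_real r *\<^sub>C x"
    and cinner_commute: "cinner x y = cnj (cinner y x)"
    and cinner_add_left: "cinner (x + y) z = cinner x z + cinner y z"
    and cinner_scaleC_left: "cinner (c *\<^sub>C x) y = c * cinner x y"
    and inner_eq_Re_cinner: "inner x y = Re (cinner x y)"

interpretation complex_vs: vector_space "scaleC :: complex \<Rightarrow> 'a \<Rightarrow> 'a::complex_inner"
  by standard (simp_all add: scaleC_add_right scaleC_add_left scaleC_scaleC scaleC_one)

definition orth_complement :: "'a::complex_inner set \<Rightarrow> 'a set" where
  "orth_complement S = {x. \<forall>y\<in>S. cinner x y = 0}"

definition orth_proj :: "'a::complex_inner set \<Rightarrow> 'a \<Rightarrow> 'a" where
  "orth_proj Q x = (THE p. p \<in> Q \<and> x - p \<in> orth_complement Q)"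

text \<open>An operator on a closed subspace \<open>Q\<close> is represented by a function on the whole space of which
  only the values on \<open>Q\<close> matter. The Hilbert space adjoint of a bounded operator \<open>T\<close> on \<open>Q\<close> is
  \<open>adjoint_on Q T\<close>; again only its values on \<open>Q\<close> matter.\<close>

definition adjoint_on :: "'a::complex_inner set \<Rightarrow> ('a \<Rightarrow> 'a) \<Rightarrow> 'a \<Rightarrow> 'a" where
  "adjoint_on Q T y = (THE v. v \<in> Q \<and> (\<forall>x\<in>Q. cinner (T x) y = cinner x v))"

definition compression :: "'a::complex_inner set \<Rightarrow> ('a \<Rightarrow> 'a) \<Rightarrow> 'a \<Rightarrow> 'a" where
  "compression Q T x = orth_proj Q (T x)"

section \<open>Hardy spaces\<close>

abbreviation unit_disc :: "complex set" where
  "unit_disc \<equiv> ball 0 1"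

definition square_summable :: "('i \<Rightarrow> complex) \<Rightarrow> bool" where
  "square_summable a \<longleftrightarrow> (\<lambda>i. (cmod (a i))\<^sup>2) summable_on UNIV"

text \<open>\<open>expansion D e a f\<close>: on \<open>D\<close> the function \<open>f\<close> is the sum of the series with square summable
  coefficients \<open>a\<close> in the monomials \<open>e\<close>. Functions on \<open>D\<close> are represented by total functions
  vanishing outside \<open>D\<close>.\<close>

definition expansion ::
    "'d set \<Rightarrow> ('i \<Rightarrow> 'd \<Rightarrow> complex) \<Rightarrow> ('i \<Rightarrow> complex) \<Rightarrow> ('d \<Rightarrow> complex) \<Rightarrow> bool" where
  "expansion D e a f \<longleftrightarrow> square_summable a \<and>
     (\<forall>x\<in>D. ((\<lambda>i. a i * e i x) has_sum f x) UNIV) \<and> (\<forall>x. x \<notin> D \<longrightarrow> f x = 0)"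

abbreviation monom1 :: "nat \<Rightarrow> complex \<Rightarrow> complex" where
  "monom1 n z \<equiv> z ^ n"

abbreviation monom2 :: "nat \<times> nat \<Rightarrow> complex \<times> complex \<Rightarrow> complex" where
  "monom2 k p \<equiv> fst p ^ fst k * snd p ^ snd k"

abbreviation "expansion1 \<equiv> expansion unit_disc monom1"
abbreviation "expansion2 \<equiv> expansion (unit_disc \<times> unit_disc) monom2"

lemma square_summable_zero: "square_summable (\<lambda>_. 0)"
  by (simp add: square_summable_def)

lemma square_summable_scale: "square_summable a \<Longrightarrow> square_summable (\<lambda>i. c * a i)"
  unfolding square_summable_def
  by (simp add: norm_mult power_mult_distrib summable_on_cmult_right)

lemma square_summable_add:
  assumes "square_summable a" "square_summable b"
  shows "square_summable (\<lambda>i. a i + b i)"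
proof -
  have s: "(\<lambda>i. 2 * (cmod (a i))\<^sup>2 + 2 * (cmod (b i))\<^sup>2) summable_on UNIV"
    using assms unfolding square_summable_def
    by (intro summable_on_add summable_on_cmult_right)
  have "(cmod (x + y))\<^sup>2 \<le> 2 * (cmod x)\<^sup>2 + 2 * (cmod y)\<^sup>2" for x y
  proof -
    have "(cmod (x + y))\<^sup>2 \<le> (cmod x + cmod y)\<^sup>2"
      by (intro power_mono norm_triangle_ineq) auto
    also have "\<dots> \<le> 2 * (cmod x)\<^sup>2 + 2 * (cmod y)\<^sup>2"
      using zero_le_power2[of "cmod x - cmod y"] by (simp add: power2_eq_square algebra_simps)
    finally show ?thesis .
  qed
  then show ?thesis
    unfolding square_summable_def by (intro summable_on_comparison_test[OF s]) auto
qed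

lemma square_summable_mult_cnj:
  assumes "square_summable a" "square_summable b"
  shows "(\<lambda>i. a i * cnj (b i)) summable_on UNIV"
proof -
  have s: "(\<lambda>i. (cmod (a i))\<^sup>2 + (cmod (b i))\<^sup>2) summable_on UNIV"
    using assms unfolding square_summable_def by (intro summable_on_add)
  have "cmod (x * cnj y) \<le> (cmod x)\<^sup>2 + (cmod y)\<^sup>2" for x y
  proof -
    have "0 \<le> cmod x * cmod y" by simp
    moreover have "2 * (cmod x * cmod y) \<le> (cmod x)\<^sup>2 + (cmod y)\<^sup>2"
      using sum_squares_bound[of "cmod x" "cmod y"] by (simp add: mult.assoc)
    ultimately show ?thesis
      unfolding norm_mult complex_mod_cnj by linarith
  qed
  then have "(\<lambda>i. cmod (a i * cnj (b i))) summable_on UNIV"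
    by (rule Infinite_Sum.abs_summable_on_comparison_test'[OF s])
  then show ?thesis
    by (rule abs_summable_summable)
qed

lemma expansion_zero: "expansion D e (\<lambda>_. 0) (\<lambda>_. 0)"
  by (simp add: expansion_def square_summable_zero)

lemma expansion_add:
  assumes "expansion D e a f" "expansion D e b g"
  shows "expansion D e (\<lambda>i. a i + b i) (\<lambda>x. f x + g x)"
proof -
  have "((\<lambda>i. (a i + b i) * e i x) has_sum f x + g x) UNIV" if "x \<in> D" for x
    using assms that
      has_sum_add[where f = "\<lambda>i. a i * e i x" and g = "\<lambda>i. b i * e i x" and A = UNIV]
    unfolding expansion_def by (simp add: distrib_right)
  with assms show ?thesis
    unfolding expansion_def by (simp add: square_summable_add)
qed

lemma expansion_scale:
  assumes "expansion D e a f"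
  shows "expansion D e (\<lambda>i. c * a i) (\<lambda>x. c * f x)"
  using assms unfolding expansion_def
  by (simp add: square_summable_scale mult.assoc has_sum_cmult_right)

lemma expansion_eqI:
  assumes "expansion D e a f" "expansion D e a g"
  shows "f = g"
proof
  fix x show "f x = g x"
  proof (cases "x \<in> D")
    case True
    then have "((\<lambda>i. a i * e i x) has_sum f x) UNIV" "((\<lambda>i. a i * e i x) has_sum g x) UNIV"
      using assms unfolding expansion_def by simp_all
    then show ?thesis by (rule has_sum_unique)
  qed (use assms in \<open>simp add: expansion_def\<close>)
qed

lemma power_coeffs_zero:
  fixes a :: "nat \<Rightarrow> complex"
  assumes "\<And>z. norm z < 1 \<Longrightarrow> ((\<lambda>n. a n * z ^ n) has_sum 0) UNIV"
  shows "a n = 0"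
proof -
  have s: "(\<lambda>n. a n * z ^ n) sums 0" if "norm z < 1" for z
    using assms[OF that] by (rule has_sum_imp_sums)
  have "Abs_fps a = 0"
  proof (rule eval_fps_eqD)
    have "summable (\<lambda>n. fps_nth (Abs_fps a) n * (1/2) ^ n)"
      using sums_summable[OF s[of "1/2"]] by (simp add: norm_divide)
    then have "ereal (norm (1/2 :: complex)) \<le> fps_conv_radius (Abs_fps a)"
      unfolding fps_conv_radius_def by (rule conv_radius_geI)
    moreover have "0 < ereal (norm (1/2 :: complex))"
      by (simp add: norm_divide)
    ultimately show "fps_conv_radius (Abs_fps a) > 0"
      by (rule less_le_trans[rotated])
    show "fps_conv_radius (0 :: complex fps) > 0"
      by simp
    have "\<forall>\<^sub>F z in nhds 0. z \<in> ball (0::complex) 1"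
      by (intro eventually_nhds_in_open) auto
    then show "\<forall>\<^sub>F z in nhds 0. eval_fps (Abs_fps a) z = eval_fps 0 z"
    proof (rule eventually_mono)
      fix z :: complex assume "z \<in> ball 0 1"
      then have "(\<Sum>n. a n * z ^ n) = 0"
        by (intro sums_unique[symmetric] s) simp
      then show "eval_fps (Abs_fps a) z = eval_fps 0 z"
        by (simp add: eval_fps_def)
    qed
  qed
  then have "fps_nth (Abs_fps a) n = fps_nth 0 n"
    by (rule arg_cong)
  then show ?thesis
    by simp
qed

lemma expansion1_coeffs_zero:
  assumes "expansion1 a (\<lambda>_. 0)"
  shows "a = (\<lambda>_. 0)"
  using assms power_coeffs_zero[of a] unfolding expansion_def by auto

lemma expansion2_coeffs_zero:
  assumes "expansion2 a (\<lambda>_. 0)"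
  shows "a = (\<lambda>_. 0)"
proof -
  have hs: "((\<lambda>k. a k * (z ^ fst k * w ^ snd k)) has_sum 0) (UNIV \<times> UNIV)"
    if "norm z < 1" "norm w < 1" for z w
    using assms that unfolding expansion_def by auto
  have inner_summable: "(\<lambda>n. a (m, n) * w ^ n) summable_on UNIV" if w: "norm w < 1" for m w
  proof -
    have "(\<lambda>(m, n). a (m, n) * ((1/2) ^ m * w ^ n)) summable_on (UNIV \<times> UNIV)"
      using hs[of "1/2" w] w by (force simp: case_prod_unfold summable_on_def)
    then have "(\<lambda>n. a (m, n) * ((1/2) ^ m * w ^ n)) summable_on UNIV"
      by (rule summable_on_SigmaD1) auto
    then have "(\<lambda>n. 2 ^ m * (a (m, n) * ((1/2) ^ m * w ^ n))) summable_on UNIV"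
      by (rule summable_on_cmult_right)
    then show ?thesis
      by (simp add: power_divide)
  qed
  define b where "b w m = infsum (\<lambda>n. a (m, n) * w ^ n) UNIV" for w m
  have b: "((\<lambda>n. a (m, n) * w ^ n) has_sum b w m) UNIV" if "norm w < 1" for w m
    unfolding b_def using inner_summable[OF that] by (rule has_sum_infsum)
  have "b w m = 0" if w: "norm w < 1" for w m
  proof (rule power_coeffs_zero)
    fix z :: complex assume z: "norm z < 1"
    show "((\<lambda>m. b w m * z ^ m) has_sum 0) UNIV"
    proof (rule has_sum_SigmaD[OF hs[OF z w]])
      fix m :: nat
      show "((\<lambda>n. a (m, n) * (z ^ fst (m, n) * w ^ snd (m, n))) has_sum b w m * z ^ m) UNIV"
        using has_sum_cmult_left[OF b[OF w], of m "z ^ m"] by (simp add: mult_ac)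
    qed
  qed
  then have "a (m, n) = 0" for m n
    using b by (intro power_coeffs_zero[of "\<lambda>n. a (m, n)"]) metis
  then show ?thesis
    by auto
qed

lemma expansion_unique:
  assumes zero: "\<And>a. expansion D e a (\<lambda>_. 0) \<Longrightarrow> a = (\<lambda>_. 0)"
    and "expansion D e a f" "expansion D e b f"
  shows "a = b"
proof -
  have "expansion D e (\<lambda>i. a i + (-1) * b i) (\<lambda>x. f x + (-1) * f x)"
    using assms(2,3) by (intro expansion_add expansion_scale)
  then have "(\<lambda>i. a i + (-1) * b i) = (\<lambda>_. 0)"
    by (intro zero) simp
  then show ?thesis
    by (simp add: fun_eq_iff)
qed

lemma expansion1_unique: "expansion1 a f \<Longrightarrow> expansion1 b f \<Longrightarrow> a = b"
  by (rule expansion_unique[OF expansion1_coeffs_zero])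
lemma expansion2_unique: "expansion2 a f \<Longrightarrow> expansion2 b f \<Longrightarrow> a = b"
  by (rule expansion_unique[OF expansion2_coeffs_zero])

text \<open>The spaces \<open>H\<^sup>2\<close> of the disc and of the bidisc.\<close>

typedef hardy1 = "{f. \<exists>a. expansion1 a f}" morphisms eval1 Abs_hardy1
  using expansion_zero by blast

typedef hardy2 = "{f. \<exists>a. expansion2 a f}" morphisms eval2 Abs_hardy2
  using expansion_zero by blast

setup_lifting type_definition_hardy1
setup_lifting type_definition_hardy2

definition coeff1 :: "hardy1 \<Rightarrow> nat \<Rightarrow> complex" where
  "coeff1 f = (THE a. expansion1 a (eval1 f))"

definition coeff2 :: "hardy2 \<Rightarrow> nat \<times> nat \<Rightarrow> complex" where
  "coeff2 f = (THE a. expansion2 a (eval2 f))"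

lemma expansion_coeff1: "expansion1 (coeff1 f) (eval1 f)"
proof -
  obtain a where a: "expansion1 a (eval1 f)"
    using eval1[of f] by auto
  show ?thesis
    unfolding coeff1_def
    by (rule theI[where P = "\<lambda>a. expansion1 a (eval1 f)", OF a])
       (erule expansion1_unique[OF _ a])
qed

lemma expansion_coeff2: "expansion2 (coeff2 f) (eval2 f)"
proof -
  obtain a where a: "expansion2 a (eval2 f)"
    using eval2[of f] by auto
  show ?thesis
    unfolding coeff2_def
    by (rule theI[where P = "\<lambda>a. expansion2 a (eval2 f)", OF a])
       (erule expansion2_unique[OF _ a])
qed

lemma coeff1_eqI: "expansion1 a (eval1 f) \<Longrightarrow> coeff1 f = a"
  by (rule expansion1_unique[OF expansion_coeff1])

lemma coeff2_eqI: "expansion2 a (eval2 f) \<Longrightarrow> coeff2 f = a"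
  by (rule expansion2_unique[OF expansion_coeff2])

lemma square_summable_coeff1: "square_summable (coeff1 f)"
  using expansion_coeff1 unfolding expansion_def by blast

lemma square_summable_coeff2: "square_summable (coeff2 f)"
  using expansion_coeff2 unfolding expansion_def by blast

lemma infsum_cnj_self:
  "infsum (\<lambda>i. a i * cnj (a i)) UNIV = of_real (infsum (\<lambda>i. (cmod (a i))\<^sup>2) UNIV)"
  if "square_summable a"
proof -
  have "((\<lambda>i. complex_of_real ((cmod (a i))\<^sup>2)) has_sum
      of_real (infsum (\<lambda>i. (cmod (a i))\<^sup>2) UNIV)) UNIV"
    using that unfolding square_summable_def by (intro has_sum_of_real has_sum_infsum)
  then show ?thesis
    by (intro infsumI) (simp only: complex_norm_square)
qed

lemma infsum_square_zero:
  assumes "square_summable a" "infsum (\<lambda>i. (cmod (a i))\<^sup>2) UNIV = 0"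
  shows "a = (\<lambda>_. 0)"
proof
  fix i
  have "(cmod (a i))\<^sup>2 = 0"
    using assms unfolding square_summable_def by (intro nonneg_infsum_le_0D[where A = UNIV]) auto
  then show "a i = 0" by simp
qed

instantiation hardy1 :: complex_inner
begin

lift_definition zero_hardy1 :: hardy1 is "\<lambda>_. 0"
  using expansion_zero by blast
lift_definition plus_hardy1 :: "hardy1 \<Rightarrow> hardy1 \<Rightarrow> hardy1" is "\<lambda>f g x. f x + g x"
  using expansion_add by blast
lift_definition scaleC_hardy1 :: "complex \<Rightarrow> hardy1 \<Rightarrow> hardy1" is "\<lambda>c f x. c * f x"
  using expansion_scale by blast
definition uminus_hardy1 :: "hardy1 \<Rightarrow> hardy1" where
  "uminus_hardy1 f = (-1) *\<^sub>C f"
definition minus_hardy1 :: "hardy1 \<Rightarrow> hardy1 \<Rightarrow> hardy1" where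
  "minus_hardy1 f g = f + (- g)"
definition scaleR_hardy1 :: "real \<Rightarrow> hardy1 \<Rightarrow> hardy1" where
  "scaleR_hardy1 r f = of_real r *\<^sub>C f"
definition cinner_hardy1 :: "hardy1 \<Rightarrow> hardy1 \<Rightarrow> complex" where
  "cinner_hardy1 f g = (\<Sum>\<^sub>\<infinity>n. coeff1 f n * cnj (coeff1 g n))"
definition inner_hardy1 :: "hardy1 \<Rightarrow> hardy1 \<Rightarrow> real" where
  "inner_hardy1 f g = Re (cinner f g)"
definition norm_hardy1 :: "hardy1 \<Rightarrow> real" where
  "norm_hardy1 f = sqrt (inner f f)"
definition sgn_hardy1 :: "hardy1 \<Rightarrow> hardy1" where
  "sgn_hardy1 f = inverse (norm f) *\<^sub>R f"
definition dist_hardy1 :: "hardy1 \<Rightarrow> hardy1 \<Rightarrow> real" where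
  "dist_hardy1 f g = norm (f - g)"
definition uniformity_hardy1 :: "(hardy1 \<times> hardy1) filter" where
  "uniformity_hardy1 = (INF e\<in>{0<..}. principal {(x, y). dist x y < e})"
definition open_hardy1 :: "hardy1 set \<Rightarrow> bool" where
  "open_hardy1 U \<longleftrightarrow> (\<forall>x\<in>U. \<forall>\<^sub>F (x', y) in uniformity. x' = x \<longrightarrow> y \<in> U)"

lemma coeff1_zero: "coeff1 0 = (\<lambda>_. 0)"
  by (rule coeff1_eqI) (transfer, rule expansion_zero)

lemma coeff1_add: "coeff1 (f + g) = (\<lambda>n. coeff1 f n + coeff1 g n)"
  by (rule coeff1_eqI) (simp add: plus_hardy1.rep_eq expansion_add expansion_coeff1)

lemma coeff1_scale: "coeff1 (c *\<^sub>C f) = (\<lambda>n. c * coeff1 f n)"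
  by (rule coeff1_eqI) (simp add: scaleC_hardy1.rep_eq expansion_scale expansion_coeff1)

lemma coeff1_inject:
  assumes "coeff1 f = coeff1 g"
  shows "f = g"
proof -
  have "eval1 f = eval1 g"
    using expansion_coeff1[of f] expansion_coeff1[of g] unfolding assms by (rule expansion_eqI)
  then show ?thesis
    by (simp add: eval1_inject)
qed

instance
proof
  fix f g h :: hardy1 and r s :: real and c d :: complex
  note S = square_summable_coeff1
  show "f + g + h = f + (g + h)" "f + g = g + f" "0 + f = f"
    by (transfer, simp add: algebra_simps)+
  show "- f + f = 0" unfolding uminus_hardy1_def by transfer simp
  show "f - g = f + - g" by (rule minus_hardy1_def)
  show sR: "r *\<^sub>R f = of_real r *\<^sub>C f" for r and f :: hardy1 by (rule scaleR_hardy1_def)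
  show "r *\<^sub>R (f + g) = r *\<^sub>R f + r *\<^sub>R g" "(r + s) *\<^sub>R f = r *\<^sub>R f + s *\<^sub>R f"
    "r *\<^sub>R s *\<^sub>R f = (r * s) *\<^sub>R f" "1 *\<^sub>R f = f"
    unfolding sR by (transfer, simp add: algebra_simps)+
  show "c *\<^sub>C (f + g) = c *\<^sub>C f + c *\<^sub>C g" "(c + d) *\<^sub>C f = c *\<^sub>C f + d *\<^sub>C f"
    "c *\<^sub>C (d *\<^sub>C f) = (c * d) *\<^sub>C f" "1 *\<^sub>C f = f"
    by (transfer, simp add: algebra_simps)+
  show "sgn f = inverse (norm f) *\<^sub>R f" by (rule sgn_hardy1_def)
  show "dist f g = norm (f - g)" by (rule dist_hardy1_def)
  show "uniformity = (INF e\<in>{0<..}. principal {(x :: hardy1, y). dist x y < e})"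
    by (rule uniformity_hardy1_def)
  show "open U \<longleftrightarrow> (\<forall>x\<in>U. \<forall>\<^sub>F (x', y) in uniformity. x' = x \<longrightarrow> y \<in> U)" for U :: "hardy1 set"
    by (rule open_hardy1_def)
  show I: "inner f g = Re (cinner f g)" for f g :: hardy1 by (rule inner_hardy1_def)
  show com: "cinner f g = cnj (cinner g f)" for f g :: hardy1
    unfolding cinner_hardy1_def by (simp flip: infsum_cnj add: mult.commute)
  show add: "cinner (f + g) h = cinner f h + cinner g h"
    unfolding cinner_hardy1_def coeff1_add ring_distribs
    by (intro infsum_add square_summable_mult_cnj S)
  show sc: "cinner (c *\<^sub>C f) g = c * cinner f g" for c
    unfolding cinner_hardy1_def coeff1_scale mult.assoc by (rule infsum_cmult_right')
  show "inner f g = inner g f" unfolding I by (subst com) simp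
  show "inner (f + g) h = inner f h + inner g h" unfolding I add by simp
  show "inner (r *\<^sub>R f) g = r * inner f g" unfolding I sR sc by simp
  have n: "inner f f = infsum (\<lambda>n. (cmod (coeff1 f n))\<^sup>2) UNIV"
    unfolding I cinner_hardy1_def by (simp add: infsum_cnj_self S)
  show "0 \<le> inner f f" unfolding n by (intro infsum_nonneg) simp
  show "inner f f = 0 \<longleftrightarrow> f = 0"
    unfolding n using infsum_square_zero[OF S, of f]
    by (auto simp: coeff1_zero intro: coeff1_inject)
  show "norm f = sqrt (inner f f)" by (rule norm_hardy1_def)
qed

end

instantiation hardy2 :: complex_inner
begin

lift_definition zero_hardy2 :: hardy2 is "\<lambda>_. 0"
  using expansion_zero by blast
lift_definition plus_hardy2 :: "hardy2 \<Rightarrow> hardy2 \<Rightarrow> hardy2" is "\<lambda>f g x. f x + g x"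
  using expansion_add by blast
lift_definition scaleC_hardy2 :: "complex \<Rightarrow> hardy2 \<Rightarrow> hardy2" is "\<lambda>c f x. c * f x"
  using expansion_scale by blast
definition uminus_hardy2 :: "hardy2 \<Rightarrow> hardy2" where
  "uminus_hardy2 f = (-1) *\<^sub>C f"
definition minus_hardy2 :: "hardy2 \<Rightarrow> hardy2 \<Rightarrow> hardy2" where
  "minus_hardy2 f g = f + (- g)"
definition scaleR_hardy2 :: "real \<Rightarrow> hardy2 \<Rightarrow> hardy2" where
  "scaleR_hardy2 r f = of_real r *\<^sub>C f"
definition cinner_hardy2 :: "hardy2 \<Rightarrow> hardy2 \<Rightarrow> complex" where
  "cinner_hardy2 f g = (\<Sum>\<^sub>\<infinity>k. coeff2 f k * cnj (coeff2 g k))"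
definition inner_hardy2 :: "hardy2 \<Rightarrow> hardy2 \<Rightarrow> real" where
  "inner_hardy2 f g = Re (cinner f g)"
definition norm_hardy2 :: "hardy2 \<Rightarrow> real" where
  "norm_hardy2 f = sqrt (inner f f)"
definition sgn_hardy2 :: "hardy2 \<Rightarrow> hardy2" where
  "sgn_hardy2 f = inverse (norm f) *\<^sub>R f"
definition dist_hardy2 :: "hardy2 \<Rightarrow> hardy2 \<Rightarrow> real" where
  "dist_hardy2 f g = norm (f - g)"
definition uniformity_hardy2 :: "(hardy2 \<times> hardy2) filter" where
  "uniformity_hardy2 = (INF e\<in>{0<..}. principal {(x, y). dist x y < e})"
definition open_hardy2 :: "hardy2 set \<Rightarrow> bool" where
  "open_hardy2 U \<longleftrightarrow> (\<forall>x\<in>U. \<forall>\<^sub>F (x', y) in uniformity. x' = x \<longrightarrow> y \<in> U)"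

lemma coeff2_zero: "coeff2 0 = (\<lambda>_. 0)"
  by (rule coeff2_eqI) (transfer, rule expansion_zero)

lemma coeff2_add: "coeff2 (f + g) = (\<lambda>k. coeff2 f k + coeff2 g k)"
  by (rule coeff2_eqI) (simp add: plus_hardy2.rep_eq expansion_add expansion_coeff2)

lemma coeff2_scale: "coeff2 (c *\<^sub>C f) = (\<lambda>k. c * coeff2 f k)"
  by (rule coeff2_eqI) (simp add: scaleC_hardy2.rep_eq expansion_scale expansion_coeff2)

lemma coeff2_inject:
  assumes "coeff2 f = coeff2 g"
  shows "f = g"
proof -
  have "eval2 f = eval2 g"
    using expansion_coeff2[of f] expansion_coeff2[of g] unfolding assms by (rule expansion_eqI)
  then show ?thesis
    by (simp add: eval2_inject)
qed

instance
proof
  fix f g h :: hardy2 and r s :: real and c d :: complex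
  note S = square_summable_coeff2
  show "f + g + h = f + (g + h)" "f + g = g + f" "0 + f = f"
    by (transfer, simp add: algebra_simps)+
  show "- f + f = 0" unfolding uminus_hardy2_def by transfer simp
  show "f - g = f + - g" by (rule minus_hardy2_def)
  show sR: "r *\<^sub>R f = of_real r *\<^sub>C f" for r and f :: hardy2 by (rule scaleR_hardy2_def)
  show "r *\<^sub>R (f + g) = r *\<^sub>R f + r *\<^sub>R g" "(r + s) *\<^sub>R f = r *\<^sub>R f + s *\<^sub>R f"
    "r *\<^sub>R s *\<^sub>R f = (r * s) *\<^sub>R f" "1 *\<^sub>R f = f"
    unfolding sR by (transfer, simp add: algebra_simps)+
  show "c *\<^sub>C (f + g) = c *\<^sub>C f + c *\<^sub>C g" "(c + d) *\<^sub>C f = c *\<^sub>C f + d *\<^sub>C f"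
    "c *\<^sub>C (d *\<^sub>C f) = (c * d) *\<^sub>C f" "1 *\<^sub>C f = f"
    by (transfer, simp add: algebra_simps)+
  show "sgn f = inverse (norm f) *\<^sub>R f" by (rule sgn_hardy2_def)
  show "dist f g = norm (f - g)" by (rule dist_hardy2_def)
  show "uniformity = (INF e\<in>{0<..}. principal {(x :: hardy2, y). dist x y < e})"
    by (rule uniformity_hardy2_def)
  show "open U \<longleftrightarrow> (\<forall>x\<in>U. \<forall>\<^sub>F (x', y) in uniformity. x' = x \<longrightarrow> y \<in> U)" for U :: "hardy2 set"
    by (rule open_hardy2_def)
  show I: "inner f g = Re (cinner f g)" for f g :: hardy2 by (rule inner_hardy2_def)
  show com: "cinner f g = cnj (cinner g f)" for f g :: hardy2
    unfolding cinner_hardy2_def by (simp flip: infsum_cnj add: mult.commute)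
  show add: "cinner (f + g) h = cinner f h + cinner g h"
    unfolding cinner_hardy2_def coeff2_add ring_distribs
    by (intro infsum_add square_summable_mult_cnj S)
  show sc: "cinner (c *\<^sub>C f) g = c * cinner f g" for c
    unfolding cinner_hardy2_def coeff2_scale mult.assoc by (rule infsum_cmult_right')
  show "inner f g = inner g f" unfolding I by (subst com) simp
  show "inner (f + g) h = inner f h + inner g h" unfolding I add by simp
  show "inner (r *\<^sub>R f) g = r * inner f g" unfolding I sR sc by simp
  have n: "inner f f = infsum (\<lambda>n. (cmod (coeff2 f n))\<^sup>2) UNIV"
    unfolding I cinner_hardy2_def by (simp add: infsum_cnj_self S)
  show "0 \<le> inner f f" unfolding n by (intro infsum_nonneg) simp
  show "inner f f = 0 \<longleftrightarrow> f = 0"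
    unfolding n using infsum_square_zero[OF S, of f]
    by (auto simp: coeff2_zero intro: coeff2_inject)
  show "norm f = sqrt (inner f f)" by (rule norm_hardy2_def)
qed

end

section \<open>Multiplication operators and tensor products\<close>

lemma expansion_shift:
  assumes "expansion D e a f" and inj: "inj s" and e: "\<And>i x. e (s i) x = \<phi> x * e i x"
  shows "\<exists>b. expansion D e b (\<lambda>x. \<phi> x * f x)"
proof -
  define b where "b i = (if i \<in> range s then a (inv s i) else 0)" for i
  have bs: "b (s i) = a i" for i
    using inj by (simp add: b_def)
  have "(\<lambda>i. (cmod (b i))\<^sup>2) summable_on range s"
    using assms(1) inj unfolding expansion_def square_summable_def
    by (subst summable_on_reindex) (auto simp: o_def bs)
  then have 1: "square_summable b"
    unfolding square_summable_def
    by (subst summable_on_cong_neutral[where T = "range s" and g = "\<lambda>i. (cmod (b i))\<^sup>2"])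
       (auto simp: b_def)
  have "((\<lambda>i. b i * e i x) has_sum \<phi> x * f x) UNIV" if "x \<in> D" for x
  proof -
    have "((\<lambda>i. \<phi> x * (a i * e i x)) has_sum \<phi> x * f x) UNIV"
      using assms(1) that unfolding expansion_def by (intro has_sum_cmult_right) auto
    then have "((\<lambda>i. b i * e i x) has_sum \<phi> x * f x) (range s)"
      using inj by (subst has_sum_reindex) (auto simp: o_def bs e mult_ac)
    then show ?thesis
      by (subst has_sum_cong_neutral[where T = "range s" and g = "\<lambda>i. b i * e i x"])
         (auto simp: b_def)
  qed
  with 1 assms(1) show ?thesis
    unfolding expansion_def by (intro exI[of _ b]) auto
qed

lift_definition mult_z :: "hardy1 \<Rightarrow> hardy1" is "\<lambda>f z. z * f z"
  using expansion_shift[where s = Suc and D = unit_disc and e = monom1 and \<phi> = "\<lambda>z. z"]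
  by auto

text \<open>The operators \<open>M\<^sub>1\<close> and \<open>M\<^sub>2\<close>, multiplication by the first and the second coordinate.\<close>

lift_definition mult_1 :: "hardy2 \<Rightarrow> hardy2" is "\<lambda>f p. fst p * f p"
  using expansion_shift[where s = "map_prod Suc id" and D = "unit_disc \<times> unit_disc"
      and e = monom2 and \<phi> = fst]
  by (auto simp: prod.inj_map mult.assoc)

lift_definition mult_2 :: "hardy2 \<Rightarrow> hardy2" is "\<lambda>f p. snd p * f p"
  using expansion_shift[where s = "map_prod id Suc" and D = "unit_disc \<times> unit_disc"
      and e = monom2 and \<phi> = snd]
  by (auto simp: prod.inj_map mult_ac)

lemma expansion_tensor:
  assumes f: "expansion1 a f" and g: "expansion1 b g"
  shows "expansion2 (\<lambda>k. a (fst k) * b (snd k)) (\<lambda>p. f (fst p) * g (snd p))"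
proof -
  have prod: "((\<lambda>k. u (fst k) * v (snd k)) has_sum x * y) UNIV"
    if u: "(u has_sum x) UNIV" and v: "(v has_sum y) UNIV"
    for u v :: "nat \<Rightarrow> complex" and x y
  proof -
    have au: "(\<lambda>m. norm (u m)) summable_on UNIV" and av: "(\<lambda>n. norm (v n)) summable_on UNIV"
      using u v summable_on_iff_abs_summable_on_complex by (auto simp: summable_on_def)
    have "(\<lambda>k. norm (u (fst k) * v (snd k))) summable_on (UNIV \<times> UNIV)"
    proof (rule summable_on_SigmaI)
      show "((\<lambda>n. norm (u (fst (m, n)) * v (snd (m, n)))) has_sum
          norm (u m) * infsum (\<lambda>n. norm (v n)) UNIV) UNIV" for m
        using has_sum_cmult_right[OF has_sum_infsum[OF av], of "norm (u m)"]
        by (simp add: norm_mult)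
      show "(\<lambda>m. norm (u m) * infsum (\<lambda>n. norm (v n)) UNIV) summable_on UNIV"
        using au by (rule summable_on_cmult_left)
    qed auto
    then have s: "(\<lambda>k. u (fst k) * v (snd k)) summable_on (UNIV \<times> UNIV)"
      by (rule abs_summable_summable)
    have "((\<lambda>k. u (fst k) * v (snd k)) has_sum x * y) (UNIV \<times> UNIV)"
      by (rule has_sum_SigmaI[where g = "\<lambda>m. u m * y"])
         (use s has_sum_cmult_right[OF v] has_sum_cmult_left[OF u] in auto)
    then show ?thesis
      by simp
  qed
  have "square_summable (\<lambda>k. a (fst k) * b (snd k))"
  proof -
    have sa: "(\<lambda>m. (cmod (a m))\<^sup>2) summable_on UNIV" and sb: "(\<lambda>n. (cmod (b n))\<^sup>2) summable_on UNIV"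
      using f g unfolding expansion_def square_summable_def by auto
    have "(\<lambda>k. (cmod (a (fst k) * b (snd k)))\<^sup>2) summable_on (UNIV \<times> UNIV)"
    proof (rule summable_on_SigmaI)
      show "((\<lambda>n. (cmod (a (fst (m, n)) * b (snd (m, n))))\<^sup>2) has_sum
          (cmod (a m))\<^sup>2 * infsum (\<lambda>n. (cmod (b n))\<^sup>2) UNIV) UNIV" for m
        using has_sum_cmult_right[OF has_sum_infsum[OF sb], of "(cmod (a m))\<^sup>2"]
        by (simp add: norm_mult power_mult_distrib)
      show "(\<lambda>m. (cmod (a m))\<^sup>2 * infsum (\<lambda>n. (cmod (b n))\<^sup>2) UNIV) summable_on UNIV"
        using sa by (rule summable_on_cmult_left)
    qed auto
    then show ?thesis
      by (simp add: square_summable_def)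
  qed
  moreover have "((\<lambda>k. a (fst k) * b (snd k) * monom2 k p) has_sum f (fst p) * g (snd p)) UNIV"
    if "p \<in> unit_disc \<times> unit_disc" for p
  proof -
    have "((\<lambda>k. (a (fst k) * fst p ^ fst k) * (b (snd k) * snd p ^ snd k))
        has_sum f (fst p) * g (snd p)) UNIV"
      using f g that unfolding expansion_def by (intro prod) auto
    then show ?thesis
      by (simp add: mult_ac)
  qed
  moreover have "f (fst p) * g (snd p) = 0" if "p \<notin> unit_disc \<times> unit_disc" for p
    using f g that unfolding expansion_def by (cases p) auto
  ultimately show ?thesis
    unfolding expansion_def by blast
qed

lift_definition tensor :: "hardy1 \<Rightarrow> hardy1 \<Rightarrow> hardy2" is "\<lambda>f g p. f (fst p) * g (snd p)"
  using expansion_tensor by blast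

text \<open>The Hilbert space tensor product of two subspaces.\<close>

definition tensor_space :: "hardy1 set \<Rightarrow> hardy1 set \<Rightarrow> hardy2 set" where
  "tensor_space A B = closure (complex_vs.span {tensor f g | f g. f \<in> A \<and> g \<in> B})"

section \<open>Quotient modules\<close>

definition quotient_module1 :: "hardy1 set \<Rightarrow> bool" where
  "quotient_module1 Q \<longleftrightarrow> closed Q \<and> complex_vs.subspace Q \<and>
     (\<forall>f\<in>Q. adjoint_on UNIV mult_z f \<in> Q)"

definition quotient_module2 :: "hardy2 set \<Rightarrow> bool" where
  "quotient_module2 Q \<longleftrightarrow> closed Q \<and> complex_vs.subspace Q \<and>
     (\<forall>f\<in>Q. adjoint_on UNIV mult_1 f \<in> Q) \<and> (\<forall>f\<in>Q. adjoint_on UNIV mult_2 f \<in> Q)"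

definition doubly_commuting :: "hardy2 set \<Rightarrow> bool" where
  "doubly_commuting Q \<longleftrightarrow>
     (let Q\<^sub>1 = compression Q mult_1; Q\<^sub>2 = compression Q mult_2
      in \<forall>f\<in>Q. adjoint_on Q Q\<^sub>1 (Q\<^sub>2 f) = Q\<^sub>2 (adjoint_on Q Q\<^sub>1 f))"

definition phi_doubly_commuting :: "hardy2 set \<Rightarrow> bool" where
  "phi_doubly_commuting Q \<longleftrightarrow>
     (let Q\<^sub>1 = compression Q mult_1; Q\<^sub>2 = compression Q mult_2
      in \<forall>f\<in>Q. Q\<^sub>1 (Q\<^sub>2 (adjoint_on Q Q\<^sub>2 f)) = adjoint_on Q Q\<^sub>2 (Q\<^sub>1 (Q\<^sub>2 f)))"

section \<open>Inner functions\<close>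

text \<open>Only the values on the unit disc of the functions below matter.\<close>

definition inner_function :: "(complex \<Rightarrow> complex) \<Rightarrow> bool" where
  "inner_function \<theta> \<longleftrightarrow> \<theta> holomorphic_on unit_disc \<and> bounded (\<theta> ` unit_disc) \<and>
     (AE t in lebesgue_on {0..2*pi}.
        \<exists>l. ((\<lambda>r. \<theta> (of_real r * cis t)) \<longlongrightarrow> l) (at_left 1) \<and> cmod l = 1)"

definition disc_automorphism :: "complex \<Rightarrow> complex \<Rightarrow> complex \<Rightarrow> complex" where
  "disc_automorphism c a = (\<lambda>z. c * ((z - a) / (1 - cnj a * z)))"

text \<open>\<open>\<theta>H\<^sup>2\<close>, for \<open>\<theta>\<close> bounded and holomorphic on the disc.\<close>

definition mult_range :: "(complex \<Rightarrow> complex) \<Rightarrow> hardy1 set" where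
  "mult_range \<theta> = {h. \<exists>f. \<forall>z\<in>unit_disc. eval1 h z = \<theta> z * eval1 f z}"

end

theory Submission
  imports Defs "HOL-Complex_Analysis.Complex_Analysis"
begin

text \<open>Let \<open>A\<close> and \<open>B\<close> be the compressions of the shift to \<open>Q\<^sub>1\<close> and \<open>Q\<^sub>2\<close>. On the tensor product
  the two compressed coordinate multiplications are \<open>A \<otimes> I\<close> and \<open>I \<otimes> B\<close>, so the identity that
  defines \<open>\<phi>\<close>-double commutativity reads \<open>A \<otimes> B B* = A \<otimes> B* B\<close>. It holds if and only if
  \<open>A = 0\<close> or \<open>B\<close> is normal (\<open>phi_doubly_commuting_tensor_iff\<close>).

  The adjoints of \<open>A\<close> and \<open>B\<close> are restrictions of the backward shift. Hence \<open>A = 0\<close> means that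
  \<open>Q\<^sub>1\<close> consists of the constants (\<open>quotient_module.compressed_shift_eq_0_iff\<close>). Normality of
  \<open>B\<close> means that \<open>Q\<^sub>2\<close> is the line spanned by one kernel function
  (\<open>quotient_module.normal_iff\<close>): the defect \<open>I - B B*\<close> has rank one, spanned by the
  projection \<open>k\<close> of \<open>1\<close>, a normal \<open>B\<close> respects it, so \<open>k\<close> is an eigenvector of the backward
  shift, and its complement in \<open>Q\<^sub>2\<close> is zero. The line of the kernel function at \<open>a\<close> is the
  orthogonal complement of the range of multiplication by a disc automorphism vanishing at \<open>a\<close>
  (\<open>orth_complement_disc_automorphism_range\<close>); for \<open>a = 0\<close> it consists of the constants.

  The other factor is then an arbitrary nonzero quotient module. By Beurling's theorem
  (\<open>beurling\<close>) it is the whole space or \<open>H\<^sup>2 \<ominus> \<theta> H\<^sup>2\<close> for an inner function \<open>\<theta>\<close>. The proof of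
  Beurling's theorem works with norms and inner products only and produces a function of norm
  one that is bounded by one in the disc. That such a function is inner, with unimodular
  radial limits almost everywhere, is a form of Fatou's theorem
  (\<open>inner_function_of_norm_one\<close>). Its proof combines almost everywhere convergence along a
  fast sequence of radii with Lebesgue differentiation of the boundary values of an
  antiderivative.\<close>

section \<open>Orthogonal projections in complex Hilbert spaces\<close>

class complex_hilbert = complex_inner + complete_space

lemma cinner_diff_left: "cinner (x - y) z = cinner x z - cinner y z"
  using cinner_add_left[of "x - y" y z] by simp

lemma cinner_zero_left [simp]: "cinner 0 y = 0"
  using cinner_diff_left[of 0 0 y] by simp

lemma cinner_add_right: "cinner x (y + z) = cinner x y + cinner x z"
  by (metis cinner_add_left cinner_commute complex_cnj_add)

lemma cinner_diff_right: "cinner x (y - z) = cinner x y - cinner x z"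
  by (metis cinner_diff_left cinner_commute complex_cnj_diff)

lemma cinner_zero_right [simp]: "cinner x 0 = 0"
  using cinner_diff_right[of x 0 0] by simp

lemma cinner_scaleC_right: "cinner x (c *\<^sub>C y) = cnj c * cinner x y"
  by (metis cinner_scaleC_left cinner_commute complex_cnj_mult)

lemma cinner_eq_0_commute: "cinner x y = 0 \<longleftrightarrow> cinner y x = 0"
  by (metis cinner_commute complex_cnj_zero)

lemma cinner_self: "cinner x x = of_real ((norm x)\<^sup>2)"
proof (rule complex_eqI)
  show "Re (cinner x x) = Re (of_real ((norm x)\<^sup>2))"
    by (simp add: power2_norm_eq_inner inner_eq_Re_cinner)
  show "Im (cinner x x) = Im (of_real ((norm x)\<^sup>2))"
    using arg_cong[OF cinner_commute[of x x], of Im] by simp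
qed

lemma cinner_self_eq_0 [simp]: "cinner x x = 0 \<longleftrightarrow> x = 0"
  unfolding cinner_self of_real_eq_0_iff by simp

lemma norm_scaleC: "norm (c *\<^sub>C x) = cmod c * norm (x :: 'a::complex_inner)"
proof -
  have "complex_of_real ((norm (c *\<^sub>C x))\<^sup>2) = of_real ((cmod c * norm x)\<^sup>2)"
    unfolding cinner_self[symmetric] cinner_scaleC_left cinner_scaleC_right
    by (simp add: cinner_self power_mult_distrib complex_norm_square mult_ac flip: of_real_power)
  then show ?thesis
    unfolding of_real_eq_iff by (simp add: power2_eq_iff_nonneg)
qed

text \<open>A unimodular factor makes the complex form real, which reduces the claim to the real
  Cauchy-Schwarz inequality.\<close>

lemma norm_cinner_le: "cmod (cinner x y) \<le> norm x * norm (y :: 'a::complex_inner)"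
proof -
  obtain u where u: "cmod u = 1" "u * cinner x y = of_real (cmod (cinner x y))"
  proof (cases "cinner x y = 0")
    case True
    then show ?thesis using that[of 1] by simp
  next
    case False
    define u where "u = cnj (cinner x y) / of_real (cmod (cinner x y))"
    have "u * cinner x y = of_real (cmod (cinner x y))"
      using False by (simp add: u_def field_simps complex_norm_square[symmetric] power2_eq_square)
    moreover have "cmod u = 1"
      using False by (simp add: u_def norm_divide)
    ultimately show ?thesis using that by blast
  qed
  have "cmod (cinner x y) = inner (u *\<^sub>C x) y"
    unfolding inner_eq_Re_cinner cinner_scaleC_left u(2) by simp
  also have "\<dots> \<le> norm (u *\<^sub>C x) * norm y"
    by (rule norm_cauchy_schwarz)
  finally show ?thesis
    by (simp add: norm_scaleC u(1))
qed

lemma bounded_linear_cinner_left: "bounded_linear (\<lambda>x. cinner x (y :: 'a::complex_inner))"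
  by (rule bounded_linear_intro[where K = "norm y"])
     (simp_all add: cinner_add_left scaleR_eq_scaleC cinner_scaleC_left scaleR_conv_of_real
        norm_cinner_le)

lemma bounded_linear_cinner_right: "bounded_linear (\<lambda>y. cinner (x :: 'a::complex_inner) y)"
  by (rule bounded_linear_intro[where K = "norm x"])
     (simp_all add: cinner_add_right scaleR_eq_scaleC cinner_scaleC_right scaleR_conv_of_real
        norm_cinner_le mult.commute[of _ "norm x"])

lemmas tendsto_cinner_left = bounded_linear.tendsto[OF bounded_linear_cinner_left]

lemma norm_add_square_orth:
  assumes "cinner x y = 0"
  shows "(norm (x + y))\<^sup>2 = (norm x)\<^sup>2 + (norm (y :: 'a::complex_inner))\<^sup>2"
  using assms by (simp add: power2_norm_eq_inner inner_add_left inner_add_right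
      inner_commute[of y x] inner_eq_Re_cinner[of x y])

lemma subspace_orth_complement: "complex_vs.subspace (orth_complement S)"
  unfolding complex_vs.subspace_def orth_complement_def
  by (simp add: cinner_add_left cinner_scaleC_left)

lemma closed_orth_complement: "closed (orth_complement (S :: 'a::complex_inner set))"
proof -
  have "orth_complement S = (\<Inter>y\<in>S. {x. cinner x y = 0})"
    by (auto simp: orth_complement_def)
  moreover have "closed {x. cinner x y = 0}" for y :: 'a
    by (intro closed_Collect_eq linear_continuous_on bounded_linear_cinner_left continuous_on_const)
  ultimately show ?thesis by (simp add: closed_INT)
qed

lemma orth_complement_antimono: "S \<subseteq> T \<Longrightarrow> orth_complement T \<subseteq> orth_complement S"
  by (auto simp: orth_complement_def)

lemma subset_orth_complement_twice: "S \<subseteq> orth_complement (orth_complement S)"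
  unfolding orth_complement_def by (auto simp: cinner_eq_0_commute)

lemma orth_complement_disjoint: "x \<in> S \<Longrightarrow> x \<in> orth_complement S \<Longrightarrow> x = 0"
  unfolding orth_complement_def by (metis (mono_tags, lifting) cinner_self_eq_0 mem_Collect_eq)

lemma cinner_zero_on_closure_span:
  fixes x :: "'a::complex_inner"
  assumes "\<And>y. y \<in> S \<Longrightarrow> cinner x y = 0" and "y \<in> closure (complex_vs.span S)"
  shows "cinner x y = 0"
proof -
  have "S \<subseteq> orth_complement {x}"
    using assms(1) by (auto simp: orth_complement_def cinner_eq_0_commute)
  then have "complex_vs.span S \<subseteq> orth_complement {x}"
    by (rule complex_vs.span_minimal) (rule subspace_orth_complement)
  then have "closure (complex_vs.span S) \<subseteq> orth_complement {x}"
    by (rule closure_minimal) (rule closed_orth_complement)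
  then show ?thesis
    using assms(2) by (auto simp: orth_complement_def cinner_eq_0_commute)
qed

text \<open>A minimizing sequence in \<open>Q\<close> is a Cauchy sequence by the parallelogram law, and its limit is
  the foot of the perpendicular.\<close>

lemma ex_orth_proj:
  fixes x :: "'a::complex_hilbert"
  assumes "closed Q" "complex_vs.subspace Q"
  shows "\<exists>p. p \<in> Q \<and> x - p \<in> orth_complement Q"
proof -
  have Q0: "0 \<in> Q" and Qadd: "\<And>u v. u \<in> Q \<Longrightarrow> v \<in> Q \<Longrightarrow> u + v \<in> Q"
    and Qsc: "\<And>c u. u \<in> Q \<Longrightarrow> c *\<^sub>C u \<in> Q"
    using assms(2) by (auto simp: complex_vs.subspace_def)
  define d where "d = infdist x Q"
  have d_le: "d \<le> norm (x - y)" if "y \<in> Q" for y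
    using infdist_le[OF that, of x] by (simp add: d_def dist_norm)
  have d0: "0 \<le> d" by (simp add: d_def infdist_nonneg)
  have "\<exists>p. p \<in> Q \<and> (norm (x - p))\<^sup>2 < d\<^sup>2 + 1 / Suc n" for n
  proof -
    have "d < sqrt (d\<^sup>2 + 1 / Suc n)"
      using d0 by (intro real_less_rsqrt) simp
    then obtain p where "p \<in> Q" "dist x p < sqrt (d\<^sup>2 + 1 / Suc n)"
      using cInf_lessD[of "dist x ` Q" "sqrt (d\<^sup>2 + 1 / Suc n)"] Q0
      by (metis d_def empty_iff image_iff image_is_empty infdist_def)
    moreover from this have "(norm (x - p))\<^sup>2 < (sqrt (d\<^sup>2 + 1 / Suc n))\<^sup>2"
      by (intro power_strict_mono) (auto simp: dist_norm)
    ultimately show ?thesis by (auto simp: add_nonneg_nonneg)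
  qed
  then obtain p where pQ: "\<And>n. p n \<in> Q" and pd: "\<And>n. (norm (x - p n))\<^sup>2 < d\<^sup>2 + 1 / Suc n"
    by metis
  \<comment> \<open>The midpoint of two almost minimal points of \<open>Q\<close> lies in \<open>Q\<close>, so it is not closer to \<open>x\<close> than
    \<open>d\<close>.\<close>
  have diff: "(norm (p m - p n))\<^sup>2 \<le> 2 / Suc m + 2 / Suc n" for m n
  proof -
    define q where "q = (1/2 :: complex) *\<^sub>C (p m + p n)"
    have "q \<in> Q" unfolding q_def by (intro Qsc Qadd pQ)
    have q: "q = (1/2 :: real) *\<^sub>R (p m + p n)"
      by (simp add: q_def scaleR_eq_scaleC)
    have "(norm (p m - p n))\<^sup>2 + 4 * (norm (x - q))\<^sup>2 = 2 * (norm (x - p m))\<^sup>2 + 2 * (norm (x - p n))\<^sup>2"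
      unfolding q power2_norm_eq_inner
      by (simp add: inner_add_left inner_add_right inner_diff_left inner_diff_right inner_commute
          algebra_simps)
    moreover have "d\<^sup>2 \<le> (norm (x - q))\<^sup>2"
      using d_le[OF \<open>q \<in> Q\<close>] d0 by (intro power_mono)
    ultimately show ?thesis
      using pd[of m] pd[of n] by simp
  qed
  have "Cauchy p"
  proof (rule metric_CauchyI)
    fix e :: real assume e: "0 < e"
    obtain N where N: "4 / e\<^sup>2 < real (Suc N)"
      using reals_Archimedean2 less_trans of_nat_less_iff lessI by metis
    have "dist (p m) (p n) < e" if "N \<le> m" "N \<le> n" for m n
    proof -
      have "(2 :: real) / Suc m \<le> 2 / Suc N" "(2 :: real) / Suc n \<le> 2 / Suc N"
        using that by (simp_all add: frac_le)
      then have "(norm (p m - p n))\<^sup>2 \<le> 4 / Suc N"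
        using diff[of m n] by simp
      also have "\<dots> < e\<^sup>2"
        using N e by (simp add: field_simps)
      finally show ?thesis
        unfolding dist_norm using e by (simp add: power_less_imp_less_base)
    qed
    then show "\<exists>M. \<forall>m\<ge>M. \<forall>n\<ge>M. dist (p m) (p n) < e" by blast
  qed
  then obtain l where l: "p \<longlonglongrightarrow> l"
    using Cauchy_convergent convergent_def by blast
  have lQ: "l \<in> Q"
    using closed_sequentially[OF assms(1) _ l] pQ by blast
  have "(norm (x - l))\<^sup>2 \<le> d\<^sup>2"
  proof (rule LIMSEQ_le)
    show "(\<lambda>n. (norm (x - p n))\<^sup>2) \<longlonglongrightarrow> (norm (x - l))\<^sup>2"
      by (intro tendsto_intros l)
    show "(\<lambda>n. d\<^sup>2 + 1 / Suc n) \<longlonglongrightarrow> d\<^sup>2"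
      using tendsto_add[OF tendsto_const LIMSEQ_inverse_real_of_nat, of "d\<^sup>2"]
      by (simp add: inverse_eq_divide)
    show "\<exists>N. \<forall>n\<ge>N. (norm (x - p n))\<^sup>2 \<le> d\<^sup>2 + 1 / Suc n"
      using pd less_imp_le by blast
  qed
  then have min: "(norm (x - l))\<^sup>2 \<le> (norm (x - l - c *\<^sub>C y))\<^sup>2" if "y \<in> Q" for c y
  proof -
    have "d \<le> norm (x - (l + c *\<^sub>C y))"
      using that by (intro d_le Qadd Qsc lQ)
    then have "d\<^sup>2 \<le> (norm (x - l - c *\<^sub>C y))\<^sup>2"
      using d0 by (intro power_mono) (auto simp: algebra_simps)
    then show ?thesis
      using \<open>(norm (x - l))\<^sup>2 \<le> d\<^sup>2\<close> by linarith
  qed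
  have "cinner (x - l) y = 0" if "y \<in> Q" for y
  proof (cases "y = 0")
    case False
    define v where "v = x - l"
    define c where "c = cinner v y / cinner y y"
    have o: "cinner (v - c *\<^sub>C y) (c *\<^sub>C y) = 0"
      using False by (simp add: c_def cinner_diff_left cinner_scaleC_left cinner_scaleC_right)
    have "(norm v)\<^sup>2 = (norm (v - c *\<^sub>C y))\<^sup>2 + (norm (c *\<^sub>C y))\<^sup>2"
      using norm_add_square_orth[OF o] by simp
    moreover have "(norm v)\<^sup>2 \<le> (norm (v - c *\<^sub>C y))\<^sup>2"
      unfolding v_def by (rule min[OF that])
    ultimately have "c *\<^sub>C y = 0"
      by simp
    then have "c = 0" using False by (metis norm_eq_zero norm_scaleC mult_eq_0_iff)
    then show ?thesis using False by (simp add: c_def v_def)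
  qed simp
  with lQ show ?thesis
    unfolding orth_complement_def by blast
qed

locale closed_csubspace =
  fixes Q :: "'a::complex_hilbert set"
  assumes closed: "closed Q" and subspace: "complex_vs.subspace Q"
begin

lemma zero_mem: "0 \<in> Q"
  and add_mem: "x \<in> Q \<Longrightarrow> y \<in> Q \<Longrightarrow> x + y \<in> Q"
  and scaleC_mem: "x \<in> Q \<Longrightarrow> c *\<^sub>C x \<in> Q"
  using subspace by (auto simp: complex_vs.subspace_def)

lemma diff_mem: "x \<in> Q \<Longrightarrow> y \<in> Q \<Longrightarrow> x - y \<in> Q"
  using complex_vs.subspace_diff[OF subspace] by blast

lemma orth_proj_eqI:
  assumes "p \<in> Q" "x - p \<in> orth_complement Q"
  shows "orth_proj Q x = p"
  unfolding orth_proj_def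
proof (rule the_equality)
  fix p' assume p': "p' \<in> Q \<and> x - p' \<in> orth_complement Q"
  have "(x - p) - (x - p') \<in> orth_complement Q"
    using assms p' complex_vs.subspace_diff[OF subspace_orth_complement] by blast
  moreover have "p' - p \<in> Q"
    using assms p' diff_mem by blast
  ultimately have "p' - p = 0"
    by (intro orth_complement_disjoint[of "p' - p" Q]) simp_all
  then show "p' = p" by simp
qed (use assms in blast)

lemma orth_proj_mem: "orth_proj Q x \<in> Q"
  and diff_orth_proj: "x - orth_proj Q x \<in> orth_complement Q"
proof -
  obtain p where "p \<in> Q" "x - p \<in> orth_complement Q"
    using ex_orth_proj[OF closed subspace] by blast
  with orth_proj_eqI[OF this] show "orth_proj Q x \<in> Q" "x - orth_proj Q x \<in> orth_complement Q"
    by simp_all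
qed

lemma cinner_orth_proj: "y \<in> Q \<Longrightarrow> cinner (orth_proj Q x) y = cinner x y"
  using diff_orth_proj[of x] by (auto simp: orth_complement_def cinner_diff_left)

lemma cinner_orth_proj_right: "y \<in> Q \<Longrightarrow> cinner y (orth_proj Q x) = cinner y x"
  by (metis cinner_commute cinner_orth_proj)

lemma orth_proj_add: "orth_proj Q (x + y) = orth_proj Q x + orth_proj Q y"
proof (rule orth_proj_eqI)
  have "(x - orth_proj Q x) + (y - orth_proj Q y) \<in> orth_complement Q"
    using diff_orth_proj complex_vs.subspace_add[OF subspace_orth_complement] by blast
  then show "x + y - (orth_proj Q x + orth_proj Q y) \<in> orth_complement Q"
    by (simp add: algebra_simps)
qed (intro add_mem orth_proj_mem)

lemma orth_proj_diff: "orth_proj Q (x - y) = orth_proj Q x - orth_proj Q y"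
  using orth_proj_add[of "x - y" y] by simp

lemma orth_proj_id: "x \<in> Q \<Longrightarrow> orth_proj Q x = x"
  using complex_vs.subspace_0[OF subspace_orth_complement] by (intro orth_proj_eqI) simp_all

lemma orth_proj_scaleC: "orth_proj Q (c *\<^sub>C x) = c *\<^sub>C orth_proj Q x"
proof (rule orth_proj_eqI)
  have "c *\<^sub>C (x - orth_proj Q x) \<in> orth_complement Q"
    using diff_orth_proj complex_vs.subspace_scale[OF subspace_orth_complement] by blast
  then show "c *\<^sub>C x - c *\<^sub>C orth_proj Q x \<in> orth_complement Q"
    by (simp add: complex_vs.scale_right_diff_distrib)
qed (intro scaleC_mem orth_proj_mem)

lemma norm_orth_proj_le: "norm (orth_proj Q x) \<le> norm x"
proof -
  have "cinner (orth_proj Q x) (x - orth_proj Q x) = 0"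
    using cinner_orth_proj_right[OF orth_proj_mem] by (simp add: cinner_diff_right)
  then have "(norm x)\<^sup>2 = (norm (orth_proj Q x))\<^sup>2 + (norm (x - orth_proj Q x))\<^sup>2"
    using norm_add_square_orth by fastforce
  then show ?thesis
    using norm_ge_zero power2_le_imp_le by (metis le_add_same_cancel1 zero_le_power2)
qed

lemma bounded_linear_orth_proj: "bounded_linear (orth_proj Q)"
  by (rule bounded_linear_intro[where K = 1])
     (simp_all add: orth_proj_add scaleR_eq_scaleC orth_proj_scaleC norm_orth_proj_le)

lemma orth_complement_twice: "orth_complement (orth_complement Q) = Q"
proof
  show "orth_complement (orth_complement Q) \<subseteq> Q"
  proof
    fix x assume x: "x \<in> orth_complement (orth_complement Q)"
    have "orth_proj Q x \<in> orth_complement (orth_complement Q)"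
      using orth_proj_mem subset_orth_complement_twice by blast
    then have "x - orth_proj Q x \<in> orth_complement (orth_complement Q)"
      using x complex_vs.subspace_diff[OF subspace_orth_complement] by blast
    then have "x - orth_proj Q x = 0"
      using diff_orth_proj orth_complement_disjoint by blast
    then show "x \<in> Q" using orth_proj_mem[of x] by simp
  qed
qed (rule subset_orth_complement_twice)

lemma adjoint_on_eqI:
  assumes "v \<in> Q" "\<And>x. x \<in> Q \<Longrightarrow> cinner (T x) y = cinner x v"
  shows "adjoint_on Q T y = v"
  unfolding adjoint_on_def
proof (rule the_equality)
  fix v' assume v': "v' \<in> Q \<and> (\<forall>x\<in>Q. cinner (T x) y = cinner x v')"
  then have "v' - v \<in> Q" using assms diff_mem by blast
  then have "cinner (v' - v) (v' - v) = 0"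
    using v' assms by (simp add: cinner_diff_right)
  then show "v' = v" by simp
qed (use assms in blast)

text \<open>Inner products with vectors of \<open>Q\<close> do not see the projection in the compression, so a formal
  adjoint of \<open>T\<close> on the whole space serves as the adjoint of the compression wherever it stays
  in \<open>Q\<close>.\<close>

lemma adjoint_on_compression:
  assumes "T' y \<in> Q" "y \<in> Q" "\<And>x. cinner (T x) y = cinner x (T' y)"
  shows "adjoint_on Q (compression Q T) y = T' y"
  using assms by (intro adjoint_on_eqI) (simp_all add: compression_def cinner_orth_proj)

end

section \<open>Square summable coefficients\<close>

text \<open>Completeness of \<open>l\<^sup>2\<close>: the coordinatewise limit of a Cauchy sequence is its limit in norm,
  because a bound on all finite partial sums of squares survives coordinatewise limits.\<close>

lemma square_summable_complete:
  fixes X :: "nat \<Rightarrow> 'i \<Rightarrow> complex"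
  assumes ss: "\<And>n. square_summable (X n)"
    and cau: "\<And>e. e > 0 \<Longrightarrow> \<exists>N. \<forall>m\<ge>N. \<forall>n\<ge>N. (\<Sum>\<^sub>\<infinity>i. (cmod (X m i - X n i))\<^sup>2) < e"
  shows "\<exists>a. square_summable a \<and>
    (\<forall>e>0. \<exists>N. \<forall>n\<ge>N. (\<Sum>\<^sub>\<infinity>i. (cmod (X n i - a i))\<^sup>2) \<le> e)"
proof -
  have sd: "square_summable (\<lambda>i. u i - v i)" if "square_summable u" "square_summable v"
    for u v :: "'i \<Rightarrow> complex"
    using square_summable_add[OF that(1) square_summable_scale[OF that(2), of "-1"]] by simp
  have fin_le: "(\<Sum>i\<in>F. (cmod (X m i - X n i))\<^sup>2) \<le> (\<Sum>\<^sub>\<infinity>i. (cmod (X m i - X n i))\<^sup>2)"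
    if "finite F" for F m n
    using sd[OF ss ss] that unfolding square_summable_def by (intro finite_sum_le_infsum) auto
  have "Cauchy (\<lambda>n. X n i)" for i
  proof (rule metric_CauchyI)
    fix e :: real assume "0 < e"
    then obtain N where N: "\<forall>m\<ge>N. \<forall>n\<ge>N. (\<Sum>\<^sub>\<infinity>i. (cmod (X m i - X n i))\<^sup>2) < e\<^sup>2"
      using cau[of "e\<^sup>2"] by auto
    have "dist (X m i) (X n i) < e" if "m \<ge> N" "n \<ge> N" for m n
    proof -
      have "(cmod (X m i - X n i))\<^sup>2 < e\<^sup>2"
        using le_less_trans[OF fin_le[of "{i}" m n] N[rule_format, OF that]] by simp
      then show ?thesis
        using \<open>0 < e\<close> by (simp add: dist_norm power_less_imp_less_base)
    qed
    then show "\<exists>M. \<forall>m\<ge>M. \<forall>n\<ge>M. dist (X m i) (X n i) < e" by blast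
  qed
  then have "(\<lambda>n. X n i) \<longlonglongrightarrow> lim (\<lambda>n. X n i)" for i
    by (simp add: Cauchy_convergent_iff convergent_LIMSEQ_iff)
  then obtain a where a: "\<And>i. (\<lambda>n. X n i) \<longlonglongrightarrow> a i"
    by (rule that)
  have tail: "square_summable (\<lambda>i. X n i - a i) \<and> (\<Sum>\<^sub>\<infinity>i. (cmod (X n i - a i))\<^sup>2) \<le> e"
    if N: "\<forall>m\<ge>N. \<forall>n\<ge>N. (\<Sum>\<^sub>\<infinity>i. (cmod (X m i - X n i))\<^sup>2) < e" and n: "n \<ge> N" for N n e
  proof -
    have fin: "(\<Sum>i\<in>F. (cmod (X n i - a i))\<^sup>2) \<le> e" if "finite F" for F
    proof (rule LIMSEQ_le_const2)
      show "(\<lambda>m. \<Sum>i\<in>F. (cmod (X n i - X m i))\<^sup>2) \<longlonglongrightarrow> (\<Sum>i\<in>F. (cmod (X n i - a i))\<^sup>2)"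
        by (intro tendsto_intros a)
      show "\<exists>M. \<forall>m\<ge>M. (\<Sum>i\<in>F. (cmod (X n i - X m i))\<^sup>2) \<le> e"
        using N n fin_le[OF that] by (meson le_less_trans less_imp_le)
    qed
    have "(\<lambda>i. (cmod (X n i - a i))\<^sup>2) summable_on UNIV"
      by (rule nonneg_bdd_above_summable_on) (use fin in \<open>auto intro!: bdd_aboveI2\<close>)
    moreover from this have "(\<Sum>\<^sub>\<infinity>i. (cmod (X n i - a i))\<^sup>2) \<le> e"
      by (rule infsum_le_finite_sums) (use fin in auto)
    ultimately show ?thesis by (simp add: square_summable_def)
  qed
  have "square_summable a"
  proof -
    obtain N where "\<forall>m\<ge>N. \<forall>n\<ge>N. (\<Sum>\<^sub>\<infinity>i. (cmod (X m i - X n i))\<^sup>2) < 1"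
      using cau[of 1] by auto
    then have "square_summable (\<lambda>i. X N i - a i)" using tail by blast
    then have "square_summable (\<lambda>i. X N i - (X N i - a i))" by (rule sd[OF ss])
    then show ?thesis by simp
  qed
  moreover have "\<forall>e>0. \<exists>N. \<forall>n\<ge>N. (\<Sum>\<^sub>\<infinity>i. (cmod (X n i - a i))\<^sup>2) \<le> e"
  proof (intro allI impI)
    fix e :: real assume "e > 0"
    from cau[OF this] obtain N where "\<forall>m\<ge>N. \<forall>n\<ge>N. (\<Sum>\<^sub>\<infinity>i. (cmod (X m i - X n i))\<^sup>2) < e" ..
    from tail[OF this] show "\<exists>N. \<forall>n\<ge>N. (\<Sum>\<^sub>\<infinity>i. (cmod (X n i - a i))\<^sup>2) \<le> e" by blast
  qed
  ultimately show ?thesis by (intro exI[of _ a] conjI)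
qed

lemma square_summable_powers:
  fixes z :: complex
  assumes "cmod z < 1"
  shows "square_summable (\<lambda>n. z ^ n)"
proof -
  have "(\<lambda>n. ((cmod z)\<^sup>2) ^ n) summable_on UNIV"
    using assms by (intro summable_on_UNIV_nonneg_real_iff[THEN iffD2] summable_geometric)
      (auto simp: abs_square_less_1)
  then show ?thesis
    unfolding square_summable_def by (simp add: norm_power power_mult[symmetric] mult.commute)
qed

text \<open>The series converges absolutely at each point by the Cauchy-Schwarz inequality, since the
  monomials are themselves square summable there.\<close>

lemma ex_expansion:
  fixes e :: "'i \<Rightarrow> 'd \<Rightarrow> complex"
  assumes "square_summable a" and e: "\<And>x. x \<in> D \<Longrightarrow> square_summable (\<lambda>i. e i x)"
  shows "\<exists>f. expansion D e a f"
proof -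
  have cnj: "square_summable (\<lambda>i. cnj (e i x))" if "x \<in> D" for x
    using e[OF that] by (simp add: square_summable_def)
  have s: "(\<lambda>i. a i * e i x) summable_on UNIV" if "x \<in> D" for x
    using square_summable_mult_cnj[OF assms(1) cnj[OF that]] by simp
  have "expansion D e a (\<lambda>x. if x \<in> D then \<Sum>\<^sub>\<infinity>i. a i * e i x else 0)"
    using assms(1) s unfolding expansion_def by (auto intro: has_sum_infsum)
  then show ?thesis by blast
qed

lemma square_summable_monom2:
  assumes "cmod z < 1" "cmod w < 1"
  shows "square_summable (\<lambda>k. z ^ fst k * w ^ snd k)"
proof -
  have ex: "\<exists>f. expansion1 (\<lambda>n. u ^ n) f" if "cmod u < 1" for u
    by (rule ex_expansion) (use that square_summable_powers in auto)
  obtain f g where "expansion1 (\<lambda>n. z ^ n) f" "expansion1 (\<lambda>n. w ^ n) g"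
    using ex assms by metis
  from expansion_tensor[OF this] show ?thesis
    unfolding expansion_def by blast
qed

definition hardy1_of :: "(nat \<Rightarrow> complex) \<Rightarrow> hardy1" where
  "hardy1_of a = (SOME f. coeff1 f = a)"

definition hardy2_of :: "(nat \<times> nat \<Rightarrow> complex) \<Rightarrow> hardy2" where
  "hardy2_of a = (SOME f. coeff2 f = a)"

lemma coeff1_hardy1_of: "square_summable a \<Longrightarrow> coeff1 (hardy1_of a) = a"
proof -
  assume "square_summable a"
  then obtain f where f: "expansion1 a f"
    using ex_expansion[of a unit_disc monom1] square_summable_powers by auto
  then have "coeff1 (Abs_hardy1 f) = a"
    by (intro coeff1_eqI) (subst Abs_hardy1_inverse, auto)
  then show ?thesis unfolding hardy1_of_def by (rule someI)
qed

lemma coeff2_hardy2_of: "square_summable a \<Longrightarrow> coeff2 (hardy2_of a) = a"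
proof -
  assume "square_summable a"
  then obtain f where f: "expansion2 a f"
    using ex_expansion[of a "unit_disc \<times> unit_disc" monom2] square_summable_monom2 by auto
  then have "coeff2 (Abs_hardy2 f) = a"
    by (intro coeff2_eqI) (subst Abs_hardy2_inverse, auto)
  then show ?thesis unfolding hardy2_of_def by (rule someI)
qed

lemma norm_hardy1_square: "(norm f)\<^sup>2 = (\<Sum>\<^sub>\<infinity>n. (cmod (coeff1 f n))\<^sup>2)"
proof -
  have "complex_of_real ((norm f)\<^sup>2) = of_real (\<Sum>\<^sub>\<infinity>n. (cmod (coeff1 f n))\<^sup>2)"
    unfolding cinner_self[symmetric] cinner_hardy1_def
    by (rule infsum_cnj_self[OF square_summable_coeff1])
  then show ?thesis unfolding of_real_eq_iff .
qed

lemma norm_hardy2_square: "(norm f)\<^sup>2 = (\<Sum>\<^sub>\<infinity>n. (cmod (coeff2 f n))\<^sup>2)"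
proof -
  have "complex_of_real ((norm f)\<^sup>2) = of_real (\<Sum>\<^sub>\<infinity>n. (cmod (coeff2 f n))\<^sup>2)"
    unfolding cinner_self[symmetric] cinner_hardy2_def
    by (rule infsum_cnj_self[OF square_summable_coeff2])
  then show ?thesis unfolding of_real_eq_iff .
qed

lemma coeff1_diff: "coeff1 (f - g) n = coeff1 f n - coeff1 g n"
  using coeff1_add[of "f - g" g] by simp

lemma coeff2_diff: "coeff2 (f - g) n = coeff2 f n - coeff2 g n"
  using coeff2_add[of "f - g" g] by simp

text \<open>Both Hardy spaces are isometric to a space of square summable families by means of their
  coefficients; the lemma transports completeness along such an isometry.\<close>

lemma convergent_if_coefficients_complete:
  fixes X :: "nat \<Rightarrow> 'a::complex_inner" and coeff :: "'a \<Rightarrow> 'i \<Rightarrow> complex"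
  assumes ss: "\<And>f. square_summable (coeff f)"
    and diff: "\<And>f g i. coeff (f - g) i = coeff f i - coeff g i"
    and nm: "\<And>f. (norm f)\<^sup>2 = (\<Sum>\<^sub>\<infinity>i. (cmod (coeff f i))\<^sup>2)"
    and surj: "\<And>a. square_summable a \<Longrightarrow> \<exists>f. coeff f = a"
    and "Cauchy X"
  shows "convergent X"
proof -
  have nm2: "(\<Sum>\<^sub>\<infinity>i. (cmod (coeff f i - coeff g i))\<^sup>2) = (norm (f - g))\<^sup>2" for f g
    by (simp add: nm diff)
  have "\<exists>a. square_summable a \<and> (\<forall>e>0. \<exists>N. \<forall>n\<ge>N. (\<Sum>\<^sub>\<infinity>i. (cmod (coeff (X n) i - a i))\<^sup>2) \<le> e)"
  proof (rule square_summable_complete[OF ss])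
    fix e :: real assume "e > 0"
    then obtain N where N: "\<forall>m\<ge>N. \<forall>n\<ge>N. norm (X m - X n) < sqrt e"
      using \<open>Cauchy X\<close>[unfolded Cauchy_iff] by (meson real_sqrt_gt_zero)
    have "(norm (X m - X n))\<^sup>2 < e" if "m \<ge> N" "n \<ge> N" for m n
    proof -
      have "(norm (X m - X n))\<^sup>2 < (sqrt e)\<^sup>2"
        using N that by (intro power_strict_mono) auto
      then show ?thesis using \<open>e > 0\<close> by simp
    qed
    then show "\<exists>N. \<forall>m\<ge>N. \<forall>n\<ge>N. (\<Sum>\<^sub>\<infinity>i. (cmod (coeff (X m) i - coeff (X n) i))\<^sup>2) < e"
      unfolding nm2 by blast
  qed
  then obtain a where "square_summable a"
    and a: "\<forall>e>0. \<exists>N. \<forall>n\<ge>N. (\<Sum>\<^sub>\<infinity>i. (cmod (coeff (X n) i - a i))\<^sup>2) \<le> e"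
    by blast
  from surj[OF this(1)] obtain f where "coeff f = a" ..
  with a have f: "\<forall>e>0. \<exists>N. \<forall>n\<ge>N. (norm (X n - f))\<^sup>2 \<le> e"
    by (simp flip: nm2)
  have "X \<longlonglongrightarrow> f"
  proof (rule LIMSEQ_I)
    fix e :: real assume "0 < e"
    then obtain N where N: "\<forall>n\<ge>N. (norm (X n - f))\<^sup>2 \<le> (e/2)\<^sup>2"
      using f[rule_format, of "(e/2)\<^sup>2"] by auto
    have "norm (X n - f) < e" if "n \<ge> N" for n
      using power2_le_imp_le[OF N[rule_format, OF that]] \<open>0 < e\<close> by simp
    then show "\<exists>N. \<forall>n\<ge>N. norm (X n - f) < e" by blast
  qed
  then show ?thesis by (rule convergentI)
qed

instance hardy1 :: complex_hilbert
proof
  fix X :: "nat \<Rightarrow> hardy1"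
  show "Cauchy X \<Longrightarrow> convergent X"
    by (rule convergent_if_coefficients_complete[OF square_summable_coeff1 coeff1_diff
          norm_hardy1_square])
      (use coeff1_hardy1_of in blast)
qed

instance hardy2 :: complex_hilbert
proof
  fix X :: "nat \<Rightarrow> hardy2"
  show "Cauchy X \<Longrightarrow> convergent X"
    by (rule convergent_if_coefficients_complete[OF square_summable_coeff2 coeff2_diff
          norm_hardy2_square])
      (use coeff2_hardy2_of in blast)
qed

section \<open>Radial limits of derivatives\<close>

text \<open>On the circle the Poisson kernel is the Cauchy kernel at \<open>r\<close> applied to the function
  \<open>u \<mapsto> (1 - r\<^sup>2) / (1 - r * u)\<close>, whose value at \<open>r\<close> is \<open>1\<close>.\<close>

lemma poisson_kernel_integral:
  fixes r :: real
  assumes "0 \<le> r" "r < 1"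
  shows "((\<lambda>x. (1 - r\<^sup>2) / (cmod (circlepath 0 1 x - of_real r))\<^sup>2) has_integral 1) {0..1}"
proof -
  let ?f = "\<lambda>u :: complex. (1 - of_real r ^ 2) / (1 - of_real r * u)"
  have nz: "1 - of_real r * u \<noteq> 0" if "cmod u \<le> 1" for u :: complex
  proof
    assume "1 - of_real r * u = 0"
    then have "cmod (of_real r * u) = 1" by simp
    moreover have "cmod (of_real r * u) \<le> r * 1"
      unfolding norm_mult using assms that by (intro mult_mono) auto
    ultimately show False using assms by simp
  qed
  have "((\<lambda>u. ?f u / (u - of_real r)) has_contour_integral (2 * of_real pi * \<i> * ?f (of_real r))) (circlepath 0 1)"
    by (rule Cauchy_integral_circlepath_simple)
      (use assms nz in \<open>auto intro!: holomorphic_intros simp: dist_norm\<close>)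
  moreover have "?f (of_real r) = 1"
    using nz[of "of_real r"] assms by (simp add: power2_eq_square)
  ultimately have "((\<lambda>x. ?f (circlepath 0 1 x) / (circlepath 0 1 x - of_real r) *
      vector_derivative (circlepath 0 1) (at x within {0..1})) has_integral (2 * of_real pi * \<i>)) {0..1}"
    by (simp add: has_contour_integral_def)
  then have "((\<lambda>x. 2 * of_real pi * \<i> * of_real ((1 - r\<^sup>2) / (cmod (circlepath 0 1 x - of_real r))\<^sup>2))
      has_integral (2 * of_real pi * \<i>)) {0..1}"
  proof (rule has_integral_eq[rotated])
    fix x :: real assume x: "x \<in> {0..1}"
    define u where "u = circlepath 0 1 x"
    have u: "cmod u = 1" and ue: "u = exp (2 * of_real pi * \<i> * of_real x)"
      by (simp_all add: u_def circlepath norm_exp_eq_Re)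
    have "cnj u * u = 1" using u by (simp add: complex_norm_square[symmetric] mult.commute)
    then have cnj: "1 - of_real r * u = u * cnj (u - of_real r)"
      by (simp add: algebra_simps)
    have "vector_derivative (circlepath 0 1) (at x within {0..1}) = 2 * of_real pi * \<i> * u"
      using x by (simp add: vector_derivative_circlepath01 ue)
    moreover have "u \<noteq> 0" using u by auto
    moreover have "of_real ((cmod (u - of_real r))\<^sup>2) = (u - of_real r) * cnj (u - of_real r)"
      by (rule complex_norm_square)
    ultimately show "?f (circlepath 0 1 x) / (circlepath 0 1 x - of_real r) *
        vector_derivative (circlepath 0 1) (at x within {0..1}) =
        2 * of_real pi * \<i> * of_real ((1 - r\<^sup>2) / (cmod (circlepath 0 1 x - of_real r))\<^sup>2)"
      unfolding u_def[symmetric] cnj by (simp add: divide_simps)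
  qed
  then have "((\<lambda>x. 1 / (2 * of_real pi * \<i>) * (2 * of_real pi * \<i> * of_real ((1 - r\<^sup>2) / (cmod (circlepath 0 1 x - of_real r))\<^sup>2)))
      has_integral (1 / (2 * of_real pi * \<i>) * (2 * of_real pi * \<i>) :: complex)) {0..1}"
    by (rule has_integral_mult_right)
  then have "((\<lambda>x. complex_of_real ((1 - r\<^sup>2) / (cmod (circlepath 0 1 x - of_real r))\<^sup>2))
      has_integral 1) {0..1}"
    by simp
  from has_integral_Re[OF this] show ?thesis
    by simp
qed

text \<open>The Cauchy kernel for the derivative is of size \<open>1 / \<bar>u - r\<bar>\<^sup>2\<close>, and against a function of
  size \<open>\<bar>u - 1\<bar>\<close> its integral still diverges logarithmically as \<open>r\<close> tends to \<open>1\<close>. The cure is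
  to apply the formula to \<open>H * K\<close> for a factor \<open>K\<close> with \<open>K r = 1\<close> and \<open>K' r = 0\<close>, which does
  not change the derivative at \<open>r\<close>, but gains a factor of size
  \<open>(1 - r\<^sup>2) * \<bar>u - 1\<bar> / \<bar>u - r\<bar>\<^sup>2\<close>. Near \<open>1\<close> the integrand is then at most \<open>8 * e\<close> times the
  Poisson kernel, and far from \<open>1\<close> it is of size \<open>1 - r\<^sup>2\<close>.\<close>

lemma deriv_bound_near_boundary_zero:
  fixes H :: "complex \<Rightarrow> complex" and r e d B :: real
  assumes cont: "continuous_on (cball 0 1) H" and hol: "H holomorphic_on ball 0 1"
    and B: "\<And>z. cmod z = 1 \<Longrightarrow> cmod (H z) \<le> B"
    and e: "\<And>z. cmod z = 1 \<Longrightarrow> cmod (z - 1) < d \<Longrightarrow> cmod (H z) \<le> e * cmod (z - 1)"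
    and "0 < d" "0 \<le> e" and r: "0 \<le> r" "r < 1"
  shows "cmod (deriv H (of_real r)) \<le> 8 * e + 32 * B * (1 - r\<^sup>2) / d ^ 4"
proof -
  define w where "w = complex_of_real r"
  define K where "K = (\<lambda>u. (1 - w\<^sup>2) * (1 - u\<^sup>2) / (1 - w * u)\<^sup>2)"
  define C where "C = 32 * B * (1 - r\<^sup>2) / d ^ 4"
  have w1: "cmod w < 1" using r by (simp add: w_def)
  have r2: "0 < 1 - r\<^sup>2" using r by (simp add: abs_square_less_1)
  have B0: "0 \<le> B" using order_trans[OF norm_ge_zero B[of 1]] by simp
  have nz: "1 - w * u \<noteq> 0" if "cmod u \<le> 1" for u
  proof
    assume "1 - w * u = 0"
    then have "cmod (w * u) = 1" by simp
    moreover have "cmod (w * u) \<le> cmod w * 1"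
      unfolding norm_mult using that by (intro mult_mono) auto
    ultimately show False using w1 by simp
  qed
  have contphi: "continuous_on (cball 0 1) (\<lambda>u. H u * K u)"
    unfolding K_def using nz by (intro continuous_intros cont) (auto simp: dist_norm)
  have holphi: "(\<lambda>u. H u * K u) holomorphic_on ball 0 1"
    unfolding K_def using nz by (intro holomorphic_intros hol) (auto simp: dist_norm)
  have Kw: "K w = 1" and K': "(K has_field_derivative 0) (at w)"
  proof -
    have n: "1 - w * w \<noteq> 0" using nz[of w] w1 by simp
    then show "K w = 1" by (simp add: K_def power2_eq_square)
    have "(1 - w * w) * (1 - w * w) \<noteq> 0" using n by simp
    then have square_nonzero: "1 + w * (w * (w * w)) \<noteq> w * (w * 2)"
      by (simp add: algebra_simps)
    show "(K has_field_derivative 0) (at w)"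
      unfolding K_def using n square_nonzero
      by (auto intro!: derivative_eq_intros simp: field_simps power2_eq_square)
  qed
  have "(H has_field_derivative deriv H w) (at w)"
    using hol w1 by (intro holomorphic_derivI) auto
  from DERIV_mult[OF this K'] have phi': "((\<lambda>u. H u * K u) has_field_derivative deriv H w) (at w)"
    by (simp add: Kw)
  have w_in: "w \<in> ball 0 1" using w1 by simp
  note C1 = Cauchy_derivative_integral_circlepath[OF contphi holphi w_in]
  define F where "F = (\<lambda>x. H (circlepath 0 1 x) * K (circlepath 0 1 x) / (circlepath 0 1 x - w)\<^sup>2 *
      vector_derivative (circlepath 0 1) (at x within {0..1}))"
  have Fint: "F integrable_on {0..1}"
    using C1(1) unfolding contour_integrable_on_def has_contour_integral_def F_def integrable_on_def .
  have "deriv H w = 1 / (2 * of_real pi * \<i>) * contour_integral (circlepath 0 1) (\<lambda>u. H u * K u / (u - w)\<^sup>2)"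
    by (rule DERIV_unique[OF phi' C1(2)])
  also have "contour_integral (circlepath 0 1) (\<lambda>u. H u * K u / (u - w)\<^sup>2) = integral {0..1} F"
    using has_contour_integral_integral[OF C1(1)]
    unfolding has_contour_integral_def F_def by (simp add: integral_unique)
  finally have deriv: "cmod (deriv H w) = cmod (integral {0..1} F) / (2 * pi)"
    by (simp add: norm_mult norm_divide)
  define P where "P = (\<lambda>x. 2 * pi * (8 * e * ((1 - r\<^sup>2) / (cmod (circlepath 0 1 x - of_real r))\<^sup>2) + C))"
  have P: "(P has_integral 2 * pi * (8 * e * 1 + C)) {0..1}"
    unfolding P_def
    using has_integral_const_real[of C 0 1]
    by (intro has_integral_mult_right has_integral_add poisson_kernel_integral r) auto
  have "cmod (integral {0..1} F) \<le> integral {0..1} P"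
  proof (rule integral_norm_bound_integral[OF Fint])
    show "P integrable_on {0..1}" using P by blast
    fix x :: real assume x: "x \<in> {0..1}"
    define u where "u = circlepath 0 1 x"
    have u: "cmod u = 1" and ue: "u = exp (2 * of_real pi * \<i> * of_real x)"
      by (simp_all add: u_def circlepath norm_exp_eq_Re)
    define D where "D = cmod (u - w)"
    have D1: "1 - r \<le> D"
      using norm_triangle_ineq2[of u w] u r by (simp add: D_def w_def)
    then have D0: "0 < D" using r by linarith
    have u1: "cmod (u - 1) \<le> 2 * D"
    proof -
      have "cmod (u - 1) \<le> cmod (u - w) + cmod (w - 1)"
        using norm_triangle_ineq[of "u - w" "w - 1"] by simp
      also have "w - 1 = of_real (r - 1)"
        by (simp add: w_def)
      also have "cmod (of_real (r - 1)) = 1 - r"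
        unfolding norm_of_real using r by simp
      finally show ?thesis using D1 by (simp add: D_def)
    qed
    have up1: "cmod (1 + u) \<le> 2"
      using norm_triangle_ineq[of 1 u] u by simp
    have "cnj u * u = 1" using u by (simp add: complex_norm_square[symmetric] mult.commute)
    then have cnj: "1 - w * u = u * cnj (u - w)"
      by (simp add: algebra_simps w_def)
    then have D': "cmod (1 - w * u) = D"
      by (simp only: cnj D_def norm_mult complex_mod_cnj u mult_1)
    have K: "cmod (K u) = (1 - r\<^sup>2) * (cmod (u - 1) * cmod (1 + u)) / D\<^sup>2"
    proof -
      have "1 - u\<^sup>2 = (1 - u) * (1 + u)" by (simp add: power2_eq_square algebra_simps)
      then have "cmod (1 - u\<^sup>2) = cmod (u - 1) * cmod (1 + u)"
        by (simp only: norm_mult norm_minus_commute[of 1 u])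
      moreover have "1 - w\<^sup>2 = of_real (1 - r\<^sup>2)"
        by (simp add: w_def)
      then have "cmod (1 - w\<^sup>2) = 1 - r\<^sup>2"
        using r2 by (simp only: norm_of_real abs_of_pos)
      ultimately show ?thesis
        unfolding K_def norm_mult norm_divide norm_power D' by (simp only:)
    qed
    have main: "cmod (H u) * cmod (K u) / D\<^sup>2 \<le> 8 * e * ((1 - r\<^sup>2) / D\<^sup>2) + C"
    proof (cases "cmod (u - 1) < d")
      case True
      have "cmod (H u) * cmod (K u) / D\<^sup>2 \<le>
          (e * cmod (u - 1)) * ((1 - r\<^sup>2) * (cmod (u - 1) * 2) / D\<^sup>2) / D\<^sup>2"
        unfolding K using e[OF u True] r2 up1 \<open>0 \<le> e\<close>
        by (intro divide_right_mono mult_mono) auto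
      also have "\<dots> = e * (1 - r\<^sup>2) * 2 * (cmod (u - 1))\<^sup>2 / (D\<^sup>2 * D\<^sup>2)"
        by (simp add: power2_eq_square)
      also have "\<dots> \<le> e * (1 - r\<^sup>2) * 2 * (2 * D)\<^sup>2 / (D\<^sup>2 * D\<^sup>2)"
        using u1 \<open>0 \<le> e\<close> r2 by (intro divide_right_mono mult_left_mono power_mono) auto
      also have "\<dots> = 8 * e * ((1 - r\<^sup>2) / D\<^sup>2)"
        using D0 by (simp add: power2_eq_square)
      finally show ?thesis
        using B0 r2 \<open>0 < d\<close> by (simp add: C_def add_increasing2)
    next
      case False
      have dD: "d / 2 \<le> D" using False u1 by simp
      have "cmod (H u) * cmod (K u) / D\<^sup>2 \<le> B * ((1 - r\<^sup>2) * (cmod (u - 1) * cmod (1 + u)) / D\<^sup>2) / D\<^sup>2"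
        unfolding K using B[OF u] r2 by (intro divide_right_mono mult_right_mono) auto
      also have "cmod (u - 1) * cmod (1 + u) = cmod (u\<^sup>2 - 1)"
        unfolding norm_mult[symmetric] by (simp add: power2_eq_square algebra_simps)
      also have "B * ((1 - r\<^sup>2) * cmod (u\<^sup>2 - 1) / D\<^sup>2) / D\<^sup>2 \<le> B * ((1 - r\<^sup>2) * 2 / D\<^sup>2) / D\<^sup>2"
      proof -
        have "cmod (u\<^sup>2 - 1) \<le> 2"
          using norm_triangle_ineq4[of "u\<^sup>2" 1] u by (simp add: norm_power)
        then show ?thesis
          using r2 B0 by (intro divide_right_mono mult_left_mono) auto
      qed
      also have "\<dots> = 2 * B * (1 - r\<^sup>2) / D ^ 4"
        by (simp add: power2_eq_square power4_eq_xxxx algebra_simps)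
      also have "\<dots> \<le> 2 * B * (1 - r\<^sup>2) / (d / 2) ^ 4"
        using dD \<open>0 < d\<close> B0 r2 by (intro divide_left_mono power_mono mult_nonneg_nonneg mult_pos_pos zero_less_power D0) auto
      also have "\<dots> = C"
        by (simp add: C_def power_divide)
      finally show ?thesis using \<open>0 \<le> e\<close> r2 by (simp add: add_increasing)
    qed
    have "vector_derivative (circlepath 0 1) (at x within {0..1}) = 2 * of_real pi * \<i> * u"
      using x by (simp add: vector_derivative_circlepath01 ue)
    then have "cmod (F x) = cmod (H u) * cmod (K u) / D\<^sup>2 * (2 * pi)"
      unfolding F_def by (simp add: u_def[symmetric] norm_mult norm_divide norm_power u D_def)
    also have "\<dots> \<le> (8 * e * ((1 - r\<^sup>2) / D\<^sup>2) + C) * (2 * pi)"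
      using main by (intro mult_right_mono) auto
    also have "\<dots> = P x"
      by (simp add: P_def u_def[symmetric] D_def w_def)
    finally show "cmod (F x) \<le> P x" .
  qed
  also have "\<dots> = 2 * pi * (8 * e + C)"
    using P by (simp add: integral_unique)
  finally have "cmod (deriv H w) \<le> 8 * e + C"
    unfolding deriv by (simp add: field_simps)
  then show ?thesis by (simp add: w_def C_def)
qed

text \<open>Fatou's theorem on derivatives, normalised: differentiability along the circle at a point,
  with derivative \<open>0\<close>, controls the derivative on the radius ending there.\<close>

lemma radial_limit_deriv_at_one:
  fixes H :: "complex \<Rightarrow> complex"
  assumes cont: "continuous_on (cball 0 1) H" and hol: "H holomorphic_on ball 0 1"
    and "H 1 = 0" and lim: "((\<lambda>z. H z / (z - 1)) \<longlongrightarrow> 0) (at 1 within sphere 0 1)"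
  shows "((\<lambda>r. deriv H (of_real r)) \<longlongrightarrow> 0) (at_left (1 :: real))"
proof -
  have "compact (H ` cball 0 1)" by (intro compact_continuous_image cont) simp
  then obtain B where "\<forall>x \<in> H ` cball 0 1. cmod x \<le> B"
    using compact_imp_bounded bounded_iff by blast
  then have B: "cmod (H z) \<le> B" if "cmod z = 1" for z
    using that by auto
  show ?thesis
  proof (rule tendstoI)
    fix \<epsilon> :: real assume "\<epsilon> > 0"
    define e where "e = \<epsilon> / 16"
    have "e > 0" using \<open>\<epsilon> > 0\<close> by (simp add: e_def)
    obtain d where "d > 0" and d': "\<forall>z\<in>sphere 0 1. z \<noteq> 1 \<and> dist z 1 < d \<longrightarrow> dist (H z / (z - 1)) 0 < e"
      using tendstoD[OF lim \<open>e > 0\<close>] unfolding eventually_at by blast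
    have d: "cmod (H z / (z - 1)) < e" if "cmod z = 1" "z \<noteq> 1" "cmod (z - 1) < d" for z
      using d'[rule_format, of z] that by (simp add: dist_norm)
    have e: "cmod (H z) \<le> e * cmod (z - 1)" if "cmod z = 1" "cmod (z - 1) < d" for z
    proof (cases "z = 1")
      case False
      then show ?thesis
        using d[OF that(1) False that(2)] by (simp add: norm_divide pos_divide_less_eq)
    qed (simp add: \<open>H 1 = 0\<close>)
    have "((\<lambda>r. 8 * e + 32 * B * (1 - r\<^sup>2) / d ^ 4) \<longlongrightarrow> 8 * e + 32 * B * (1 - 1\<^sup>2) / d ^ 4) (at_left 1)"
      by (intro tendsto_intros) (use \<open>d > 0\<close> in auto)
    then have "\<forall>\<^sub>F r in at_left 1. 8 * e + 32 * B * (1 - r\<^sup>2) / d ^ 4 < \<epsilon>"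
      by (rule order_tendstoD(2)) (use \<open>\<epsilon> > 0\<close> in \<open>simp add: e_def\<close>)
    moreover have "\<forall>\<^sub>F r :: real in at_left 1. r \<in> {0<..<1}"
      by (intro eventually_at_leftI[of 0]) auto
    ultimately show "\<forall>\<^sub>F r in at_left 1. dist (deriv H (of_real r)) 0 < \<epsilon>"
    proof eventually_elim
      case (elim r)
      have "cmod (deriv H (of_real r)) \<le> 8 * e + 32 * B * (1 - r\<^sup>2) / d ^ 4"
        using elim(2) by (intro deriv_bound_near_boundary_zero[OF cont hol B e \<open>d > 0\<close>
            less_imp_le[OF \<open>e > 0\<close>]]) simp_all
      then show ?case using elim(1) by (simp only: dist_0_norm dist_commute[of _ 0])
    qed
  qed
qed

text \<open>The normalised case applies after a rotation and the subtraction of an affine function.\<close>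

lemma radial_limit_deriv:
  fixes F :: "complex \<Rightarrow> complex"
  assumes cont: "continuous_on (cball 0 1) F" and hol: "F holomorphic_on ball 0 1"
    and b: "cmod b = 1"
    and lim: "((\<lambda>z. (F z - F b) / (z - b)) \<longlongrightarrow> L) (at b within sphere 0 1)"
  shows "((\<lambda>r. deriv F (of_real r * b)) \<longlongrightarrow> L) (at_left (1 :: real))"
proof -
  define H where "H z = (F (z * b) - F b) / b - L * (z - 1)" for z
  have b0: "b \<noteq> 0" using b by auto
  have rot: "(\<lambda>z. z * b) ` cball 0 1 \<subseteq> cball 0 1" "(\<lambda>z. z * b) ` ball 0 1 \<subseteq> ball 0 1"
    using b by (auto simp: norm_mult)
  have "continuous_on (cball 0 1) (F \<circ> (\<lambda>z. z * b))"
    by (intro continuous_on_compose continuous_intros continuous_on_subset[OF cont] rot)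
  then have contH: "continuous_on (cball 0 1) H"
    unfolding H_def o_def by (intro continuous_intros) (use b0 in simp_all)
  have "(F \<circ> (\<lambda>z. z * b)) holomorphic_on ball 0 1"
    by (intro holomorphic_on_compose holomorphic_intros holomorphic_on_subset[OF hol] rot)
  then have holH: "H holomorphic_on ball 0 1"
    unfolding H_def o_def using b0 by (intro holomorphic_intros)
  have "((\<lambda>r. deriv H (of_real r)) \<longlongrightarrow> 0) (at_left (1 :: real))"
  proof (rule radial_limit_deriv_at_one[OF contH holH])
    show "H 1 = 0" by (simp add: H_def)
    have "filterlim (\<lambda>z. z * b) (at b within sphere 0 1) (at (1 :: complex) within sphere 0 1)"
      unfolding filterlim_at
    proof
      show "((\<lambda>z. z * b) \<longlongrightarrow> b) (at (1 :: complex) within sphere 0 1)"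
        by (rule tendsto_eq_intros refl | simp)+
      show "\<forall>\<^sub>F z in at (1 :: complex) within sphere 0 1. z * b \<in> sphere 0 1 \<and> z * b \<noteq> b"
        unfolding eventually_at by (intro exI[of _ 1]) (use b b0 in \<open>simp add: norm_mult\<close>)
    qed
    from filterlim_compose[OF lim this]
    have "((\<lambda>z. (F (z * b) - F b) / (z * b - b) - L) \<longlongrightarrow> L - L) (at 1 within sphere 0 1)"
      by (intro tendsto_diff tendsto_const)
    moreover have "\<forall>\<^sub>F z in at 1 within sphere 0 1. (F (z * b) - F b) / (z * b - b) - L = H z / (z - 1)"
      unfolding eventually_at
    proof (intro exI[of _ 1] conjI ballI impI)
      fix z :: complex assume "z \<noteq> 1 \<and> dist z 1 < 1"
      moreover have "z * b - b = (z - 1) * b" by (simp add: algebra_simps)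
      ultimately show "(F (z * b) - F b) / (z * b - b) - L = H z / (z - 1)"
        using b0 by (simp add: H_def diff_divide_distrib mult.commute)
    qed simp
    ultimately show "((\<lambda>z. H z / (z - 1)) \<longlongrightarrow> 0) (at 1 within sphere 0 1)"
      unfolding diff_self by (rule Lim_transform_eventually)
  qed
  then have "((\<lambda>r. deriv H (of_real r) + L) \<longlongrightarrow> 0 + L) (at_left (1 :: real))"
    by (intro tendsto_add tendsto_const)
  moreover have "\<forall>\<^sub>F r :: real in at_left 1. deriv H (of_real r) + L = deriv F (of_real r * b)"
  proof (rule eventually_at_leftI[of 0])
    fix r :: real assume "r \<in> {0<..<1}"
    then have "of_real r * b \<in> ball 0 1" using b by (simp add: norm_mult)
    then have "(F has_field_derivative deriv F (of_real r * b)) (at (of_real r * b))"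
      using hol by (intro holomorphic_derivI) auto
    then have "((\<lambda>z. F (z * b)) has_field_derivative deriv F (of_real r * b) * b) (at (of_real r))"
      by (rule DERIV_chain2) (auto intro!: derivative_eq_intros)
    then have "(H has_field_derivative (deriv F (of_real r * b) * b) / b - L) (at (of_real r))"
      unfolding H_def using b0 by (auto intro!: derivative_eq_intros)
    then show "deriv H (of_real r) + L = deriv F (of_real r * b)"
      using b0 by (simp add: DERIV_imp_deriv)
  qed simp
  ultimately show ?thesis
    unfolding add_0 by (rule Lim_transform_eventually)
qed

text \<open>A derivative with respect to the angle is a derivative along the circle, because \<open>cis\<close> has a
  nonzero derivative and a continuous local inverse, given by \<open>Arg\<close>.\<close>

lemma difference_quotient_on_circle:
  fixes F :: "complex \<Rightarrow> complex"
  assumes "((\<lambda>h. (F (cis (t + h)) - F (cis t)) / of_real h) \<longlongrightarrow> \<i> * cis t * L) (at 0)"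
  shows "((\<lambda>z. (F z - F (cis t)) / (z - cis t)) \<longlongrightarrow> L) (at (cis t) within sphere 0 1)"
proof -
  have "((\<lambda>h. (cis (t + h) - cis t) / of_real h) \<longlongrightarrow> \<i> * cis t) (at 0)"
  proof -
    have "((\<lambda>z. exp (\<i> * z)) has_field_derivative \<i> * exp (\<i> * of_real t)) (at (of_real t))"
      by (auto intro!: derivative_eq_intros)
    then have "((\<lambda>h. (exp (\<i> * (of_real t + h)) - exp (\<i> * of_real t)) / h) \<longlongrightarrow> \<i> * exp (\<i> * of_real t)) (at 0)"
      by (simp add: DERIV_def)
    moreover have "filterlim complex_of_real (at 0) (at 0)"
      unfolding filterlim_at by (auto intro!: tendsto_eq_intros simp: eventually_at_filter)
    ultimately have "((\<lambda>h. (exp (\<i> * (of_real t + of_real h)) - exp (\<i> * of_real t)) / of_real h) \<longlongrightarrow> \<i> * exp (\<i> * of_real t)) (at (0::real))"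
      by (rule filterlim_compose)
    then show ?thesis by (simp add: cis_conv_exp)
  qed
  from tendsto_divide[OF assms this]
  have "((\<lambda>h. (F (cis (t + h)) - F (cis t)) / of_real h / ((cis (t + h) - cis t) / of_real h)) \<longlongrightarrow> L) (at 0)"
    by simp
  then have q: "((\<lambda>h. (F (cis (t + h)) - F (cis t)) / (cis (t + h) - cis t)) \<longlongrightarrow> L) (at 0)"
    by (rule Lim_transform_eventually) (auto simp: eventually_at_filter)
  have cis_Arg': "cis (t + Arg (z / cis t)) = z" if "cmod z = 1" for z
  proof -
    have "cmod (z / cis t) = 1" using that by (simp add: norm_divide)
    then have "cis (Arg (z / cis t)) = z / cis t"
      by (subst cis_Arg) (auto simp: sgn_div_norm)
    then show ?thesis by (simp add: cis_mult[symmetric])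
  qed
  have "filterlim (\<lambda>z. Arg (z / cis t)) (at 0) (at (cis t) within sphere 0 1)"
    unfolding filterlim_at
  proof
    have "((\<lambda>z. Arg (z / cis t)) \<longlongrightarrow> Arg (cis t / cis t)) (at (cis t) within sphere 0 1)"
      by (rule tendsto_Arg) (intro tendsto_intros, auto)
    then show "((\<lambda>z. Arg (z / cis t)) \<longlongrightarrow> 0) (at (cis t) within sphere 0 1)"
      by (simp add: Arg_eq_0)
    show "\<forall>\<^sub>F z in at (cis t) within sphere 0 1. Arg (z / cis t) \<in> UNIV \<and> Arg (z / cis t) \<noteq> 0"
      unfolding eventually_at
    proof (intro exI[of _ 1] conjI ballI impI)
      fix z assume "z \<in> sphere 0 1" "z \<noteq> cis t \<and> dist z (cis t) < 1"
      then show "Arg (z / cis t) \<noteq> 0" using cis_Arg'[of z] by auto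
    qed auto
  qed
  from filterlim_compose[OF q this] show ?thesis
    by (rule Lim_transform_eventually) (auto simp: eventually_at cis_Arg' intro!: exI[of _ 1])
qed

section \<open>Lebesgue differentiation on an interval\<close>

text \<open>The integral averages over small intervals to the right converge almost everywhere; outside
  \<open>{a..b}\<close> the function is replaced by \<open>0\<close> to make it integrable on every interval.\<close>

lemma lebesgue_differentiation_right:
  fixes g :: "real \<Rightarrow> complex"
  assumes int: "g integrable_on {a..b}"
    and G: "\<And>x y. a \<le> x \<Longrightarrow> x \<le> y \<Longrightarrow> y \<le> b \<Longrightarrow> G y - G x = integral {x..y} g"
  obtains N where "negligible N"
    "\<And>t. t \<in> {a<..<b} \<Longrightarrow> t \<notin> N \<Longrightarrow> ((\<lambda>h. (G (t + h) - G t) / of_real h) \<longlongrightarrow> g t) (at_right 0)"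
proof -
  define g' where "g' x = (if x \<in> {a..b} then g x else 0)" for x
  have "g' integrable_on UNIV"
    unfolding g'_def using int integrable_restrict_UNIV by blast
  then have "g' integrable_on cbox x y" for x y
    by (rule integrable_on_subcbox) simp
  then obtain N where N: "negligible N"
    and lim: "\<And>x e. x \<notin> N \<Longrightarrow> 0 < e \<Longrightarrow> \<exists>d>0. \<forall>h. 0 < h \<and> h < d \<longrightarrow>
      norm (integral (cbox x (x + h *\<^sub>R One)) g' /\<^sub>R h ^ DIM(real) - g' x) < e"
    using integrable_ccontinuous_explicit[of g'] by metis
  show ?thesis
  proof (rule that[OF N])
    fix t assume t: "t \<in> {a<..<b}" "t \<notin> N"
    show "((\<lambda>h. (G (t + h) - G t) / of_real h) \<longlongrightarrow> g t) (at_right 0)"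
    proof (rule tendstoI)
      fix e :: real assume "0 < e"
      then obtain d where "d > 0" and d: "\<And>h. 0 < h \<Longrightarrow> h < d \<Longrightarrow>
          norm (integral {t..t + h} g' /\<^sub>R h - g' t) < e"
        using lim[OF t(2) \<open>0 < e\<close>] by (auto simp del: real_norm_def)
      have "dist ((G (t + h) - G t) / of_real h) (g t) < e" if "h \<in> {0<..<min d (b - t)}" for h
      proof -
        have "integral {t..t + h} g' = integral {t..t + h} g"
          using t that by (intro integral_cong) (auto simp: g'_def)
        also have "\<dots> = G (t + h) - G t"
          using t that by (intro G[symmetric]) auto
        finally show ?thesis
          using d[of h] that t by (simp add: dist_norm g'_def scaleR_conv_of_real divide_inverse mult.commute)
      qed
      then show "\<forall>\<^sub>F h in at_right 0. dist ((G (t + h) - G t) / of_real h) (g t) < e"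
        using t \<open>d > 0\<close> by (intro eventually_at_rightI[of 0 "min d (b - t)"]) auto
    qed
  qed
qed

text \<open>The left difference quotients are the right ones of the reflected function.\<close>

lemma lebesgue_differentiation:
  fixes g :: "real \<Rightarrow> complex"
  assumes int: "g integrable_on {a..b}"
    and G: "\<And>x y. a \<le> x \<Longrightarrow> x \<le> y \<Longrightarrow> y \<le> b \<Longrightarrow> G y - G x = integral {x..y} g"
  obtains N where "negligible N"
    "\<And>t. t \<in> {a<..<b} \<Longrightarrow> t \<notin> N \<Longrightarrow> ((\<lambda>h. (G (t + h) - G t) / of_real h) \<longlongrightarrow> g t) (at 0)"
proof -
  obtain N1 where N1: "negligible N1"
    and right: "\<And>t. t \<in> {a<..<b} \<Longrightarrow> t \<notin> N1 \<Longrightarrow> ((\<lambda>h. (G (t + h) - G t) / of_real h) \<longlongrightarrow> g t) (at_right 0)"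
    using lebesgue_differentiation_right[OF int G] by blast
  have int': "(\<lambda>x. g (- x)) integrable_on {- b..- a}"
    using int by simp
  have G': "- G (- y) - - G (- x) = integral {x..y} (\<lambda>x. g (- x))" if "- b \<le> x" "x \<le> y" "y \<le> - a" for x y
    using G[of "- y" "- x"] Henstock_Kurzweil_Integration.integral_reflect_real[of "- x" "- y" g] that by simp
  obtain N2 where N2: "negligible N2"
    and left: "\<And>t. t \<in> {- b<..<- a} \<Longrightarrow> t \<notin> N2 \<Longrightarrow>
      ((\<lambda>h. (- G (- (t + h)) - - G (- t)) / of_real h) \<longlongrightarrow> g (- t)) (at_right 0)"
    using lebesgue_differentiation_right[OF int' G'] by blast
  have "negligible (N1 \<union> uminus ` N2)"
    using N1 N2 by (intro negligible_Un negligible_differentiable_image_negligible)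
      (auto intro!: derivative_intros differentiable_on_minus differentiable_on_ident)
  moreover have "((\<lambda>h. (G (t + h) - G t) / of_real h) \<longlongrightarrow> g t) (at 0)"
    if t: "t \<in> {a<..<b}" "t \<notin> N1 \<union> uminus ` N2" for t
  proof (rule filterlim_split_at)
    show "((\<lambda>h. (G (t + h) - G t) / of_real h) \<longlongrightarrow> g t) (at_right 0)"
      using t by (intro right) auto
    have "- t \<notin> N2" using t(2) by (metis UnI2 image_eqI minus_minus)
    then have "((\<lambda>h. (- G (- (- t + h)) - - G (- (- t))) / of_real h) \<longlongrightarrow> g (- (- t))) (at_right 0)"
      using t by (intro left) auto
    moreover have "(- A - - B) / x = (A - B) / (- x)" for A B x :: complex
      unfolding minus_diff_minus minus_divide_left[symmetric] minus_divide_right[symmetric] ..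
    ultimately have "((\<lambda>h. (G (t + - h) - G t) / of_real (- h)) \<longlongrightarrow> g t) (at_right 0)"
      by (simp only: minus_minus minus_add_distrib of_real_minus)
    then show "((\<lambda>h. (G (t + h) - G t) / of_real h) \<longlongrightarrow> g t) (at_left 0)"
      by (subst filterlim_at_left_to_right) (simp only: minus_zero)
  qed
  ultimately show ?thesis by (rule that)
qed

section \<open>Boundary values of bounded functions of norm one\<close>

lemma integral_cis_orthogonal:
  "((\<lambda>t. cis t ^ m * cnj (cis t ^ n)) has_integral (if m = n then of_real (2 * pi) else 0)) {0..2 * pi}"
proof -
  define k where "k = real m - real n"
  have e: "cis t ^ m * cnj (cis t ^ n) = cis (k * t)" for t
    by (simp add: k_def Complex.DeMoivre cis_cnj cis_mult algebra_simps)
  show ?thesis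
  proof (cases "m = n")
    case True
    then show ?thesis
      unfolding e using has_integral_const_real[of "1::complex" 0 "2 * pi"]
      by (simp add: k_def scaleR_conv_of_real)
  next
    case False
    then have k: "k \<noteq> 0" by (simp add: k_def)
    have "((\<lambda>t. cis (k * t)) has_integral (cis (k * (2 * pi)) / (\<i> * of_real k) - cis (k * 0) / (\<i> * of_real k))) {0..2 * pi}"
    proof (rule fundamental_theorem_of_calculus)
      fix t :: real
      have "((\<lambda>z. exp (\<i> * (of_real k * z)) / (\<i> * of_real k)) has_field_derivative exp (\<i> * (of_real k * of_real t))) (at (of_real t))"
        using k by (auto intro!: derivative_eq_intros simp: algebra_simps)
      from has_vector_derivative_real_field[OF this]
      show "((\<lambda>t. cis (k * t) / (\<i> * of_real k)) has_vector_derivative cis (k * t)) (at t within {0..2 * pi})"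
        by (simp add: cis_conv_exp has_vector_derivative_at_within)
    qed simp
    moreover have "cis (k * (2 * pi)) = 1"
      using cis_multiple_2pi[of k] by (simp add: k_def mult_ac)
    ultimately show ?thesis
      unfolding e using False by simp
  qed
qed

lemma parseval_finite:
  "((\<lambda>t. (cmod (\<Sum>n<N. b n * cis t ^ n))\<^sup>2) has_integral 2 * pi * (\<Sum>n<N. (cmod (b n))\<^sup>2)) {0..2 * pi}"
proof -
  have "((\<lambda>t. \<Sum>m<N. \<Sum>n<N. (b m * cnj (b n)) * (cis t ^ m * cnj (cis t ^ n))) has_integral
      (\<Sum>m<N. \<Sum>n<N. (b m * cnj (b n)) * (if m = n then of_real (2 * pi) else 0))) {0..2 * pi}"
    by (intro has_integral_sum has_integral_mult_right integral_cis_orthogonal) simp_all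
  also have "(\<lambda>t. \<Sum>m<N. \<Sum>n<N. (b m * cnj (b n)) * (cis t ^ m * cnj (cis t ^ n))) =
      (\<lambda>t. complex_of_real ((cmod (\<Sum>n<N. b n * cis t ^ n))\<^sup>2))"
    unfolding complex_norm_square cnj_sum sum_product by (simp add: mult_ac)
  also have "(\<Sum>m<N. \<Sum>n<N. (b m * cnj (b n)) * (if m = n then of_real (2 * pi) else 0)) =
      of_real (2 * pi * (\<Sum>n<N. (cmod (b n))\<^sup>2))"
  proof -
    have "(\<Sum>n<N. (b m * cnj (b n)) * (if m = n then of_real (2 * pi) else 0)) = of_real (2 * pi * (cmod (b m))\<^sup>2)"
      if "m < N" for m
    proof -
      have "(\<Sum>n<N. (b m * cnj (b n)) * (if m = n then of_real (2 * pi) else 0)) =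
          (\<Sum>n<N. if n = m then b m * cnj (b m) * of_real (2 * pi) else 0)"
        by (intro sum.cong) auto
      then show ?thesis
        using that by (simp add: complex_norm_square[symmetric] mult.commute)
    qed
    then show ?thesis by (simp add: sum_distrib_left)
  qed
  finally have "((\<lambda>t. complex_of_real ((cmod (\<Sum>n<N. b n * cis t ^ n))\<^sup>2)) has_integral
      of_real (2 * pi * (\<Sum>n<N. (cmod (b n))\<^sup>2))) {0..2 * pi}" .
  from has_integral_Re[OF this] show ?thesis
    by (simp only: Re_complex_of_real)
qed

text \<open>Both claims pass from trigonometric polynomials to the limit by uniform convergence.\<close>

lemma
  fixes b :: "nat \<Rightarrow> complex"
  assumes b: "summable (\<lambda>n. cmod (b n))"
  shows continuous_on_cis_series: "continuous_on A (\<lambda>t. \<Sum>n. b n * cis t ^ n)"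
    and parseval: "((\<lambda>t. (cmod (\<Sum>n. b n * cis t ^ n))\<^sup>2) has_integral 2 * pi * (\<Sum>n. (cmod (b n))\<^sup>2)) {0..2 * pi}"
proof -
  let ?s = "\<lambda>N t. \<Sum>n<N. b n * cis t ^ n" and ?S = "\<lambda>t. \<Sum>n. b n * cis t ^ n"
  have unif: "uniform_limit UNIV ?s ?S sequentially"
    by (rule Weierstrass_m_test[OF _ b]) (simp add: norm_mult norm_power)
  have cont: "continuous_on X (?s N)" for N X
    by (intro continuous_intros)
  have "continuous_on UNIV ?S"
    by (rule uniform_limit_theorem[OF _ unif]) (use cont in auto)
  then show "continuous_on A ?S"
    by (rule continuous_on_subset) simp
  then have contS: "continuous_on {0..2 * pi} ?S"
    using \<open>continuous_on UNIV ?S\<close> continuous_on_subset by blast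
  have lim: "(\<lambda>N. ?s N t) \<longlonglongrightarrow> ?S t" for t
    using tendsto_uniform_limitI[OF unif] by simp
  have bd: "cmod (?s N t) \<le> (\<Sum>n. cmod (b n))" for N t
  proof -
    have "cmod (?s N t) \<le> (\<Sum>n<N. cmod (b n))"
      by (rule sum_norm_le) (simp add: norm_mult norm_power)
    also have "\<dots> \<le> (\<Sum>n. cmod (b n))"
      by (rule sum_le_suminf[OF b]) auto
    finally show ?thesis .
  qed
  have "(\<lambda>N. integral {0..2 * pi} (\<lambda>t. (cmod (?s N t))\<^sup>2)) \<longlonglongrightarrow> integral {0..2 * pi} (\<lambda>t. (cmod (?S t))\<^sup>2)"
  proof (rule dominated_convergence(2)[where h = "\<lambda>_. (\<Sum>n. cmod (b n))\<^sup>2"])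
    show "(\<lambda>t. (cmod (?s N t))\<^sup>2) integrable_on {0..2 * pi}" for N
      by (intro integrable_continuous_real continuous_intros)
    show "norm ((cmod (?s N t))\<^sup>2) \<le> (\<Sum>n. cmod (b n))\<^sup>2" for N t
      using power_mono[OF bd] by simp
    show "(\<lambda>N. (cmod (?s N t))\<^sup>2) \<longlonglongrightarrow> (cmod (?S t))\<^sup>2" for t
      by (intro tendsto_intros lim)
  qed (simp add: integrable_const_ivl)
  then have "(\<lambda>N. 2 * pi * (\<Sum>n<N. (cmod (b n))\<^sup>2)) \<longlonglongrightarrow> integral {0..2 * pi} (\<lambda>t. (cmod (?S t))\<^sup>2)"
    by (simp add: integral_unique[OF parseval_finite])
  moreover have "summable (\<lambda>n. (cmod (b n))\<^sup>2)"
  proof (rule summable_comparison_test_ev[OF _ b])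
    have "\<forall>\<^sub>F n in sequentially. cmod (b n) < 1"
      using summable_LIMSEQ_zero[OF b] by (rule order_tendstoD) simp
    then show "\<forall>\<^sub>F n in sequentially. norm ((cmod (b n))\<^sup>2) \<le> cmod (b n)"
      by eventually_elim (simp add: power2_eq_square mult_left_le)
  qed
  then have "(\<lambda>N. 2 * pi * (\<Sum>n<N. (cmod (b n))\<^sup>2)) \<longlonglongrightarrow> 2 * pi * (\<Sum>n. (cmod (b n))\<^sup>2)"
    by (intro tendsto_intros summable_LIMSEQ)
  ultimately have eq: "integral {0..2 * pi} (\<lambda>t. (cmod (?S t))\<^sup>2) = 2 * pi * (\<Sum>n. (cmod (b n))\<^sup>2)"
    by (rule LIMSEQ_unique)
  have "(\<lambda>t. (cmod (?S t))\<^sup>2) integrable_on {0..2 * pi}"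
    by (intro integrable_continuous_real continuous_intros contS)
  from integrable_integral[OF this] show "((\<lambda>t. (cmod (?S t))\<^sup>2) has_integral 2 * pi * (\<Sum>n. (cmod (b n))\<^sup>2)) {0..2 * pi}"
    unfolding eq .
qed

text \<open>By Tannery's theorem the mean square distance between \<open>f\<close> and its dilations tends to zero as
  the radius tends to \<open>1\<close>, so there are radii along which it decays geometrically.\<close>

lemma ex_fast_radii:
  fixes c :: "nat \<Rightarrow> complex"
  assumes c: "summable (\<lambda>n. (cmod (c n))\<^sup>2)"
  obtains r :: "nat \<Rightarrow> real" where "\<And>k. 0 < r k" "\<And>k. r k < 1" "r \<longlonglongrightarrow> 1"
    "\<And>k. (\<Sum>n. (cmod (c n))\<^sup>2 * (1 - r k ^ n)\<^sup>2) \<le> (1 / 4) ^ k"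
proof -
  have in01: "\<forall>\<^sub>F \<rho> :: real in at_left 1. \<rho> \<in> {0<..<1}"
    by (intro eventually_at_leftI[of 0]) auto
  have bd: "norm ((cmod (c n))\<^sup>2 * (1 - \<rho> ^ n)\<^sup>2) \<le> (cmod (c n))\<^sup>2" if "\<rho> \<in> {0<..<1}" for n and \<rho> :: real
  proof -
    have "0 \<le> 1 - \<rho> ^ n" "1 - \<rho> ^ n \<le> 1" using that by (auto simp: power_le_one)
    then have "(1 - \<rho> ^ n)\<^sup>2 \<le> 1" by (simp add: power_le_one)
    then show ?thesis by (simp add: mult_left_le)
  qed
  have "((\<lambda>\<rho>. \<Sum>n. (cmod (c n))\<^sup>2 * (1 - \<rho> ^ n)\<^sup>2) \<longlongrightarrow> (\<Sum>n. (cmod (c n))\<^sup>2 * (1 - 1 ^ n)\<^sup>2)) (at_left (1::real))"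
  proof (rule tannerys_theorem[THEN conjunct2, THEN conjunct2, OF _ _ c])
    show "((\<lambda>\<rho>. (cmod (c n))\<^sup>2 * (1 - \<rho> ^ n)\<^sup>2) \<longlongrightarrow> (cmod (c n))\<^sup>2 * (1 - 1 ^ n)\<^sup>2) (at_left (1::real))" for n
      by (intro tendsto_intros)
    show "\<forall>\<^sub>F (n, \<rho>) in sequentially \<times>\<^sub>F at_left 1. norm ((cmod (c n))\<^sup>2 * (1 - \<rho> ^ n)\<^sup>2) \<le> (cmod (c n))\<^sup>2"
    proof (rule eventually_mono)
      show "\<forall>\<^sub>F x in sequentially \<times>\<^sub>F at_left 1. True \<and> snd x \<in> {0<..<1::real}"
        by (rule eventually_prodI[OF always_eventually in01]) simp
    qed (use bd in force)
  qed simp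
  then have lim: "((\<lambda>\<rho>. \<Sum>n. (cmod (c n))\<^sup>2 * (1 - \<rho> ^ n)\<^sup>2) \<longlongrightarrow> 0) (at_left (1::real))"
    by simp
  have "\<exists>\<rho>::real. 0 < \<rho> \<and> \<rho> < 1 \<and> 1 - 1 / Suc k < \<rho> \<and>
      (\<Sum>n. (cmod (c n))\<^sup>2 * (1 - \<rho> ^ n)\<^sup>2) < (1 / 4) ^ k" for k
  proof -
    have "\<forall>\<^sub>F \<rho> in at_left (1::real). (\<Sum>n. (cmod (c n))\<^sup>2 * (1 - \<rho> ^ n)\<^sup>2) < (1 / 4) ^ k"
      using lim by (rule order_tendstoD(2)) simp
    moreover have "\<forall>\<^sub>F \<rho> :: real in at_left 1. \<rho> \<in> {1 - 1 / Suc k<..<1}"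
      by (intro eventually_at_leftI[of "1 - 1 / Suc k"]) auto
    ultimately have "\<forall>\<^sub>F \<rho> in at_left (1::real). 0 < \<rho> \<and> \<rho> < 1 \<and> 1 - 1 / Suc k < \<rho> \<and>
      (\<Sum>n. (cmod (c n))\<^sup>2 * (1 - \<rho> ^ n)\<^sup>2) < (1 / 4) ^ k"
      using in01 by eventually_elim simp
    then show ?thesis by (rule eventually_happens'[rotated]) simp
  qed
  then obtain r where r: "\<forall>k. 0 < r k \<and> r k < 1 \<and> 1 - 1 / real (Suc k) < r k \<and>
      (\<Sum>n. (cmod (c n))\<^sup>2 * (1 - r k ^ n)\<^sup>2) < (1 / 4) ^ k"
    using choice[of "\<lambda>k \<rho>. 0 < \<rho> \<and> \<rho> < 1 \<and> 1 - 1 / real (Suc k) < \<rho> \<and>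
      (\<Sum>n. (cmod (c n))\<^sup>2 * (1 - \<rho> ^ n)\<^sup>2) < (1 / 4) ^ k"]
    by blast
  have "r \<longlonglongrightarrow> 1"
  proof (rule real_tendsto_sandwich)
    have "(\<lambda>k. 1 - 1 / real (Suc k)) \<longlonglongrightarrow> 1 - 0"
      using LIMSEQ_inverse_real_of_nat by (intro tendsto_diff) (auto simp: inverse_eq_divide)
    then show "(\<lambda>k. 1 - 1 / real (Suc k)) \<longlonglongrightarrow> 1" by simp
    show "\<forall>\<^sub>F k in sequentially. 1 - 1 / real (Suc k) \<le> r k"
      using r by (intro always_eventually allI less_imp_le) blast
    show "\<forall>\<^sub>F k in sequentially. r k \<le> 1"
      using r by (intro always_eventually allI less_imp_le) blast
  qed simp
  then show ?thesis
    using r less_imp_le by (intro that[of r]) blast+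
qed

text \<open>By the inequality between the arithmetic and the geometric mean, termwise.\<close>

lemma summable_power_scaled:
  fixes c :: "nat \<Rightarrow> complex" and r :: real
  assumes c: "summable (\<lambda>n. (cmod (c n))\<^sup>2)" and r: "0 \<le> r" "r < 1"
  shows "summable (\<lambda>n. cmod (c n) * r ^ n)"
proof (rule summable_comparison_test)
  have "summable (\<lambda>n. (r\<^sup>2) ^ n)"
    using r by (intro summable_geometric) (auto simp: abs_square_less_1)
  then show "summable (\<lambda>n. (cmod (c n))\<^sup>2 + (r\<^sup>2) ^ n)"
    by (intro summable_add c)
  show "\<exists>N. \<forall>n\<ge>N. norm (cmod (c n) * r ^ n) \<le> (cmod (c n))\<^sup>2 + (r\<^sup>2) ^ n"
  proof (intro exI[of _ 0] allI impI)
    fix n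
    have p: "0 \<le> cmod (c n) * r ^ n" using r by simp
    have "2 * cmod (c n) * r ^ n \<le> (cmod (c n))\<^sup>2 + (r ^ n)\<^sup>2"
      by (rule sum_squares_bound)
    also have "(r ^ n)\<^sup>2 = (r\<^sup>2) ^ n" by (simp add: power_mult[symmetric] mult.commute)
    finally show "norm (cmod (c n) * r ^ n) \<le> (cmod (c n))\<^sup>2 + (r\<^sup>2) ^ n"
      using p by (simp only: real_norm_def abs_of_nonneg)
  qed
qed

text \<open>Along such radii the successive differences have summable integrals over the circle, so the
  telescoping series converges absolutely almost everywhere.\<close>

lemma AE_convergent_fast_radii:
  fixes c :: "nat \<Rightarrow> complex" and r :: "nat \<Rightarrow> real"
  assumes c: "summable (\<lambda>n. (cmod (c n))\<^sup>2)"
    and r: "\<And>k. 0 < r k" "\<And>k. r k < 1"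
    and fast: "\<And>k. (\<Sum>n. (cmod (c n))\<^sup>2 * (1 - r k ^ n)\<^sup>2) \<le> (1 / 4) ^ k"
  shows "AE t in lebesgue_on {0..2 * pi}. convergent (\<lambda>k. \<Sum>n. c n * of_real (r k) ^ n * cis t ^ n)"
proof -
  let ?M = "lebesgue_on {0..2 * pi}"
  define u where "u k t = (\<Sum>n. c n * of_real (r k) ^ n * cis t ^ n)" for k t
  define D where "D k t = u (Suc k) t - u k t" for k t
  have sb: "summable (\<lambda>n. cmod (c n * of_real (r k) ^ n))" for k
    using summable_power_scaled[OF c, of "r k"] r[of k] by (simp add: norm_mult norm_power less_imp_le)
  have sm: "summable (\<lambda>n. c n * of_real (r k) ^ n * cis t ^ n)" for k t
    by (rule summable_norm_cancel) (use sb[of k] in \<open>simp add: norm_mult norm_power\<close>)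
  define d where "d k n = c n * (of_real (r (Suc k)) ^ n - of_real (r k) ^ n)" for k n
  have sd: "summable (\<lambda>n. cmod (d k n))" for k
  proof (rule summable_comparison_test[OF _ summable_add[OF sb[of "Suc k"] sb[of k]]])
    show "\<exists>N. \<forall>n\<ge>N. norm (cmod (d k n)) \<le> cmod (c n * of_real (r (Suc k)) ^ n) + cmod (c n * of_real (r k) ^ n)"
      using norm_triangle_ineq4 by (auto simp: d_def right_diff_distrib)
  qed
  have D: "D k = (\<lambda>t. \<Sum>n. d k n * cis t ^ n)" for k
    unfolding D_def u_def suminf_diff[OF sm sm] d_def
    by (simp add: left_diff_distrib right_diff_distrib)
  have contD: "continuous_on {0..2 * pi} (D k)" for k
    unfolding D by (rule continuous_on_cis_series[OF sd])
  \<comment> \<open>Both dilations are close to \<open>f\<close> in mean square, hence to each other.\<close>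
  have sq: "(\<Sum>n. (cmod (d k n))\<^sup>2) \<le> 4 * (1 / 4) ^ k" for k
  proof -
    have bd: "(cmod (c n))\<^sup>2 * (1 - r j ^ n)\<^sup>2 \<le> (cmod (c n))\<^sup>2" for j n
    proof -
      have "0 \<le> 1 - r j ^ n" "1 - r j ^ n \<le> 1" using r[of j] by (auto simp: power_le_one less_imp_le)
      then have "(1 - r j ^ n)\<^sup>2 \<le> 1" by (simp add: power_le_one)
      then show ?thesis by (simp add: mult_left_le)
    qed
    have s: "summable (\<lambda>n. (cmod (c n))\<^sup>2 * (1 - r j ^ n)\<^sup>2)" for j
      by (rule summable_comparison_test[OF _ c]) (use bd in auto)
    have le: "(cmod (d k n))\<^sup>2 \<le> 2 * ((cmod (c n))\<^sup>2 * (1 - r (Suc k) ^ n)\<^sup>2) + 2 * ((cmod (c n))\<^sup>2 * (1 - r k ^ n)\<^sup>2)" for n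
    proof -
      have "d k n = c n * of_real ((1 - r k ^ n) - (1 - r (Suc k) ^ n))"
        by (simp add: d_def)
      then have "(cmod (d k n))\<^sup>2 = (cmod (c n))\<^sup>2 * ((1 - r k ^ n) - (1 - r (Suc k) ^ n))\<^sup>2"
        by (simp only: norm_mult norm_of_real power_mult_distrib power2_abs)
      also have "\<dots> \<le> (cmod (c n))\<^sup>2 * (2 * (1 - r (Suc k) ^ n)\<^sup>2 + 2 * (1 - r k ^ n)\<^sup>2)"
      proof (rule mult_left_mono)
        have "(x - y)\<^sup>2 \<le> 2 * y\<^sup>2 + 2 * x\<^sup>2" for x y :: real
          using zero_le_power2[of "x + y"] by (simp add: power2_eq_square algebra_simps)
        then show "((1 - r k ^ n) - (1 - r (Suc k) ^ n))\<^sup>2 \<le> 2 * (1 - r (Suc k) ^ n)\<^sup>2 + 2 * (1 - r k ^ n)\<^sup>2" .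
      qed simp
      finally show ?thesis by (simp add: algebra_simps)
    qed
    have s2: "summable (\<lambda>n. 2 * ((cmod (c n))\<^sup>2 * (1 - r (Suc k) ^ n)\<^sup>2) + 2 * ((cmod (c n))\<^sup>2 * (1 - r k ^ n)\<^sup>2))"
      by (intro summable_add summable_mult s)
    have "(\<Sum>n. (cmod (d k n))\<^sup>2) \<le>
        (\<Sum>n. 2 * ((cmod (c n))\<^sup>2 * (1 - r (Suc k) ^ n)\<^sup>2) + 2 * ((cmod (c n))\<^sup>2 * (1 - r k ^ n)\<^sup>2))"
      by (rule suminf_le[OF le _ s2]) (rule summable_comparison_test[OF _ s2], use le in auto)
    also have "\<dots> = 2 * (\<Sum>n. (cmod (c n))\<^sup>2 * (1 - r (Suc k) ^ n)\<^sup>2) + 2 * (\<Sum>n. (cmod (c n))\<^sup>2 * (1 - r k ^ n)\<^sup>2)"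
      by (simp add: suminf_add[symmetric] suminf_mult s summable_mult)
    also have "\<dots> \<le> 2 * (1 / 4) ^ Suc k + 2 * (1 / 4) ^ k"
      by (intro add_mono mult_left_mono fast) auto
    also have "\<dots> \<le> 4 * (1 / 4) ^ k"
      by simp
    finally show ?thesis .
  qed
  have int1: "integral {0..2 * pi} (\<lambda>t. cmod (D k t)) \<le> 5 * pi * (1 / 2) ^ k" for k
  proof -
    have "((\<lambda>t. (2 ^ k * (cmod (D k t))\<^sup>2 + (1 / 2) ^ k) / 2) has_integral
        (2 ^ k * (2 * pi * (\<Sum>n. (cmod (d k n))\<^sup>2)) + (2 * pi) * (1 / 2) ^ k) / 2) {0..2 * pi}"
      using has_integral_const_real[of "(1 / 2 :: real) ^ k" 0 "2 * pi"] unfolding D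
      by (intro has_integral_divide has_integral_add has_integral_mult_right parseval sd) simp
    moreover have "(\<lambda>t. cmod (D k t)) integrable_on {0..2 * pi}"
      by (intro integrable_continuous_real continuous_intros contD)
    \<comment> \<open>The weight \<open>2 ^ k\<close> balances the mean square \<open>4 * (1 / 4) ^ k\<close> against the constant
      \<open>(1 / 2) ^ k\<close>.\<close>
    moreover have "cmod (D k t) \<le> (2 ^ k * (cmod (D k t))\<^sup>2 + (1 / 2) ^ k) / 2" for t
    proof -
      have "0 \<le> (2 ^ k * cmod (D k t) - 1)\<^sup>2 * (1 / 2) ^ k" by simp
      also have "\<dots> = 2 ^ k * (cmod (D k t))\<^sup>2 + (1 / 2) ^ k - 2 * cmod (D k t)"
        by (simp add: power2_eq_square algebra_simps power_divide)
      finally show ?thesis by simp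
    qed
    ultimately have "integral {0..2 * pi} (\<lambda>t. cmod (D k t)) \<le>
        (2 ^ k * (2 * pi * (\<Sum>n. (cmod (d k n))\<^sup>2)) + (2 * pi) * (1 / 2) ^ k) / 2"
      by (intro has_integral_le[OF integrable_integral]) auto
    also have "\<dots> \<le> (2 ^ k * (2 * pi * (4 * (1 / 4) ^ k)) + (2 * pi) * (1 / 2) ^ k) / 2"
      using sq[of k] by (intro divide_right_mono add_mono mult_left_mono) auto
    also have "(2::real) ^ k * (2 * pi * (4 * (1 / 4) ^ k)) = 8 * pi * (2 * (1 / 4)) ^ k"
      unfolding power_mult_distrib by simp
    also have "(8 * pi * (2 * (1 / 4)) ^ k + (2 * pi) * (1 / 2) ^ k) / 2 = 5 * pi * (1 / 2) ^ k"
      by simp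
    finally show ?thesis .
  qed
  have intD: "integrable ?M (\<lambda>t. cmod (D k t))" for k
    by (intro continuous_imp_integrable_real continuous_intros contD)
  have nn: "(\<integral>\<^sup>+ t. ennreal (cmod (D k t)) \<partial>?M) \<le> ennreal (5 * pi * (1 / 2) ^ k)" for k
    using int1[of k] by (simp add: nn_integral_eq_integral[OF intD] lebesgue_integral_eq_integral[OF intD] ennreal_leI)
  have meas: "(\<lambda>t. ennreal (cmod (D k t))) \<in> borel_measurable ?M" for k
    using borel_measurable_integrable[OF intD] by measurable
  have geo: "summable (\<lambda>k. 5 * pi * (1 / 2 :: real) ^ k)"
    by (intro summable_mult summable_geometric) simp
  have "(\<integral>\<^sup>+ t. (\<Sum>k. ennreal (cmod (D k t))) \<partial>?M) = (\<Sum>k. \<integral>\<^sup>+ t. ennreal (cmod (D k t)) \<partial>?M)"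
    by (rule nn_integral_suminf[OF meas])
  also have "\<dots> \<le> (\<Sum>k. ennreal (5 * pi * (1 / 2) ^ k))"
    by (intro suminf_le nn) auto
  also have "\<dots> < \<infinity>"
    unfolding infinity_ennreal_def less_top[symmetric]
    by (rule ennreal_suminf_neq_top[OF geo]) simp
  finally have "(\<integral>\<^sup>+ t. (\<Sum>k. ennreal (cmod (D k t))) \<partial>?M) \<noteq> \<infinity>"
    by (rule less_imp_neq)
  then have "AE t in ?M. (\<Sum>k. ennreal (cmod (D k t))) \<noteq> \<infinity>"
    by (intro nn_integral_PInf_AE borel_measurable_suminf_order meas)
  then show ?thesis
  proof eventually_elim
    case (elim t)
    then have "summable (\<lambda>k. cmod (D k t))"
      unfolding infinity_ennreal_def by (intro summable_suminf_not_top) simp_all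
    then have "summable (\<lambda>k. D k t)"
      by (rule summable_norm_cancel)
    then have "convergent (\<lambda>K. u 0 t + (\<Sum>k<K. D k t))"
      by (auto simp: summable_iff_convergent intro!: convergent_add convergent_const)
    also have "(\<lambda>K. u 0 t + (\<Sum>k<K. D k t)) = (\<lambda>K. u K t)"
      unfolding D_def by (subst sum_lessThan_telescope) simp
    finally show ?case unfolding u_def .
  qed
qed

lemma eval1_sums: "cmod z < 1 \<Longrightarrow> (\<lambda>n. coeff1 f n * z ^ n) sums eval1 f z"
  using expansion_coeff1[of f] unfolding expansion_def by (intro has_sum_imp_sums) simp

lemma eval1_outside: "\<not> cmod z < 1 \<Longrightarrow> eval1 f z = 0"
  using expansion_coeff1[of f] unfolding expansion_def by simp

lemma holomorphic_eval1: "eval1 f holomorphic_on unit_disc"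
  by (rule power_series_holomorphic[where a = "coeff1 f"]) (simp add: eval1_sums)

lemma norm_hardy1_sums: "(\<lambda>n. (cmod (coeff1 f n))\<^sup>2) sums (norm f)\<^sup>2"
  unfolding norm_hardy1_square
  using square_summable_coeff1[of f] unfolding square_summable_def
  by (intro has_sum_imp_sums has_sum_infsum)

text \<open>The coefficients of the antiderivative are those of \<open>f\<close> divided by \<open>n + 1\<close>. They are
  absolutely summable, because both \<open>f\<close> and \<open>1 / (n + 1)\<close> are square summable, and this gives
  continuity up to the boundary.\<close>

lemma ex_continuous_antiderivative:
  fixes f :: hardy1
  obtains F where "continuous_on (cball 0 1) F"
    "\<And>z. cmod z < 1 \<Longrightarrow> (F has_field_derivative eval1 f z) (at z)"
proof -
  define a where "a n = (case n of 0 \<Rightarrow> 0 | Suc m \<Rightarrow> coeff1 f m / of_nat (Suc m))" for n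
  have a0: "a 0 = 0" and aS: "a (Suc m) = coeff1 f m / of_nat (Suc m)" for m
    by (simp_all add: a_def)
  have "summable (\<lambda>m. cmod (a (Suc m)))"
  proof (rule summable_comparison_test)
    have "summable (\<lambda>n. 1 / real (Suc n) ^ 2)"
      using summable_ignore_initial_segment[OF inverse_power_summable[of 2, where 'a = real], of 1]
      by (simp add: inverse_eq_divide)
    then show "summable (\<lambda>m. (cmod (coeff1 f m))\<^sup>2 + 1 / real (Suc m) ^ 2)"
      by (intro summable_add sums_summable[OF norm_hardy1_sums])
    show "\<exists>N. \<forall>m\<ge>N. norm (cmod (a (Suc m))) \<le> (cmod (coeff1 f m))\<^sup>2 + 1 / real (Suc m) ^ 2"
    proof (intro exI[of _ 0] allI impI)
      fix m
      have "2 * cmod (coeff1 f m) * (1 / real (Suc m)) \<le> (cmod (coeff1 f m))\<^sup>2 + (1 / real (Suc m))\<^sup>2"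
        by (rule sum_squares_bound)
      moreover have "norm (cmod (a (Suc m))) = cmod (coeff1 f m) * (1 / real (Suc m))"
        unfolding aS norm_divide norm_of_nat by simp
      moreover have "0 \<le> cmod (coeff1 f m) * (1 / real (Suc m))" by simp
      ultimately show "norm (cmod (a (Suc m))) \<le> (cmod (coeff1 f m))\<^sup>2 + 1 / real (Suc m) ^ 2"
        by (simp only: power_divide power_one)
    qed
  qed
  then have a: "summable (\<lambda>n. cmod (a n))"
    by (rule summable_Suc_iff[THEN iffD1])
  let ?F = "\<lambda>z. \<Sum>n. a n * z ^ n"
  have "uniform_limit (cball 0 1) (\<lambda>N z. \<Sum>n<N. a n * z ^ n) ?F sequentially"
    by (rule Weierstrass_m_test[OF _ a]) (simp add: norm_mult norm_power mult_left_le power_le_one)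
  then have cont: "continuous_on (cball 0 1) ?F"
    by (rule uniform_limit_theorem[rotated]) (auto intro!: always_eventually continuous_intros)
  have "summable (\<lambda>n. a n * of_real (1 ^ n))"
    using summable_norm_cancel[OF a] by simp
  from power_series_and_derivative_0[OF this] obtain g g' where g:
    "\<And>z. cmod z < 1 \<Longrightarrow> (\<lambda>n. a n * z ^ n) sums g z"
    "\<And>z. cmod z < 1 \<Longrightarrow> (\<lambda>n. of_nat n * a n * z ^ (n - 1)) sums g' z"
    "\<And>z. cmod z < 1 \<Longrightarrow> (g has_field_derivative g' z) (at z)"
    by blast
  have "(?F has_field_derivative eval1 f z) (at z)" if z: "cmod z < 1" for z
  proof -
    have "(\<lambda>m. of_nat (Suc m) * a (Suc m) * z ^ (Suc m - 1)) sums g' z"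
      using g(2)[OF z] by (subst sums_Suc_iff) simp
    moreover have "of_nat (Suc m) * a (Suc m) * z ^ (Suc m - 1) = coeff1 f m * z ^ m" for m
      unfolding aS using of_nat_neq_0[of m, where 'a = complex] by (simp del: of_nat_Suc)
    ultimately have "(\<lambda>m. coeff1 f m * z ^ m) sums g' z"
      by (simp only:)
    then have "g' z = eval1 f z"
      using eval1_sums[OF z] by (rule sums_unique2)
    with g(3)[OF z] have "(g has_field_derivative eval1 f z) (at z)" by simp
    then show ?thesis
    proof (rule has_field_derivative_transform_within_open)
      show "g x = ?F x" if "x \<in> ball 0 1" for x
        using sums_unique[OF g(1)[of x]] that by simp
    qed (use z in auto)
  qed
  with cont show ?thesis by (rule that)
qed

text \<open>The dilations of \<open>f\<close> along fast radii converge almost everywhere on the circle to some \<open>b\<close>,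
  and \<open>\<bar>b\<bar> = 1\<close> almost everywhere because \<open>\<bar>b\<bar>\<close> is at most one and has mean square one. To
  pass from these radii to the full radial limit, integrate: the continuous antiderivative
  restricted to the circle is the integral of its boundary derivative, so it is differentiable
  at almost every point, and there the radial limit exists.\<close>

theorem inner_function_of_norm_one:
  fixes f :: hardy1
  assumes bd: "\<And>z. cmod z < 1 \<Longrightarrow> cmod (eval1 f z) \<le> 1" and norm: "norm f = 1"
  shows "inner_function (eval1 f)"
proof -
  let ?S = "{0..2 * pi}"
  let ?M = "lebesgue_on ?S"
  define c where "c = coeff1 f"
  have c: "summable (\<lambda>n. (cmod (c n))\<^sup>2)" and c1: "(\<Sum>n. (cmod (c n))\<^sup>2) = 1"
    using norm_hardy1_sums[of f] by (simp_all add: c_def norm sums_iff)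
  obtain r :: "nat \<Rightarrow> real" where r: "\<And>k. 0 < r k" "\<And>k. r k < 1" and r1: "r \<longlonglongrightarrow> 1"
    and fast: "\<And>k. (\<Sum>n. (cmod (c n))\<^sup>2 * (1 - r k ^ n)\<^sup>2) \<le> (1 / 4) ^ k"
    using ex_fast_radii[OF c] by blast
  define u where "u k t = eval1 f (of_real (r k) * cis t)" for k t
  define b where "b t = lim (\<lambda>k. u k t)" for t
  have rk: "cmod (of_real (r k) * cis t) < 1" for k t
    using r[of k] by (simp add: norm_mult)
  have u: "u k t = (\<Sum>n. c n * of_real (r k) ^ n * cis t ^ n)" for k t
    using sums_unique[OF eval1_sums[OF rk]] by (simp add: u_def c_def power_mult_distrib mult.assoc)
  have sb: "summable (\<lambda>n. cmod (c n * of_real (r k) ^ n))" for k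
    using summable_power_scaled[OF c, of "r k"] r[of k] by (simp add: norm_mult norm_power less_imp_le)
  have contu: "continuous_on A (u k)" for k A
    unfolding u by (rule continuous_on_cis_series[OF sb])
  have u1: "cmod (u k t) \<le> 1" for k t
    unfolding u_def by (rule bd[OF rk])
  have conv: "AE t in lebesgue. t \<in> ?S \<longrightarrow> (\<lambda>k. u k t) \<longlonglongrightarrow> b t"
    using AE_convergent_fast_radii[OF c r fast]
    by (subst (asm) AE_restrict_space_iff) (simp_all add: b_def convergent_LIMSEQ_iff flip: u)
  have meas: "(\<lambda>t. u k t) \<in> borel_measurable (lebesgue_on {x..y})" for k x y
    by (intro continuous_imp_measurable_on_sets_lebesgue contu) simp
  have measb: "b \<in> borel_measurable (lebesgue_on {x..y})" for x y
    unfolding b_def by (rule borel_measurable_lim_metric[OF meas])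
  have conv_on: "AE t in lebesgue_on {x..y}. (\<lambda>k. u k t) \<longlonglongrightarrow> b t" if "0 \<le> x" "y \<le> 2 * pi" for x y
    using conv that by (subst AE_restrict_space_iff) (auto elim!: eventually_mono)
  have fin: "integrable (lebesgue_on {x..y}) (\<lambda>_. 1 :: real)" for x y :: real
    by (intro continuous_imp_integrable_real continuous_intros)
  have b1: "AE t in ?M. cmod (b t) \<le> 1"
    using conv_on[of 0 "2 * pi"]
  proof (rule AE_mp)
    show "AE t in ?M. (\<lambda>k. u k t) \<longlonglongrightarrow> b t \<longrightarrow> cmod (b t) \<le> 1"
      using LIMSEQ_le_const2[OF tendsto_norm] u1 by (intro AE_I2 impI) blast
  qed simp_all
  have b_unimodular: "AE t in ?M. cmod (b t) = 1"
  proof -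
    have lim1: "(\<lambda>k. integral\<^sup>L ?M (\<lambda>t. (cmod (u k t))\<^sup>2)) \<longlonglongrightarrow> integral\<^sup>L ?M (\<lambda>t. (cmod (b t))\<^sup>2)"
    proof (rule integral_dominated_convergence[where w = "\<lambda>_. 1"])
      show "AE t in ?M. (\<lambda>k. (cmod (u k t))\<^sup>2) \<longlonglongrightarrow> (cmod (b t))\<^sup>2"
        using conv_on[of 0 "2 * pi"] by (auto elim!: eventually_mono intro!: tendsto_intros)
      show "AE t in ?M. norm ((cmod (u k t))\<^sup>2) \<le> 1" for k
        using u1 by (intro AE_I2) (simp add: power_le_one)
    qed (use measb[of 0 "2 * pi"] meas[of _ 0 "2 * pi"] fin[of 0 "2 * pi"] in auto)
    have intb: "integrable ?M (\<lambda>t. (cmod (b t))\<^sup>2)"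
    proof (rule Bochner_Integration.integrable_bound[OF fin[of 0 "2 * pi"]])
      show "(\<lambda>t. (cmod (b t))\<^sup>2) \<in> borel_measurable ?M"
        using measb[of 0 "2 * pi"] by measurable
      show "AE t in ?M. norm ((cmod (b t))\<^sup>2) \<le> norm (1 :: real)"
        using b1 by eventually_elim (simp add: power_le_one)
    qed
    have "integral\<^sup>L ?M (\<lambda>t. (cmod (u k t))\<^sup>2) = 2 * pi * (\<Sum>n. (cmod (c n))\<^sup>2 * (r k ^ n)\<^sup>2)" for k
    proof -
      have "integral\<^sup>L ?M (\<lambda>t. (cmod (u k t))\<^sup>2) = integral ?S (\<lambda>t. (cmod (u k t))\<^sup>2)"
        by (intro lebesgue_integral_eq_integral continuous_imp_integrable_real continuous_intros contu) simp
      also have "\<dots> = 2 * pi * (\<Sum>n. (cmod (c n * of_real (r k) ^ n))\<^sup>2)"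
        unfolding u by (rule integral_unique[OF parseval[OF sb]])
      also have "(\<lambda>n. (cmod (c n * of_real (r k) ^ n))\<^sup>2) = (\<lambda>n. (cmod (c n))\<^sup>2 * (r k ^ n)\<^sup>2)"
        using r[of k] by (simp add: norm_mult norm_power power_mult_distrib)
      finally show ?thesis .
    qed
    moreover have "(\<lambda>k. 2 * pi * (\<Sum>n. (cmod (c n))\<^sup>2 * (r k ^ n)\<^sup>2)) \<longlonglongrightarrow>
        2 * pi * (\<Sum>n. (cmod (c n))\<^sup>2 * (1 ^ n)\<^sup>2)"
    proof (rule tendsto_mult_left)
      show "(\<lambda>k. \<Sum>n. (cmod (c n))\<^sup>2 * (r k ^ n)\<^sup>2) \<longlonglongrightarrow> (\<Sum>n. (cmod (c n))\<^sup>2 * (1 ^ n)\<^sup>2)"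
      proof (rule tannerys_theorem[THEN conjunct2, THEN conjunct2, OF _ _ c])
        show "(\<lambda>k. (cmod (c n))\<^sup>2 * (r k ^ n)\<^sup>2) \<longlonglongrightarrow> (cmod (c n))\<^sup>2 * (1 ^ n)\<^sup>2" for n
          by (intro tendsto_intros r1)
        show "\<forall>\<^sub>F (n, k) in sequentially \<times>\<^sub>F sequentially. norm ((cmod (c n))\<^sup>2 * (r k ^ n)\<^sup>2) \<le> (cmod (c n))\<^sup>2"
          using r by (intro always_eventually) (simp add: mult_left_le power_le_one less_imp_le)
      qed simp
    qed
    ultimately have "(\<lambda>k. integral\<^sup>L ?M (\<lambda>t. (cmod (u k t))\<^sup>2)) \<longlonglongrightarrow> 2 * pi"
      using c1 by simp
    with lim1 have "integral\<^sup>L ?M (\<lambda>t. (cmod (b t))\<^sup>2) = 2 * pi"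
      by (rule LIMSEQ_unique)
    moreover have "integral\<^sup>L ?M (\<lambda>_. 1 :: real) = 2 * pi"
      using has_integral_const_real[of "1 :: real" 0 "2 * pi"]
      by (subst lebesgue_integral_eq_integral[OF fin]) (simp_all add: integral_unique)
    ultimately have "integral\<^sup>L ?M (\<lambda>t. 1 - (cmod (b t))\<^sup>2) = 0"
      by (simp only: Bochner_Integration.integral_diff[OF fin intb])
    moreover have "AE t in ?M. 0 \<le> 1 - (cmod (b t))\<^sup>2"
      using b1 by eventually_elim (simp add: power_le_one)
    moreover have "integrable ?M (\<lambda>t. 1 - (cmod (b t))\<^sup>2)"
      by (rule Bochner_Integration.integrable_diff[OF fin intb])
    ultimately have "AE t in ?M. 1 - (cmod (b t))\<^sup>2 = 0"
      using integral_nonneg_eq_0_iff_AE[of ?M "\<lambda>t. 1 - (cmod (b t))\<^sup>2"] by simp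
    then show ?thesis
    proof eventually_elim
      case (elim t)
      then have "(cmod (b t))\<^sup>2 = 1\<^sup>2" by simp
      then show ?case by (rule power2_eq_imp_eq) simp_all
    qed
  qed
  obtain F where contF: "continuous_on (cball 0 1) F"
    and F': "\<And>z. cmod z < 1 \<Longrightarrow> (F has_field_derivative eval1 f z) (at z)"
    using ex_continuous_antiderivative by blast
  \<comment> \<open>The angular derivative of \<open>F\<close> on the unit circle: the limit along the radii \<open>r k\<close> of the angular
    derivatives of \<open>F\<close> on smaller circles.\<close>
  define g where "g t = \<i> * cis t * b t" for t
  have g: "g integrable_on {x..y}" "F (cis y) - F (cis x) = integral {x..y} g"
    if xy: "0 \<le> x" "x \<le> y" "y \<le> 2 * pi" for x y
  proof -
    let ?N = "lebesgue_on {x..y}"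
    define v where "v k t = \<i> * (of_real (r k) * cis t) * u k t" for k t
    have contv: "continuous_on A (v k)" for k A
      unfolding v_def by (intro continuous_intros contu)
    have intg: "integrable ?N g" and lim1: "(\<lambda>k. integral\<^sup>L ?N (v k)) \<longlonglongrightarrow> integral\<^sup>L ?N g"
    proof -
      have gm: "g \<in> borel_measurable ?N"
        unfolding g_def
        by (intro borel_measurable_times measb continuous_imp_measurable_on_sets_lebesgue continuous_intros) simp
      have vm: "v k \<in> borel_measurable ?N" for k
        by (intro continuous_imp_measurable_on_sets_lebesgue contv) simp
      have vb: "AE t in ?N. norm (v k t) \<le> 1" for k
      proof (intro AE_I2)
        fix t
        have "norm (v k t) = r k * cmod (u k t)"
          using r[of k] by (simp add: v_def norm_mult)
        also have "\<dots> \<le> 1 * 1" using r[of k] u1 by (intro mult_mono) auto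
        finally show "norm (v k t) \<le> 1" by simp
      qed
      have vl: "AE t in ?N. (\<lambda>k. v k t) \<longlonglongrightarrow> g t"
        using conv_on[OF xy(1,3)]
      proof eventually_elim
        case (elim t)
        then have "(\<lambda>k. v k t) \<longlonglongrightarrow> \<i> * (of_real 1 * cis t) * b t"
          unfolding v_def by (intro tendsto_intros r1)
        then show ?case by (simp add: g_def)
      qed
      show "integrable ?N g" "(\<lambda>k. integral\<^sup>L ?N (v k)) \<longlonglongrightarrow> integral\<^sup>L ?N g"
        using integrable_dominated_convergence[OF gm vm fin vl vb]
          integral_dominated_convergence[OF gm vm fin vl vb] by blast+
    qed
    have "integral\<^sup>L ?N (v k) = F (of_real (r k) * cis y) - F (of_real (r k) * cis x)" for k
    proof -
      have "((\<lambda>t. v k t) has_integral F (of_real (r k) * cis y) - F (of_real (r k) * cis x)) {x..y}"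
      proof (rule fundamental_theorem_of_calculus[OF xy(2)])
        fix t
        have "((\<lambda>z. F (of_real (r k) * exp (\<i> * z))) has_field_derivative
            eval1 f (of_real (r k) * exp (\<i> * of_real t)) * (of_real (r k) * (exp (\<i> * of_real t) * \<i>))) (at (of_real t))"
          by (rule DERIV_chain2[OF F'])
            (use rk[of k t] in \<open>auto intro!: derivative_eq_intros simp: cis_conv_exp\<close>)
        from has_vector_derivative_real_field[OF this]
        show "((\<lambda>t. F (of_real (r k) * cis t)) has_vector_derivative v k t) (at t within {x..y})"
          by (simp add: cis_conv_exp has_vector_derivative_at_within v_def u_def mult_ac)
      qed
      then have "integral {x..y} (v k) = F (of_real (r k) * cis y) - F (of_real (r k) * cis x)"
        by (rule integral_unique)
      moreover have "integral\<^sup>L ?N (v k) = integral {x..y} (v k)"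
        by (intro lebesgue_integral_eq_integral continuous_imp_integrable_real contv) simp
      ultimately show ?thesis by simp
    qed
    with lim1 have "(\<lambda>k. F (of_real (r k) * cis y) - F (of_real (r k) * cis x)) \<longlonglongrightarrow> integral\<^sup>L ?N g"
      by simp
    moreover have "(\<lambda>k. F (of_real (r k) * cis t)) \<longlonglongrightarrow> F (cis t)" for t
    proof (rule continuous_on_tendsto_compose[OF contF])
      have "(\<lambda>k. of_real (r k) * cis t) \<longlonglongrightarrow> of_real 1 * cis t"
        by (intro tendsto_intros r1)
      then show "(\<lambda>k. of_real (r k) * cis t) \<longlonglongrightarrow> cis t" by simp
      show "\<forall>\<^sub>F k in sequentially. of_real (r k) * cis t \<in> cball 0 1"
        using rk by (intro always_eventually allI) (simp add: less_imp_le)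
    qed simp
    then have "(\<lambda>k. F (of_real (r k) * cis y) - F (of_real (r k) * cis x)) \<longlonglongrightarrow> F (cis y) - F (cis x)"
      by (intro tendsto_diff)
    ultimately have "F (cis y) - F (cis x) = integral\<^sup>L ?N g"
      using LIMSEQ_unique by blast
    also have "\<dots> = integral {x..y} g"
      by (rule lebesgue_integral_eq_integral[OF intg]) simp
    finally show "F (cis y) - F (cis x) = integral {x..y} g" .
    show "g integrable_on {x..y}"
      using has_integral_integral_lebesgue_on[OF intg] by auto
  qed
  obtain N where N: "negligible N" and diff: "\<And>t. t \<in> {0<..<2 * pi} \<Longrightarrow> t \<notin> N \<Longrightarrow>
      ((\<lambda>h. (F (cis (t + h)) - F (cis t)) / of_real h) \<longlongrightarrow> g t) (at 0)"
    using lebesgue_differentiation[of g 0 "2 * pi" "\<lambda>t. F (cis t)"] g by auto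
  have holF: "F holomorphic_on ball 0 1"
    unfolding holomorphic_on_open[OF open_ball] using F' by (intro ballI exI) simp
  have rad: "((\<lambda>s. eval1 f (of_real s * cis t)) \<longlongrightarrow> b t) (at_left 1)"
    if t: "t \<in> {0<..<2 * pi}" "t \<notin> N" for t
  proof -
    have "((\<lambda>s. deriv F (of_real s * cis t)) \<longlongrightarrow> b t) (at_left (1 :: real))"
    proof (rule radial_limit_deriv[OF contF holF])
      show "((\<lambda>z. (F z - F (cis t)) / (z - cis t)) \<longlongrightarrow> b t) (at (cis t) within sphere 0 1)"
        using diff[OF t] unfolding g_def by (rule difference_quotient_on_circle)
    qed simp
    moreover have "\<forall>\<^sub>F s :: real in at_left 1. deriv F (of_real s * cis t) = eval1 f (of_real s * cis t)"
      by (rule eventually_at_leftI[of 0]) (auto intro!: DERIV_imp_deriv F' simp: norm_mult)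
    ultimately show ?thesis by (rule Lim_transform_eventually)
  qed
  have "AE t in lebesgue. t \<notin> N \<union> {0, 2 * pi}"
    using N by (intro AE_not_in) (simp add: negligible_iff_null_sets[symmetric] negligible_Un)
  then have "AE t in lebesgue. t \<in> ?S \<longrightarrow> t \<notin> N \<union> {0, 2 * pi}"
    by (rule eventually_mono) blast
  then have "AE t in ?M. t \<notin> N \<union> {0, 2 * pi}"
    by (subst AE_restrict_space_iff) simp_all
  moreover have "AE t in ?M. t \<in> ?S"
    by (intro AE_I2) simp
  ultimately have "AE t in ?M. \<exists>l. ((\<lambda>s. eval1 f (of_real s * cis t)) \<longlongrightarrow> l) (at_left 1) \<and> cmod l = 1"
    using b_unimodular
  proof eventually_elim
    case (elim t)
    then have "t \<in> {0<..<2 * pi}" "t \<notin> N" by auto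
    from rad[OF this] elim show ?case by blast
  qed
  moreover have "bounded (eval1 f ` unit_disc)"
    using bd by (intro boundedI[of _ 1]) auto
  ultimately show ?thesis
    unfolding inner_function_def using holomorphic_eval1 by blast
qed

section \<open>The shift and the reproducing kernels of the Hardy space\<close>

lemma square_summable_nat_iff:
  fixes a :: "nat \<Rightarrow> complex"
  shows "square_summable a \<longleftrightarrow> summable (\<lambda>n. (cmod (a n))\<^sup>2)"
  unfolding square_summable_def by (rule summable_on_UNIV_nonneg_real_iff) simp

lemma hardy1_eqI:
  assumes "\<And>z. cmod z < 1 \<Longrightarrow> eval1 f z = eval1 g z"
  shows "f = g"
proof -
  have "eval1 f z = eval1 g z" for z
    using assms eval1_outside by (cases "cmod z < 1") simp_all
  then show ?thesis by (intro eval1_inject[THEN iffD1] ext)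
qed

lemma cinner_sums: "(\<lambda>n. coeff1 f n * cnj (coeff1 g n)) sums cinner f g"
  unfolding cinner_hardy1_def
  by (intro has_sum_imp_sums has_sum_infsum square_summable_mult_cnj square_summable_coeff1)

definition monomial1 :: "nat \<Rightarrow> hardy1" where
  "monomial1 n = hardy1_of (\<lambda>k. if k = n then 1 else 0)"

lemma coeff1_monomial1: "coeff1 (monomial1 n) k = (if k = n then 1 else 0)"
proof -
  have "(\<lambda>k. (cmod (if k = n then 1 else 0))\<^sup>2) = (\<lambda>k. if k = n then 1 else 0)"
    by auto
  then have "square_summable (\<lambda>k. if k = n then 1 else 0)"
    using summable_single[of n "\<lambda>_. 1 :: real"] by (simp add: square_summable_nat_iff)
  then show ?thesis
    unfolding monomial1_def by (simp add: coeff1_hardy1_of)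
qed

lemma cinner_monomial1: "cinner f (monomial1 n) = coeff1 f n"
proof -
  have "(\<lambda>k. coeff1 f k * cnj (coeff1 (monomial1 n) k)) = (\<lambda>k. if k = n then coeff1 f k else 0)"
    by (auto simp: coeff1_monomial1)
  then have "(\<lambda>k. if k = n then coeff1 f k else 0) sums cinner f (monomial1 n)"
    using cinner_sums[of f "monomial1 n"] by simp
  then show ?thesis
    using sums_single sums_unique2 by blast
qed

lemma eval1_monomial1: "cmod z < 1 \<Longrightarrow> eval1 (monomial1 n) z = z ^ n"
proof -
  assume z: "cmod z < 1"
  have "(\<lambda>k. coeff1 (monomial1 n) k * z ^ k) = (\<lambda>k. if k = n then z ^ k else 0)"
    by (auto simp: coeff1_monomial1)
  then have "(\<lambda>k. if k = n then z ^ k else 0) sums eval1 (monomial1 n) z"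
    using eval1_sums[OF z, of "monomial1 n"] by simp
  then show ?thesis
    using sums_single sums_unique2 by blast
qed

definition backward_shift :: "hardy1 \<Rightarrow> hardy1" where
  "backward_shift f = hardy1_of (\<lambda>n. coeff1 f (Suc n))"

lemma coeff1_backward_shift: "coeff1 (backward_shift f) n = coeff1 f (Suc n)"
proof -
  have "square_summable (\<lambda>n. coeff1 f (Suc n))"
    using square_summable_coeff1[of f] unfolding square_summable_nat_iff
    by (rule summable_Suc_iff[THEN iffD2])
  then show ?thesis
    unfolding backward_shift_def by (simp add: coeff1_hardy1_of)
qed

lemma eval1_add: "eval1 (f + g) z = eval1 f z + eval1 g z"
  by (simp add: plus_hardy1.rep_eq)

lemma eval1_scaleC: "eval1 (c *\<^sub>C f) z = c * eval1 f z"
  by (simp add: scaleC_hardy1.rep_eq)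

lemma eval1_diff: "eval1 (f - g) z = eval1 f z - eval1 g z"
  using eval1_add[of "f - g" g z] by simp

lemma eval1_mult_z: "eval1 (mult_z f) z = z * eval1 f z"
  by (simp add: mult_z.rep_eq)

lemma eval1_mult_z_funpow: "eval1 ((mult_z ^^ n) f) z = z ^ n * eval1 f z"
  by (induction n) (simp_all add: eval1_mult_z mult.assoc)

lemma coeff1_mult_z: "coeff1 (mult_z f) n = (case n of 0 \<Rightarrow> 0 | Suc m \<Rightarrow> coeff1 f m)"
proof -
  define a where "a n = (case n of 0 \<Rightarrow> 0 | Suc m \<Rightarrow> coeff1 f m)" for n
  have "summable (\<lambda>n. (cmod (a (Suc n)))\<^sup>2)"
    using square_summable_coeff1[of f] by (simp add: a_def square_summable_nat_iff)
  then have a: "square_summable a"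
    unfolding square_summable_nat_iff by (rule summable_Suc_iff[THEN iffD1])
  have "mult_z f = hardy1_of a"
  proof (rule hardy1_eqI)
    fix z :: complex assume z: "cmod z < 1"
    have "(\<lambda>n. a (Suc n) * z ^ Suc n) sums (z * eval1 f z)"
      using sums_mult[OF eval1_sums[OF z], of z f] by (simp add: a_def mult_ac)
    then have "(\<lambda>n. a n * z ^ n) sums (z * eval1 f z + a 0 * z ^ 0)"
      by (rule sums_Suc)
    moreover have "(\<lambda>n. a n * z ^ n) sums eval1 (hardy1_of a) z"
      using eval1_sums[OF z, of "hardy1_of a"] by (simp add: coeff1_hardy1_of[OF a])
    ultimately show "eval1 (mult_z f) z = eval1 (hardy1_of a) z"
      using sums_unique2 by (force simp: eval1_mult_z a_def)
  qed
  then show ?thesis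
    by (simp add: coeff1_hardy1_of[OF a] a_def)
qed

lemma cinner_mult_z: "cinner (mult_z f) g = cinner f (backward_shift g)"
proof -
  have "(\<lambda>n. coeff1 (mult_z f) (Suc n) * cnj (coeff1 g (Suc n))) sums cinner f (backward_shift g)"
    using cinner_sums[of f "backward_shift g"] by (simp add: coeff1_mult_z coeff1_backward_shift)
  then have "(\<lambda>n. coeff1 (mult_z f) n * cnj (coeff1 g n)) sums
      (cinner f (backward_shift g) + coeff1 (mult_z f) 0 * cnj (coeff1 g 0))"
    by (rule sums_Suc)
  then show ?thesis
    using sums_unique2[OF cinner_sums] by (simp add: coeff1_mult_z)
qed

lemma backward_shift_mult_z: "backward_shift (mult_z f) = f"
  by (rule coeff1_inject) (auto simp: coeff1_backward_shift coeff1_mult_z)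

lemma cinner_mult_z_mult_z: "cinner (mult_z f) (mult_z g) = cinner f g"
  by (simp add: cinner_mult_z backward_shift_mult_z)

lemma mult_z_backward_shift: "f = coeff1 f 0 *\<^sub>C monomial1 0 + mult_z (backward_shift f)"
  by (rule coeff1_inject)
    (auto simp: coeff1_add coeff1_scale coeff1_monomial1 coeff1_mult_z coeff1_backward_shift
      split: nat.split)

lemma adjoint_mult_z: "adjoint_on UNIV mult_z = backward_shift"
proof
  interpret U: closed_csubspace "UNIV :: hardy1 set"
    by unfold_locales (simp_all add: complex_vs.subspace_UNIV)
  fix f show "adjoint_on UNIV mult_z f = backward_shift f"
    by (rule U.adjoint_on_eqI) (simp_all add: cinner_mult_z)
qed

text \<open>The reproducing kernel of evaluation at \<open>a\<close>, that is \<open>z \<mapsto> 1 / (1 - cnj a * z)\<close>.\<close>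

definition szego_kernel :: "complex \<Rightarrow> hardy1" where
  "szego_kernel a = hardy1_of (\<lambda>n. cnj a ^ n)"

lemma coeff1_kernel: "cmod a < 1 \<Longrightarrow> coeff1 (szego_kernel a) n = cnj a ^ n"
  unfolding szego_kernel_def by (simp add: coeff1_hardy1_of square_summable_powers)

lemma cinner_kernel: "cmod a < 1 \<Longrightarrow> cinner f (szego_kernel a) = eval1 f a"
  using sums_unique2[OF cinner_sums[of f "szego_kernel a"]] eval1_sums[of a f] by (simp add: coeff1_kernel)

lemma kernel_nonzero: "cmod a < 1 \<Longrightarrow> szego_kernel a \<noteq> 0"
  using coeff1_kernel[of a 0] by (auto simp: coeff1_zero)

text \<open>The zero of the automorphism at \<open>a\<close> puts the kernel function into the complement. Conversely
  the range contains all \<open>z ^ n * (z - a)\<close>, and orthogonality to these determines all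
  coefficients from the constant one.\<close>

lemma orth_complement_disc_automorphism_range:
  assumes a: "cmod a < 1" and c: "cmod c = 1"
  shows "orth_complement (mult_range (disc_automorphism c a)) = range (\<lambda>s. s *\<^sub>C szego_kernel a)"
proof
  show "range (\<lambda>s. s *\<^sub>C szego_kernel a) \<subseteq> orth_complement (mult_range (disc_automorphism c a))"
  proof clarify
    fix s
    have "cinner h (szego_kernel a) = 0" if h: "h \<in> mult_range (disc_automorphism c a)" for h
    proof -
      obtain f where "\<forall>z\<in>unit_disc. eval1 h z = disc_automorphism c a z * eval1 f z"
        using h unfolding mult_range_def by blast
      then have "eval1 h a = 0" using a by (simp add: disc_automorphism_def)
      then show ?thesis using a by (simp add: cinner_kernel)
    qed
    then show "s *\<^sub>C szego_kernel a \<in> orth_complement (mult_range (disc_automorphism c a))"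
      by (simp add: orth_complement_def cinner_scaleC_left cinner_eq_0_commute[of "szego_kernel a"])
  qed
  show "orth_complement (mult_range (disc_automorphism c a)) \<subseteq> range (\<lambda>s. s *\<^sub>C szego_kernel a)"
  proof
    fix g assume g: "g \<in> orth_complement (mult_range (disc_automorphism c a))"
    \<comment> \<open>\<open>z ^ n * (z - a)\<close> is the product of \<open>disc_automorphism c a\<close> with the polynomial
      \<open>cnj c * (1 - cnj a * z) * z ^ n\<close>.\<close>
    have step: "coeff1 g (Suc n) = cnj a * coeff1 g n" for n
    proof -
      define h where "h = monomial1 (Suc n) - a *\<^sub>C monomial1 n"
      define f where "f = cnj c *\<^sub>C (monomial1 n - cnj a *\<^sub>C monomial1 (Suc n))"
      have "h \<in> mult_range (disc_automorphism c a)"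
        unfolding mult_range_def
      proof (intro CollectI exI[of _ f] ballI)
        fix z assume "z \<in> unit_disc"
        then have z: "cmod z < 1" by simp
        have "cmod (cnj a * z) < 1"
          using mult_strict_mono[of "cmod a" 1 "cmod z" 1] a z by (simp add: norm_mult)
        then have nz: "1 - cnj a * z \<noteq> 0" by auto
        have cc: "c * cnj c = 1" using c by (simp add: complex_norm_square[symmetric])
        have f: "eval1 f z = cnj c * ((1 - cnj a * z) * z ^ n)"
          using z by (simp add: f_def eval1_scaleC eval1_diff eval1_monomial1 algebra_simps)
        have "disc_automorphism c a z * eval1 f z =
            (c * cnj c) * ((z - a) / (1 - cnj a * z) * (1 - cnj a * z)) * z ^ n"
          unfolding disc_automorphism_def f by (simp only: mult_ac)
        also have "\<dots> = (z - a) * z ^ n"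
          using nz cc by simp
        also have "\<dots> = eval1 h z"
          using z by (simp add: h_def eval1_scaleC eval1_diff eval1_monomial1 algebra_simps)
        finally show "eval1 h z = disc_automorphism c a z * eval1 f z" ..
      qed
      then have "cinner g h = 0" using g by (simp add: orth_complement_def)
      then show ?thesis
        by (simp add: h_def cinner_diff_right cinner_scaleC_right cinner_monomial1)
    qed
    have "g = coeff1 g 0 *\<^sub>C szego_kernel a"
    proof (rule coeff1_inject, rule ext)
      fix n
      have "coeff1 g n = coeff1 g 0 * cnj a ^ n"
        by (induction n) (simp_all add: step)
      then show "coeff1 g n = coeff1 (coeff1 g 0 *\<^sub>C szego_kernel a) n"
        by (simp only: coeff1_scale coeff1_kernel[OF a])
    qed
    then show "g \<in> range (\<lambda>s. s *\<^sub>C szego_kernel a)" by (rule range_eqI)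
  qed
qed

section \<open>Beurling's theorem\<close>

text \<open>The partial sums form a Cauchy sequence by the Pythagorean theorem.\<close>

lemma orthonormal_series:
  fixes e :: "nat \<Rightarrow> 'a::complex_hilbert"
  assumes on: "\<And>m n. cinner (e m) (e n) = (if m = n then 1 else 0)"
    and a: "summable (\<lambda>n. (cmod (a n))\<^sup>2)"
  obtains h where "(\<lambda>N. \<Sum>n<N. a n *\<^sub>C e n) \<longlonglongrightarrow> h" "(norm h)\<^sup>2 = (\<Sum>n. (cmod (a n))\<^sup>2)"
proof -
  define X where "X N = (\<Sum>n<N. a n *\<^sub>C e n)" for N
  have norm2: "(norm (\<Sum>n\<in>A. a n *\<^sub>C e n))\<^sup>2 = (\<Sum>n\<in>A. (cmod (a n))\<^sup>2)" if "finite A" for A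
    using that
  proof induction
    case (insert k A)
    have "cinner (a k *\<^sub>C e k) (\<Sum>n\<in>A. a n *\<^sub>C e n) = (\<Sum>n\<in>A. cinner (a k *\<^sub>C e k) (a n *\<^sub>C e n))"
      by (rule linear_sum[OF bounded_linear.linear[OF bounded_linear_cinner_right]])
    also have "\<dots> = 0"
      using insert(2) by (intro sum.neutral) (auto simp: cinner_scaleC_left cinner_scaleC_right on)
    finally have "(norm (a k *\<^sub>C e k + (\<Sum>n\<in>A. a n *\<^sub>C e n)))\<^sup>2 =
        (norm (a k *\<^sub>C e k))\<^sup>2 + (norm (\<Sum>n\<in>A. a n *\<^sub>C e n))\<^sup>2"
      by (rule norm_add_square_orth)
    moreover have "complex_of_real ((norm (e k))\<^sup>2) = 1"
      unfolding cinner_self[symmetric] on by simp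
    then have "(norm (e k))\<^sup>2 = 1" unfolding of_real_eq_1_iff .
    ultimately show ?case
      using insert by (simp add: norm_scaleC power_mult_distrib)
  qed simp
  have diff: "X n - X m = (\<Sum>k\<in>{m..<n}. a k *\<^sub>C e k)" if "m \<le> n" for m n
    unfolding X_def using sum_diff_nat_ivl[of 0 m n "\<lambda>k. a k *\<^sub>C e k"] that by (simp add: lessThan_atLeast0)
  have "Cauchy X"
  proof (rule CauchyI')
    fix \<epsilon> :: real assume \<epsilon>: "\<epsilon> > 0"
    obtain N where N: "\<And>m n. m \<ge> N \<Longrightarrow> norm (\<Sum>k\<in>{m..<n}. (cmod (a k))\<^sup>2) < \<epsilon>\<^sup>2"
      using a[unfolded summable_Cauchy] \<epsilon> by (meson zero_less_power)
    have "dist (X m) (X n) < \<epsilon>" if "m \<ge> N" "n > m" for m n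
    proof -
      have "(norm (X n - X m))\<^sup>2 < \<epsilon>\<^sup>2"
        using N[OF that(1), of n] that unfolding diff[OF less_imp_le[OF that(2)]]
        by (subst norm2) (simp_all add: sum_nonneg)
      then show ?thesis
        using \<epsilon> by (subst dist_commute) (simp add: dist_norm power_less_imp_less_base)
    qed
    then show "\<exists>M. \<forall>m\<ge>M. \<forall>n>m. dist (X m) (X n) < \<epsilon>" by blast
  qed
  then obtain h where h: "X \<longlonglongrightarrow> h"
    using Cauchy_convergent convergent_def by blast
  have "(\<lambda>N. (norm (X N))\<^sup>2) \<longlonglongrightarrow> (norm h)\<^sup>2"
    by (intro tendsto_intros h)
  moreover have "(\<lambda>N. (norm (X N))\<^sup>2) \<longlonglongrightarrow> (\<Sum>n. (cmod (a n))\<^sup>2)"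
    unfolding X_def norm2[OF finite_lessThan] by (rule summable_LIMSEQ[OF a])
  ultimately have "(norm h)\<^sup>2 = (\<Sum>n. (cmod (a n))\<^sup>2)"
    by (rule LIMSEQ_unique)
  with h show ?thesis unfolding X_def by (rule that)
qed

text \<open>The shifts of a wandering vector \<open>t\<close> form an orthonormal sequence. In terms of boundary
  values the conditions say that all Fourier coefficients of \<open>\<bar>t\<bar>\<^sup>2 - 1\<close> vanish.\<close>

definition wandering :: "hardy1 \<Rightarrow> bool" where
  "wandering t \<longleftrightarrow> norm t = 1 \<and> (\<forall>n>0. cinner ((mult_z ^^ n) t) t = 0)"

lemma wandering_orthonormal:
  assumes "wandering t"
  shows "cinner ((mult_z ^^ m) t) ((mult_z ^^ n) t) = (if m = n then 1 else 0)"
proof -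
  have shift: "cinner ((mult_z ^^ (k + j)) t) ((mult_z ^^ j) t) = cinner ((mult_z ^^ k) t) t" for k j
    by (induction j) (simp_all add: cinner_mult_z_mult_z)
  have le: "cinner ((mult_z ^^ m) t) ((mult_z ^^ n) t) = (if m = n then 1 else 0)" if "n \<le> m" for m n
    using shift[of "m - n" n] that assms by (auto simp: wandering_def cinner_self)
  show ?thesis
  proof (cases "n \<le> m")
    case False
    then show ?thesis using le[of m n] by (subst cinner_commute) simp
  qed (rule le)
qed

text \<open>The product of the functions \<open>t\<close> and \<open>f\<close>. A product of two functions in \<open>H\<^sup>2\<close> need not be in
  \<open>H\<^sup>2\<close>, so it is taken as the limit in norm of the products of \<open>t\<close> with the Taylor
  polynomials of \<open>f\<close>, which for wandering \<open>t\<close> is an orthonormal series. This form also shows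
  that the product stays in every closed shift-invariant subspace that contains \<open>t\<close>.\<close>

definition multiply :: "hardy1 \<Rightarrow> hardy1 \<Rightarrow> hardy1" where
  "multiply t f = lim (\<lambda>N. \<Sum>n<N. coeff1 f n *\<^sub>C (mult_z ^^ n) t)"

lemma
  assumes t: "wandering t"
  shows multiply_tendsto: "(\<lambda>N. \<Sum>n<N. coeff1 f n *\<^sub>C (mult_z ^^ n) t) \<longlonglongrightarrow> multiply t f"
    and norm_multiply: "norm (multiply t f) = norm f"
proof -
  obtain h where h: "(\<lambda>N. \<Sum>n<N. coeff1 f n *\<^sub>C (mult_z ^^ n) t) \<longlonglongrightarrow> h"
    and n: "(norm h)\<^sup>2 = (\<Sum>n. (cmod (coeff1 f n))\<^sup>2)"
    by (rule orthonormal_series[OF wandering_orthonormal[OF t] sums_summable[OF norm_hardy1_sums]])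
  have m: "multiply t f = h"
    unfolding multiply_def by (rule limI[OF h])
  show "(\<lambda>N. \<Sum>n<N. coeff1 f n *\<^sub>C (mult_z ^^ n) t) \<longlonglongrightarrow> multiply t f"
    unfolding m by (rule h)
  have "(norm h)\<^sup>2 = (norm f)\<^sup>2"
    unfolding n by (rule sums_unique[OF norm_hardy1_sums, symmetric])
  then show "norm (multiply t f) = norm f"
    unfolding m by (rule power2_eq_imp_eq) simp_all
qed

lemma eval1_multiply:
  assumes t: "wandering t" and z: "cmod z < 1"
  shows "eval1 (multiply t f) z = eval1 t z * eval1 f z"
proof -
  let ?X = "\<lambda>N. \<Sum>n<N. coeff1 f n *\<^sub>C (mult_z ^^ n) t"
  have X: "cinner (?X N) (szego_kernel z) = eval1 t z * (\<Sum>n<N. coeff1 f n * z ^ n)" for N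
  proof -
    have "cinner (?X N) (szego_kernel z) = (\<Sum>n<N. cinner (coeff1 f n *\<^sub>C (mult_z ^^ n) t) (szego_kernel z))"
      by (rule linear_sum[OF bounded_linear.linear[OF bounded_linear_cinner_left]])
    also have "\<dots> = (\<Sum>n<N. coeff1 f n * (z ^ n * eval1 t z))"
      by (simp only: cinner_kernel[OF z] eval1_scaleC eval1_mult_z_funpow)
    finally show ?thesis
      by (simp add: sum_distrib_left mult_ac)
  qed
  have "(\<lambda>N. cinner (?X N) (szego_kernel z)) \<longlonglongrightarrow> cinner (multiply t f) (szego_kernel z)"
    by (rule tendsto_cinner_left[OF multiply_tendsto[OF t]])
  moreover have "(\<lambda>N. cinner (?X N) (szego_kernel z)) \<longlonglongrightarrow> eval1 t z * eval1 f z"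
    unfolding X using eval1_sums[OF z, of f] unfolding sums_def by (rule tendsto_mult_left)
  ultimately have "cinner (multiply t f) (szego_kernel z) = eval1 t z * eval1 f z"
    by (rule LIMSEQ_unique)
  then show ?thesis
    by (simp only: cinner_kernel[OF z])
qed

lemma multiply_mem:
  assumes t: "wandering t" and M: "closed M" "complex_vs.subspace M"
    and inv: "\<And>g. g \<in> M \<Longrightarrow> mult_z g \<in> M" and tM: "t \<in> M"
  shows "multiply t f \<in> M"
proof -
  have "(mult_z ^^ n) t \<in> M" for n
    by (induction n) (simp_all add: inv tM)
  then have "(\<Sum>n<N. coeff1 f n *\<^sub>C (mult_z ^^ n) t) \<in> M" for N
    by (intro complex_vs.subspace_sum[OF M(2)] complex_vs.subspace_scale[OF M(2)])
  then show ?thesis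
    using closed_sequentially[OF M(1) _ multiply_tendsto[OF t]] by blast
qed

text \<open>Multiplication by \<open>t\<close> is an isometry, so its value on the kernel function \<open>k\<close> at \<open>a\<close>
  satisfies \<open>\<bar>t a * k a\<bar> \<le> \<parallel>k\<parallel>\<^sup>2 = k a\<close>.\<close>

lemma wandering_bounded:
  assumes t: "wandering t" and a: "cmod a < 1"
  shows "cmod (eval1 t a) \<le> 1"
proof -
  define h where "h = multiply t (szego_kernel a)"
  have h: "norm h = norm (szego_kernel a)" and ha: "eval1 h a = eval1 t a * eval1 (szego_kernel a) a"
    by (simp_all add: h_def norm_multiply[OF t] eval1_multiply[OF t a])
  have k: "eval1 (szego_kernel a) a = of_real ((norm (szego_kernel a))\<^sup>2)"
    using cinner_kernel[OF a, of "szego_kernel a"] by (simp add: cinner_self)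
  have "cmod (eval1 h a) \<le> (norm (szego_kernel a))\<^sup>2"
    using norm_cinner_le[of h "szego_kernel a"] by (simp add: cinner_kernel[OF a] h power2_eq_square)
  moreover have "cmod (eval1 h a) = cmod (eval1 t a) * (norm (szego_kernel a))\<^sup>2"
    unfolding ha k norm_mult norm_of_real by simp
  moreover have "0 < (norm (szego_kernel a))\<^sup>2"
    using kernel_nonzero[OF a] by simp
  ultimately show ?thesis by simp
qed

lemma wandering_inner_function: "wandering t \<Longrightarrow> inner_function (eval1 t)"
  using inner_function_of_norm_one wandering_bounded wandering_def by blast

text \<open>Let \<open>n\<close> be the least order of vanishing at \<open>0\<close> of a function in \<open>M\<close>. The coefficient of
  index \<open>n\<close> is a functional that is nonzero on \<open>M\<close> and zero on \<open>z * M\<close>; the vector of \<open>M\<close>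
  representing it is the projection of \<open>z ^ n\<close>, and normalising it gives \<open>t\<close>.\<close>

lemma ex_wandering:
  assumes M: "closed M" "complex_vs.subspace M" and inv: "\<And>f. f \<in> M \<Longrightarrow> mult_z f \<in> M"
    and "M \<noteq> {0}"
  shows "\<exists>t\<in>M. wandering t \<and> (\<forall>f\<in>M. cinner (mult_z f) t = 0)"
proof -
  interpret closed_csubspace M using M by unfold_locales
  obtain f where f: "f \<in> M" "f \<noteq> 0"
    using \<open>M \<noteq> {0}\<close> zero_mem by blast
  then have "coeff1 f \<noteq> coeff1 0" using coeff1_inject by blast
  then have ex: "\<exists>n. \<exists>f\<in>M. coeff1 f n \<noteq> 0"
    using f(1) by (auto simp: fun_eq_iff coeff1_zero)
  define n where "n = (LEAST n. \<exists>f\<in>M. coeff1 f n \<noteq> 0)"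
  obtain g where g: "g \<in> M" "coeff1 g n \<noteq> 0"
    using LeastI_ex[OF ex] unfolding n_def by blast
  have low: "coeff1 f k = 0" if "f \<in> M" "k < n" for f k
    using not_less_Least[of k] that unfolding n_def by blast
  define p where "p = orth_proj M (monomial1 n)"
  have p: "cinner f p = coeff1 f n" if "f \<in> M" for f
    using cinner_orth_proj_right[OF that] by (simp add: p_def cinner_monomial1)
  have p0: "p \<noteq> 0" using p[OF g(1)] g(2) by auto
  define t where "t = of_real (inverse (norm p)) *\<^sub>C p"
  have tM: "t \<in> M" unfolding t_def p_def by (intro scaleC_mem orth_proj_mem)
  have orth: "cinner (mult_z f) t = 0" if "f \<in> M" for f
    using p[OF inv[OF that]] low[OF that]
    by (simp add: t_def cinner_scaleC_right coeff1_mult_z split: nat.splits)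
  have pow: "(mult_z ^^ k) t \<in> M" for k
    by (induction k) (simp_all add: tM inv)
  have "cinner ((mult_z ^^ k) t) t = 0" if "k > 0" for k
    using that orth[OF pow] by (cases k) simp_all
  moreover have "norm t = 1"
    using p0 by (simp add: t_def norm_scaleC norm_inverse)
  ultimately have "wandering t" by (simp add: wandering_def)
  then show ?thesis using tM orth by blast
qed

text \<open>Let \<open>t\<close> be a wandering vector of \<open>M = Q\<^sup>\<bottom>\<close> that is orthogonal to \<open>z * M\<close>, and let \<open>N\<close> be the
  range of multiplication by \<open>t\<close>. Then \<open>N\<close> is contained in \<open>M\<close>, and the claim is that nothing
  is left over. The remainder \<open>M' = M \<inter> N\<^sup>\<bottom>\<close> is again closed and shift-invariant. If it were
  nonzero, it would contain a wandering vector \<open>s\<close>; the product of \<open>s\<close> and \<open>t\<close> would then lie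
  in \<open>M'\<close>, as a multiple of \<open>s\<close>, and in \<open>N\<close>, as a multiple of \<open>t\<close>. These are orthogonal, but
  the product has norm one.\<close>

theorem beurling:
  assumes Q: "quotient_module1 Q" and "Q \<noteq> UNIV"
  obtains \<theta> where "inner_function \<theta>" "Q = orth_complement (mult_range \<theta>)"
proof -
  interpret Q: closed_csubspace Q
    using Q by unfold_locales (simp_all add: quotient_module1_def)
  define M where "M = orth_complement Q"
  have closedM: "closed M" and subM: "complex_vs.subspace M"
    by (simp_all add: M_def closed_orth_complement subspace_orth_complement)
  have inv: "mult_z f \<in> M" if "f \<in> M" for f
    using that Q by (simp add: M_def orth_complement_def cinner_mult_z quotient_module1_def adjoint_mult_z)
  have "M \<noteq> {0}"
  proof
    assume "M = {0}"
    then have "Q = orth_complement {0}"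
      using Q.orth_complement_twice by (simp add: M_def)
    then show False
      using \<open>Q \<noteq> UNIV\<close> by (simp add: orth_complement_def)
  qed
  obtain t where t: "t \<in> M" "wandering t" and orth: "\<And>f. f \<in> M \<Longrightarrow> cinner (mult_z f) t = 0"
    using ex_wandering[OF closedM subM inv \<open>M \<noteq> {0}\<close>] by blast
  define N where "N = mult_range (eval1 t)"
  have N: "f \<in> N \<longleftrightarrow> (\<exists>g. \<forall>z. cmod z < 1 \<longrightarrow> eval1 f z = eval1 t z * eval1 g z)" for f
    unfolding N_def mult_range_def by (simp add: Ball_def)
  have NM: "f \<in> M" if f: "f \<in> N" for f
  proof -
    obtain g where g: "\<forall>z. cmod z < 1 \<longrightarrow> eval1 f z = eval1 t z * eval1 g z"
      using f[unfolded N] ..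
    have "f = multiply t g"
      using g by (intro hardy1_eqI) (simp add: eval1_multiply[OF t(2)])
    with multiply_mem[OF t(2) closedM subM inv t(1)] show ?thesis by simp
  qed
  define M' where "M' = M \<inter> orth_complement N"
  have closedM': "closed M'" and subM': "complex_vs.subspace M'"
    unfolding M'_def using closedM subM closed_orth_complement subspace_orth_complement
    by (blast intro: closed_Int complex_vs.subspace_inter)+
  have inv': "mult_z m \<in> M'" if m: "m \<in> M'" for m
  proof -
    have "cinner (mult_z m) f = 0" if f: "f \<in> N" for f
    proof -
      obtain g where g: "\<forall>z. cmod z < 1 \<longrightarrow> eval1 f z = eval1 t z * eval1 g z"
        using f[unfolded N] ..
      define h where "h = multiply t (backward_shift g)"
      have h: "eval1 h z = eval1 t z * eval1 (backward_shift g) z" if "cmod z < 1" for z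
        unfolding h_def by (rule eval1_multiply[OF t(2) that])
      have "f = coeff1 g 0 *\<^sub>C t + mult_z h"
      proof (rule hardy1_eqI)
        fix z :: complex assume z: "cmod z < 1"
        have "eval1 g z = coeff1 g 0 + z * eval1 (backward_shift g) z"
          by (subst mult_z_backward_shift[of g])
            (simp add: eval1_add eval1_scaleC eval1_mult_z eval1_monomial1[OF z])
        then show "eval1 f z = eval1 (coeff1 g 0 *\<^sub>C t + mult_z h) z"
          by (simp add: g[rule_format, OF z] h[OF z] eval1_add eval1_scaleC eval1_mult_z algebra_simps)
      qed
      moreover have "h \<in> N" unfolding N using h by blast
      then have "cinner m h = 0" using m by (simp add: M'_def orth_complement_def)
      moreover have "cinner (mult_z m) t = 0" using m orth by (simp add: M'_def)
      ultimately show ?thesis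
        by (simp add: cinner_add_right cinner_scaleC_right cinner_mult_z_mult_z)
    qed
    then show ?thesis
      using m inv by (simp add: M'_def orth_complement_def)
  qed
  have "M' = {0}"
  proof (rule ccontr)
    assume "M' \<noteq> {0}"
    obtain s where s: "s \<in> M'" "wandering s"
      using ex_wandering[OF closedM' subM' inv' \<open>M' \<noteq> {0}\<close>] by blast
    define h where "h = multiply s t"
    have "h \<in> N"
      unfolding N h_def by (intro exI[of _ s]) (simp add: eval1_multiply[OF s(2)] mult.commute)
    moreover have "h \<in> orth_complement N"
      using multiply_mem[OF s(2) closedM' subM' inv' s(1)] by (simp add: M'_def h_def)
    ultimately have "h = 0" by (rule orth_complement_disjoint)
    then show False
      using norm_multiply[OF s(2), of t] t(2) by (simp add: h_def wandering_def)
  qed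
  have "Q = orth_complement N"
  proof
    show sub: "Q \<subseteq> orth_complement N"
      using orth_complement_antimono[of N M] NM subset_orth_complement_twice[of Q]
      by (auto simp: M_def)
    show "orth_complement N \<subseteq> Q"
    proof
      fix x assume "x \<in> orth_complement N"
      then have "x - orth_proj Q x \<in> orth_complement N"
        using complex_vs.subspace_diff[OF subspace_orth_complement] sub Q.orth_proj_mem by blast
      then have "x - orth_proj Q x \<in> M'"
        using Q.diff_orth_proj by (simp add: M'_def M_def)
      then have "x = orth_proj Q x" using \<open>M' = {0}\<close> by simp
      then show "x \<in> Q" using Q.orth_proj_mem[of x] by simp
    qed
  qed
  then show ?thesis
    using wandering_inner_function[OF t(2)] unfolding N_def by (intro that)
qed

section \<open>Vanishing and normal compressions of the shift\<close>

lemma backward_shift_scaleC: "backward_shift (c *\<^sub>C f) = c *\<^sub>C backward_shift f"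
  by (rule coeff1_inject) (simp add: fun_eq_iff coeff1_backward_shift coeff1_scale)

lemma mult_z_add: "mult_z (f + g) = mult_z f + mult_z g"
  by (rule hardy1_eqI) (simp add: eval1_mult_z eval1_add algebra_simps)

lemma mult_z_scaleC: "mult_z (c *\<^sub>C f) = c *\<^sub>C mult_z f"
  by (rule hardy1_eqI) (simp add: eval1_mult_z eval1_scaleC)

lemma monomial1_0: "monomial1 0 = szego_kernel 0"
  by (rule coeff1_inject) (simp add: fun_eq_iff coeff1_monomial1 coeff1_kernel)

lemma backward_shift_kernel: "cmod a < 1 \<Longrightarrow> backward_shift (szego_kernel a) = cnj a *\<^sub>C szego_kernel a"
  by (rule coeff1_inject) (simp add: fun_eq_iff coeff1_backward_shift coeff1_kernel coeff1_scale)

text \<open>An eigenvector of the backward shift has geometric coefficients, and these are square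
  summable only for an eigenvalue in the disc.\<close>

lemma backward_shift_eigenvector:
  assumes eig: "backward_shift k = l *\<^sub>C k" and "k \<noteq> 0"
  shows "cmod l < 1" "k = coeff1 k 0 *\<^sub>C szego_kernel (cnj l)"
proof -
  have step: "coeff1 k (Suc n) = l * coeff1 k n" for n
    using arg_cong[OF eig, of "\<lambda>f. coeff1 f n"] by (simp add: coeff1_backward_shift coeff1_scale)
  have c: "coeff1 k n = coeff1 k 0 * l ^ n" for n
    by (induction n) (simp_all add: step)
  have "coeff1 k 0 \<noteq> 0"
  proof
    assume "coeff1 k 0 = 0"
    then have "coeff1 k = coeff1 0"
      unfolding fun_eq_iff coeff1_zero using c by (metis mult_zero_left)
    then show False using \<open>k \<noteq> 0\<close> coeff1_inject by blast
  qed
  have "(\<lambda>n. (cmod (coeff1 k n))\<^sup>2) \<longlonglongrightarrow> 0"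
    by (rule summable_LIMSEQ_zero[OF sums_summable[OF norm_hardy1_sums]])
  then have "\<forall>\<^sub>F n in sequentially. (cmod (coeff1 k n))\<^sup>2 < (cmod (coeff1 k 0))\<^sup>2"
    by (rule order_tendstoD(2)) (use \<open>coeff1 k 0 \<noteq> 0\<close> in simp)
  then obtain n where "(cmod (coeff1 k n))\<^sup>2 < (cmod (coeff1 k 0))\<^sup>2"
    by (auto simp: eventually_sequentially)
  then have "cmod (coeff1 k n) < cmod (coeff1 k 0)"
    by (rule power_less_imp_less_base) simp
  then have "cmod (coeff1 k 0) * cmod l ^ n < cmod (coeff1 k 0) * 1"
    unfolding c[of n] by (simp only: norm_mult norm_power mult_1_right)
  then have "cmod l ^ n < 1"
    by (rule mult_left_less_imp_less) simp
  then show l: "cmod l < 1"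
    using one_le_power[of "cmod l" n] by (meson not_le)
  show "k = coeff1 k 0 *\<^sub>C szego_kernel (cnj l)"
  proof (rule coeff1_inject, rule ext)
    fix n show "coeff1 k n = coeff1 (coeff1 k 0 *\<^sub>C szego_kernel (cnj l)) n"
      using l by (subst c) (simp add: coeff1_scale coeff1_kernel)
  qed
qed

locale quotient_module = closed_csubspace Q for Q :: "hardy1 set" +
  assumes backward_shift_mem: "f \<in> Q \<Longrightarrow> backward_shift f \<in> Q"
begin

definition compressed_shift :: "hardy1 \<Rightarrow> hardy1" where
  "compressed_shift f = orth_proj Q (mult_z f)"

lemma compressed_shift_mem: "compressed_shift f \<in> Q"
  unfolding compressed_shift_def by (rule orth_proj_mem)

lemma cinner_compressed_shift: "g \<in> Q \<Longrightarrow> cinner (compressed_shift f) g = cinner f (backward_shift g)"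
  unfolding compressed_shift_def by (simp add: cinner_orth_proj cinner_mult_z)

lemma compressed_shift_scaleC: "compressed_shift (c *\<^sub>C f) = c *\<^sub>C compressed_shift f"
  unfolding compressed_shift_def by (simp add: mult_z_scaleC orth_proj_scaleC)

lemma kernel_span_eqI:
  assumes sub: "Q \<subseteq> range (\<lambda>s. s *\<^sub>C szego_kernel a)" and nz: "Q \<noteq> {0}"
  shows "Q = range (\<lambda>s. s *\<^sub>C szego_kernel a)"
proof
  obtain f where f: "f \<in> Q" "f \<noteq> 0"
    using nz zero_mem by blast
  then obtain s where s: "f = s *\<^sub>C szego_kernel a" using sub by blast
  with f(2) have "s \<noteq> 0" by auto
  then have "szego_kernel a = inverse s *\<^sub>C f"
    by (simp add: s scaleC_scaleC scaleC_one)
  then have "szego_kernel a \<in> Q"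
    using scaleC_mem[OF f(1)] by simp
  then show "range (\<lambda>s. s *\<^sub>C szego_kernel a) \<subseteq> Q"
    using scaleC_mem by blast
qed (rule sub)

text \<open>The compression vanishes exactly if its adjoint does, and the kernel of the backward shift
  consists of the constants, which are the multiples of \<open>szego_kernel 0\<close>.\<close>

lemma compressed_shift_eq_0_iff:
  assumes nz: "Q \<noteq> {0}"
  shows "(\<forall>f\<in>Q. compressed_shift f = 0) \<longleftrightarrow> Q = range (\<lambda>s. s *\<^sub>C szego_kernel 0)"
proof
  assume compressed_shift: "\<forall>f\<in>Q. compressed_shift f = 0"
  have "Q \<subseteq> range (\<lambda>s. s *\<^sub>C szego_kernel 0)"
  proof
    fix g assume g: "g \<in> Q"
    have "cinner (backward_shift g) (backward_shift g) = cinner (compressed_shift (backward_shift g)) g"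
      by (rule cinner_compressed_shift[OF g, symmetric])
    then have "backward_shift g = 0"
      using compressed_shift backward_shift_mem[OF g] by simp
    then have "g = coeff1 g 0 *\<^sub>C szego_kernel 0"
      using mult_z_backward_shift[of g] mult_z_scaleC[of 0 0] by (simp add: monomial1_0)
    then show "g \<in> range (\<lambda>s. s *\<^sub>C szego_kernel 0)" by (rule range_eqI)
  qed
  then show "Q = range (\<lambda>s. s *\<^sub>C szego_kernel 0)"
    using nz by (rule kernel_span_eqI)
next
  assume Q: "Q = range (\<lambda>s. s *\<^sub>C szego_kernel 0)"
  have "backward_shift g = 0" if "g \<in> Q" for g
    using that unfolding Q by (auto simp: backward_shift_scaleC backward_shift_kernel)
  then have "cinner (compressed_shift f) (compressed_shift f) = 0" for f
    by (simp add: cinner_compressed_shift[OF compressed_shift_mem] compressed_shift_mem)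
  then show "\<forall>f\<in>Q. compressed_shift f = 0" by simp
qed

text \<open>Write \<open>B\<close> for the compressed shift and let \<open>k\<close> be the projection of the constant \<open>1\<close> to \<open>Q\<close>.
  Then \<open>B B*\<close> is the identity minus the rank one operator \<open>g \<mapsto> \<langle>g, k\<rangle> k\<close>. If \<open>B\<close> is normal, it
  commutes with \<open>B B*\<close>, so \<open>k\<close> is an eigenvector of \<open>B\<close> and of \<open>B*\<close>, the restricted backward
  shift; hence \<open>k\<close> is a multiple of a kernel function. The orthogonal complement of \<open>k\<close> in \<open>Q\<close>
  is invariant under the backward shift and consists of functions vanishing at \<open>0\<close>, so it is
  zero.\<close>

lemma normal_imp_kernel_span:
  assumes nz: "Q \<noteq> {0}" and normal: "\<And>g. g \<in> Q \<Longrightarrow> compressed_shift (backward_shift g) = backward_shift (compressed_shift g)"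
  shows "\<exists>a. cmod a < 1 \<and> Q = range (\<lambda>s. s *\<^sub>C szego_kernel a)"
proof -
  define k where "k = orth_proj Q (monomial1 0)"
  have kQ: "k \<in> Q" unfolding k_def by (rule orth_proj_mem)
  have k: "cinner g k = coeff1 g 0" if "g \<in> Q" for g
    unfolding k_def using cinner_orth_proj_right[OF that] by (simp add: cinner_monomial1)
  have BB: "compressed_shift (backward_shift g) = g - cinner g k *\<^sub>C k" if g: "g \<in> Q" for g
  proof -
    have "mult_z (backward_shift g) = g - coeff1 g 0 *\<^sub>C monomial1 0"
      using mult_z_backward_shift[of g] by (simp add: algebra_simps)
    then show ?thesis
      unfolding compressed_shift_def
      by (simp add: orth_proj_diff orth_proj_id[OF g] orth_proj_scaleC k[OF g] k_def[symmetric])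
  qed
  have k0: "k \<noteq> 0"
  proof
    assume "k = 0"
    then have c0: "coeff1 g 0 = 0" if "g \<in> Q" for g using k[OF that] by simp
    have "coeff1 g n = 0" if "g \<in> Q" for g n
      using that
    proof (induction n arbitrary: g)
      case (Suc n)
      then show ?case using backward_shift_mem[OF Suc.prems] coeff1_backward_shift[of g n] by metis
    qed (rule c0)
    then have "g = 0" if "g \<in> Q" for g
      using that by (intro coeff1_inject) (simp add: fun_eq_iff coeff1_zero)
    then show False using nz zero_mem by blast
  qed
  \<comment> \<open>Normality gives \<open>B (B B*) = (B B*) B\<close>; both sides are evaluated at \<open>g\<close> with \<open>BB\<close>.\<close>
  have comm: "cinner g k *\<^sub>C compressed_shift k = cinner (compressed_shift g) k *\<^sub>C k" if g: "g \<in> Q" for g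
  proof -
    have "compressed_shift (g - cinner g k *\<^sub>C k) = compressed_shift (backward_shift (compressed_shift g))"
      using BB[OF g] normal[OF g] by simp
    also have "\<dots> = compressed_shift g - cinner (compressed_shift g) k *\<^sub>C k"
      by (rule BB[OF compressed_shift_mem])
    moreover have "compressed_shift (g - cinner g k *\<^sub>C k) = compressed_shift g - cinner g k *\<^sub>C compressed_shift k"
    proof -
      have "compressed_shift (g - cinner g k *\<^sub>C k) + cinner g k *\<^sub>C compressed_shift k = compressed_shift g"
        unfolding compressed_shift_scaleC[symmetric] unfolding compressed_shift_def orth_proj_add[symmetric] mult_z_add[symmetric]
        by simp
      then show ?thesis by (simp add: algebra_simps)
    qed
    ultimately show ?thesis by simp
  qed
  have kk: "cinner k k \<noteq> 0" using k0 by simp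
  define m where "m = cinner (compressed_shift k) k / cinner k k"
  have Bk: "compressed_shift k = m *\<^sub>C k"
  proof -
    have "compressed_shift k = (inverse (cinner k k) * cinner k k) *\<^sub>C compressed_shift k"
      using kk by (simp add: scaleC_one)
    also have "\<dots> = inverse (cinner k k) *\<^sub>C (cinner (compressed_shift k) k *\<^sub>C k)"
      unfolding scaleC_scaleC[symmetric] comm[OF kQ] ..
    finally show ?thesis by (simp add: m_def scaleC_scaleC divide_inverse mult.commute)
  qed
  define l where "l = cinner (backward_shift k) k / cinner k k"
  have "backward_shift k = l *\<^sub>C k"
  proof -
    define g where "g = backward_shift k - l *\<^sub>C k"
    have gQ: "g \<in> Q" unfolding g_def by (intro diff_mem scaleC_mem backward_shift_mem kQ)
    have gk: "cinner g k = 0"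
      using kk by (simp add: g_def l_def cinner_diff_left cinner_scaleC_left)
    have "cinner (compressed_shift g) k *\<^sub>C k = 0"
      using comm[OF gQ] gk by simp
    then have "cinner (compressed_shift g) k = 0" using k0 by simp
    then have "cinner g (backward_shift k) = 0"
      by (simp add: cinner_compressed_shift[OF kQ])
    then have "cinner g g = 0"
      using gk by (simp add: g_def cinner_diff_right cinner_scaleC_right)
    then show ?thesis by (simp add: g_def)
  qed
  note eig = backward_shift_eigenvector[OF this k0]
  have "Q \<subseteq> range (\<lambda>s. s *\<^sub>C szego_kernel (cnj l))"
  proof
    fix g assume gQ: "g \<in> Q"
    define h where "h = g - (cinner g k / cinner k k) *\<^sub>C k"
    have hQ: "h \<in> Q" unfolding h_def by (intro diff_mem scaleC_mem gQ kQ)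
    have hk: "cinner h k = 0"
      using kk by (simp add: h_def cinner_diff_left cinner_scaleC_left)
    have "coeff1 f n = 0" if "f \<in> Q" "cinner f k = 0" for f n
      using that
    proof (induction n arbitrary: f)
      case 0
      then show ?case using k by simp
    next
      case (Suc n)
      have "cinner k (backward_shift f) = cinner (compressed_shift k) f"
        by (rule cinner_compressed_shift[OF Suc.prems(1), symmetric])
      also have "\<dots> = 0"
        using Suc.prems(2) by (simp add: Bk cinner_scaleC_left cinner_eq_0_commute[of k])
      finally have "coeff1 (backward_shift f) n = 0"
        by (intro Suc.IH backward_shift_mem Suc.prems(1)) (simp add: cinner_eq_0_commute[of _ k])
      then show ?case by (simp add: coeff1_backward_shift)
    qed
    from this[OF hQ hk] have "h = 0"
      by (intro coeff1_inject) (simp add: fun_eq_iff coeff1_zero)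
    then have "g = (cinner g k / cinner k k) *\<^sub>C k" by (simp add: h_def)
    also have "\<dots> = (cinner g k / cinner k k) *\<^sub>C (coeff1 k 0 *\<^sub>C szego_kernel (cnj l))"
      by (rule arg_cong[OF eig(2)])
    finally have "g = (cinner g k / cinner k k * coeff1 k 0) *\<^sub>C szego_kernel (cnj l)"
      by (simp only: scaleC_scaleC)
    then show "g \<in> range (\<lambda>s. s *\<^sub>C szego_kernel (cnj l))" by (rule range_eqI)
  qed
  then have "Q = range (\<lambda>s. s *\<^sub>C szego_kernel (cnj l))"
    using nz by (rule kernel_span_eqI)
  then show ?thesis using eig(1) by (intro exI[of _ "cnj l"]) simp
qed

text \<open>Every operator on a line is normal.\<close>

lemma kernel_span_imp_normal:
  assumes a: "cmod a < 1" and Q: "Q = range (\<lambda>s. s *\<^sub>C szego_kernel a)" and g: "g \<in> Q"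
  shows "compressed_shift (backward_shift g) = backward_shift (compressed_shift g)"
proof -
  have "compressed_shift g \<in> range (\<lambda>s. s *\<^sub>C szego_kernel a)" using compressed_shift_mem[of g] by (simp only: Q)
  then obtain m where m: "compressed_shift g = m *\<^sub>C szego_kernel a" by blast
  obtain s where s: "g = s *\<^sub>C szego_kernel a" using g unfolding Q by blast
  have "backward_shift g = cnj a *\<^sub>C g"
    by (simp add: s backward_shift_scaleC backward_shift_kernel[OF a] scaleC_scaleC mult.commute)
  moreover have "backward_shift (compressed_shift g) = cnj a *\<^sub>C compressed_shift g"
    by (simp add: m backward_shift_scaleC backward_shift_kernel[OF a] scaleC_scaleC mult.commute)
  ultimately show ?thesis by (simp add: compressed_shift_scaleC)
qed

lemma normal_iff:
  assumes "Q \<noteq> {0}"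
  shows "(\<forall>g\<in>Q. compressed_shift (backward_shift g) = backward_shift (compressed_shift g)) \<longleftrightarrow>
    (\<exists>a. cmod a < 1 \<and> Q = range (\<lambda>s. s *\<^sub>C szego_kernel a))"
proof
  assume "\<forall>g\<in>Q. compressed_shift (backward_shift g) = backward_shift (compressed_shift g)"
  then show "\<exists>a. cmod a < 1 \<and> Q = range (\<lambda>s. s *\<^sub>C szego_kernel a)"
    by (intro normal_imp_kernel_span[OF assms]) blast
next
  assume "\<exists>a. cmod a < 1 \<and> Q = range (\<lambda>s. s *\<^sub>C szego_kernel a)"
  then obtain a where a: "cmod a < 1" "Q = range (\<lambda>s. s *\<^sub>C szego_kernel a)" by blast
  show "\<forall>g\<in>Q. compressed_shift (backward_shift g) = backward_shift (compressed_shift g)"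
    using kernel_span_imp_normal[OF a] by blast
qed

end

lemma quotient_moduleI: "quotient_module1 Q \<Longrightarrow> quotient_module Q"
  by unfold_locales (simp_all add: quotient_module1_def adjoint_mult_z)

section \<open>Coordinate shifts on the Hardy space of the bidisc\<close>

text \<open>The point is the explicit coefficient family \<open>b\<close>: multiplication by \<open>\<phi>\<close> moves the
  coefficient at \<open>i\<close> to \<open>s i\<close>.\<close>

lemma expansion_shift_coeffs:
  assumes f: "expansion D e a f" and inj: "inj s" and e: "\<And>i x. e (s i) x = \<phi> x * e i x"
    and b: "\<And>i. b (s i) = a i" "\<And>i. i \<notin> range s \<Longrightarrow> b i = 0"
  shows "expansion D e b (\<lambda>x. \<phi> x * f x)"
proof -
  have "(\<lambda>i. (cmod (b i))\<^sup>2) summable_on range s"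
    using f inj unfolding expansion_def square_summable_def
    by (subst summable_on_reindex) (simp_all add: o_def b)
  then have ssb: "square_summable b"
    unfolding square_summable_def
    by (subst summable_on_cong_neutral[where T = "range s" and g = "\<lambda>i. (cmod (b i))\<^sup>2"])
      (simp_all add: b)
  have "((\<lambda>i. b i * e i x) has_sum \<phi> x * f x) UNIV" if "x \<in> D" for x
  proof -
    have "((\<lambda>i. \<phi> x * (a i * e i x)) has_sum \<phi> x * f x) UNIV"
      using f that unfolding expansion_def by (intro has_sum_cmult_right) simp
    then have "((\<lambda>i. b i * e i x) has_sum \<phi> x * f x) (range s)"
      using inj by (subst has_sum_reindex) (simp_all add: o_def b e mult_ac)
    then show ?thesis
      by (subst has_sum_cong_neutral[where T = "range s" and g = "\<lambda>i. b i * e i x"])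
        (simp_all add: b)
  qed
  with ssb f show ?thesis unfolding expansion_def by simp
qed

text \<open>The common form of the multiplications by the two coordinates, which move the coefficients
  along an injection of the index set.\<close>

locale coefficient_shift =
  fixes M :: "hardy2 \<Rightarrow> hardy2" and s :: "nat \<times> nat \<Rightarrow> nat \<times> nat"
  assumes inj: "inj s" and coeff2_M: "coeff2 (M F) (s k) = coeff2 F k"
    and coeff2_M_off: "k \<notin> range s \<Longrightarrow> coeff2 (M F) k = 0"
begin

definition adj :: "hardy2 \<Rightarrow> hardy2" where
  "adj F = hardy2_of (\<lambda>k. coeff2 F (s k))"

lemma coeff2_adj: "coeff2 (adj F) k = coeff2 F (s k)"
proof -
  have "(\<lambda>k. (cmod (coeff2 F k))\<^sup>2) summable_on range s"
    using square_summable_coeff2[of F] unfolding square_summable_def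
    by (rule summable_on_subset_banach) simp
  then have "square_summable (\<lambda>k. coeff2 F (s k))"
    using inj unfolding square_summable_def by (subst (asm) summable_on_reindex) (simp_all add: o_def)
  then show ?thesis
    unfolding adj_def by (simp add: coeff2_hardy2_of)
qed

lemma cinner_M: "cinner (M F) G = cinner F (adj G)"
proof -
  have "cinner (M F) G = (\<Sum>\<^sub>\<infinity>k\<in>range s. coeff2 (M F) k * cnj (coeff2 G k))"
    unfolding cinner_hardy2_def by (rule infsum_cong_neutral) (auto simp: coeff2_M_off)
  also have "\<dots> = (\<Sum>\<^sub>\<infinity>k. coeff2 F k * cnj (coeff2 (adj G) k))"
    using inj by (subst infsum_reindex) (simp_all add: o_def coeff2_M coeff2_adj)
  finally show ?thesis by (simp add: cinner_hardy2_def)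
qed

lemma adj_M: "adj (M F) = F"
  by (rule coeff2_inject) (simp add: fun_eq_iff coeff2_adj coeff2_M)

lemma adj_add: "adj (F + G) = adj F + adj G"
  by (rule coeff2_inject) (simp add: fun_eq_iff coeff2_adj coeff2_add)

lemma adj_scaleC: "adj (c *\<^sub>C F) = c *\<^sub>C adj F"
  by (rule coeff2_inject) (simp add: fun_eq_iff coeff2_adj coeff2_scale)

lemma M_add: "M (F + G) = M F + M G"
proof (rule coeff2_inject, rule ext)
  fix k show "coeff2 (M (F + G)) k = coeff2 (M F + M G) k"
    by (cases "k \<in> range s") (auto simp: coeff2_add coeff2_M coeff2_M_off)
qed

lemma M_scaleC: "M (c *\<^sub>C F) = c *\<^sub>C M F"
proof (rule coeff2_inject, rule ext)
  fix k show "coeff2 (M (c *\<^sub>C F)) k = coeff2 (c *\<^sub>C M F) k"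
    by (cases "k \<in> range s") (auto simp: coeff2_scale coeff2_M coeff2_M_off)
qed

lemma norm_M: "norm (M F) = norm F"
proof -
  have "complex_of_real ((norm (M F))\<^sup>2) = of_real ((norm F)\<^sup>2)"
    unfolding cinner_self[symmetric] by (simp add: cinner_M adj_M)
  then have "(norm (M F))\<^sup>2 = (norm F)\<^sup>2" unfolding of_real_eq_iff .
  then show ?thesis by (rule power2_eq_imp_eq) simp_all
qed

lemma norm_adj_le: "norm (adj F) \<le> norm F"
proof -
  have "(norm (adj F))\<^sup>2 = cmod (cinner (adj F) (adj F))"
    unfolding cinner_self norm_of_real by simp
  also have "\<dots> = cmod (cinner (M (adj F)) F)"
    by (simp add: cinner_M)
  also have "\<dots> \<le> norm (M (adj F)) * norm F"
    by (rule norm_cinner_le)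
  finally have "norm (adj F) * norm (adj F) \<le> norm (adj F) * norm F"
    by (simp add: norm_M power2_eq_square)
  then show ?thesis
    by (cases "adj F = 0") (simp_all add: mult_le_cancel_left_pos)
qed

lemma bounded_linear_M: "bounded_linear M"
  by (rule bounded_linear_intro[where K = 1]) (simp_all add: M_add M_scaleC scaleR_eq_scaleC norm_M)

lemma bounded_linear_adj: "bounded_linear adj"
  by (rule bounded_linear_intro[where K = 1])
    (simp_all add: adj_add adj_scaleC scaleR_eq_scaleC norm_adj_le)

lemma adjoint_M: "adjoint_on UNIV M = adj"
proof
  interpret U: closed_csubspace "UNIV :: hardy2 set"
    by unfold_locales (simp_all add: complex_vs.subspace_UNIV)
  fix F show "adjoint_on UNIV M F = adj F"
    by (rule U.adjoint_on_eqI) (simp_all add: cinner_M)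
qed

end

interpretation M1: coefficient_shift mult_1 "map_prod Suc id"
proof -
  have "coeff2 (mult_1 F) = (\<lambda>k. case fst k of 0 \<Rightarrow> 0 | Suc m \<Rightarrow> coeff2 F (m, snd k))" for F
  proof (rule coeff2_eqI)
    have "expansion2 (\<lambda>k. case fst k of 0 \<Rightarrow> 0 | Suc m \<Rightarrow> coeff2 F (m, snd k)) (\<lambda>p. fst p * eval2 F p)"
      by (rule expansion_shift_coeffs[OF expansion_coeff2, where s = "map_prod Suc id"])
        (auto simp: prod.inj_map image_iff split: nat.splits)
    then show "expansion2 (\<lambda>k. case fst k of 0 \<Rightarrow> 0 | Suc m \<Rightarrow> coeff2 F (m, snd k)) (eval2 (mult_1 F))"
      by (simp add: mult_1.rep_eq)
  qed
  then show "coefficient_shift mult_1 (map_prod Suc id)"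
    by unfold_locales (auto simp: prod.inj_map image_iff split: nat.splits)
qed

interpretation M2: coefficient_shift mult_2 "map_prod id Suc"
proof -
  have "coeff2 (mult_2 F) = (\<lambda>k. case snd k of 0 \<Rightarrow> 0 | Suc m \<Rightarrow> coeff2 F (fst k, m))" for F
  proof (rule coeff2_eqI)
    have "expansion2 (\<lambda>k. case snd k of 0 \<Rightarrow> 0 | Suc m \<Rightarrow> coeff2 F (fst k, m)) (\<lambda>p. snd p * eval2 F p)"
      by (rule expansion_shift_coeffs[OF expansion_coeff2, where s = "map_prod id Suc"])
        (auto simp: prod.inj_map image_iff split: nat.splits)
    then show "expansion2 (\<lambda>k. case snd k of 0 \<Rightarrow> 0 | Suc m \<Rightarrow> coeff2 F (fst k, m)) (eval2 (mult_2 F))"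
      by (simp add: mult_2.rep_eq)
  qed
  then show "coefficient_shift mult_2 (map_prod id Suc)"
    by unfold_locales (auto simp: prod.inj_map image_iff split: nat.splits)
qed

section \<open>Elementary tensors\<close>

lemma coeff2_tensor: "coeff2 (tensor f g) k = coeff1 f (fst k) * coeff1 g (snd k)"
  using coeff2_eqI[of "\<lambda>k. coeff1 f (fst k) * coeff1 g (snd k)" "tensor f g"]
    expansion_tensor[OF expansion_coeff1 expansion_coeff1]
  by (simp add: tensor.rep_eq)

lemma cinner_tensor: "cinner (tensor f g) (tensor f' g') = cinner f f' * cinner g g'"
proof -
  let ?u = "\<lambda>m. coeff1 f m * cnj (coeff1 f' m)" and ?v = "\<lambda>n. coeff1 g n * cnj (coeff1 g' n)"
  have eq: "coeff2 (tensor f g) k * cnj (coeff2 (tensor f' g') k) = (case k of (m, n) \<Rightarrow> ?u m * ?v n)" for k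
    by (simp add: coeff2_tensor case_prod_unfold mult_ac)
  have s: "(\<lambda>(m, n). ?u m * ?v n) summable_on UNIV \<times> UNIV"
    using square_summable_mult_cnj[OF square_summable_coeff2 square_summable_coeff2, of "tensor f g" "tensor f' g'"]
    unfolding eq by simp
  have "cinner (tensor f g) (tensor f' g') = (\<Sum>\<^sub>\<infinity>(m, n)\<in>UNIV \<times> UNIV. ?u m * ?v n)"
    unfolding cinner_hardy2_def eq by simp
  also have "\<dots> = (\<Sum>\<^sub>\<infinity>m. \<Sum>\<^sub>\<infinity>n. ?u m * ?v n)"
    by (rule infsum_Sigma'_banach[OF s, symmetric])
  also have "\<dots> = (\<Sum>\<^sub>\<infinity>m. ?u m * cinner g g')"
    unfolding infsum_cmult_right' cinner_hardy1_def ..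
  also have "\<dots> = cinner f f' * cinner g g'"
    unfolding infsum_cmult_left' by (simp add: cinner_hardy1_def)
  finally show ?thesis .
qed

lemma tensor_eq_0_iff: "tensor f g = 0 \<longleftrightarrow> f = 0 \<or> g = 0"
  using cinner_self_eq_0[of "tensor f g"] unfolding cinner_tensor by simp

lemma tensor_diff_right: "tensor f (g - g') = tensor f g - tensor f g'"
  by (rule coeff2_inject) (simp add: fun_eq_iff coeff2_tensor coeff2_diff coeff1_diff algebra_simps)

lemma mult_1_tensor: "mult_1 (tensor f g) = tensor (mult_z f) g"
  by (rule eval2_inject[THEN iffD1])
    (simp add: fun_eq_iff mult_1.rep_eq tensor.rep_eq mult_z.rep_eq mult.assoc)

lemma mult_2_tensor: "mult_2 (tensor f g) = tensor f (mult_z g)"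
  by (rule eval2_inject[THEN iffD1])
    (simp add: fun_eq_iff mult_2.rep_eq tensor.rep_eq mult_z.rep_eq mult.left_commute)

lemma adj_2_tensor: "M2.adj (tensor f g) = tensor f (backward_shift g)"
  by (rule coeff2_inject) (simp add: fun_eq_iff M2.coeff2_adj coeff2_tensor coeff1_backward_shift)

lemma tensor_mem: "f \<in> A \<Longrightarrow> g \<in> C \<Longrightarrow> tensor f g \<in> tensor_space A C"
  unfolding tensor_space_def
  by (intro closure_subset[THEN subsetD] complex_vs.span_base) blast

lemma tensor_space_induct:
  assumes "closed S" "complex_vs.subspace S" "\<And>f g. f \<in> A \<Longrightarrow> g \<in> C \<Longrightarrow> tensor f g \<in> S"
  shows "tensor_space A C \<subseteq> S"
  unfolding tensor_space_def using assms
  by (intro closure_minimal complex_vs.span_minimal) blast+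

section \<open>Tensor products of quotient modules\<close>

text \<open>The tensor product of the projections lands in the tensor product space, and what it removes
  is orthogonal to all elementary tensors, hence to the closure of their span.\<close>

lemma orth_proj_tensor_space:
  assumes A: "closed_csubspace A" and C: "closed_csubspace C" and Q: "closed_csubspace (tensor_space A C)"
  shows "orth_proj (tensor_space A C) (tensor f g) = tensor (orth_proj A f) (orth_proj C g)"
proof -
  interpret A: closed_csubspace A by (rule A)
  interpret C: closed_csubspace C by (rule C)
  interpret Q: closed_csubspace "tensor_space A C" by (rule Q)
  let ?p = "tensor (orth_proj A f) (orth_proj C g)"
  show ?thesis
  proof (rule Q.orth_proj_eqI)
    show "?p \<in> tensor_space A C"
      by (intro tensor_mem A.orth_proj_mem C.orth_proj_mem)
    have "cinner (tensor f g - ?p) y = 0" if "y \<in> {tensor f' g' | f' g'. f' \<in> A \<and> g' \<in> C}" for y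
      using that
      by (auto simp: cinner_diff_left cinner_tensor A.cinner_orth_proj C.cinner_orth_proj)
    then show "tensor f g - ?p \<in> orth_complement (tensor_space A C)"
      unfolding orth_complement_def tensor_space_def
      by (intro CollectI ballI) (rule cinner_zero_on_closure_span)
  qed
qed

text \<open>On an elementary tensor \<open>f \<otimes> g\<close> the two sides of the defining identity are \<open>A f \<otimes> B B* g\<close>
  and \<open>A f \<otimes> B* B g\<close>, where \<open>A\<close> and \<open>B\<close> are the compressions of the shift to the two factors.
  Both sides are bounded linear operators, so they agree on the tensor product if they agree
  on elementary tensors; and an elementary tensor vanishes only if one of its factors does.\<close>

lemma phi_doubly_commuting_tensor_iff:
  assumes Q1: "quotient_module1 Q1" and Q2: "quotient_module1 Q2"
    and Q: "quotient_module2 (tensor_space Q1 Q2)"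
  shows "phi_doubly_commuting (tensor_space Q1 Q2) \<longleftrightarrow>
    (\<forall>f\<in>Q1. quotient_module.compressed_shift Q1 f = 0) \<or>
    (\<forall>g\<in>Q2. quotient_module.compressed_shift Q2 (backward_shift g) = backward_shift (quotient_module.compressed_shift Q2 g))"
proof -
  interpret Q1: quotient_module Q1 by (rule quotient_moduleI[OF Q1])
  interpret Q2: quotient_module Q2 by (rule quotient_moduleI[OF Q2])
  define Q where "Q = tensor_space Q1 Q2"
  interpret Q: closed_csubspace Q
    using assms(3) by unfold_locales (simp_all add: Q_def quotient_module2_def)
  have adj_mem: "M2.adj F \<in> Q" if "F \<in> Q" for F
    using assms(3) that by (simp add: Q_def quotient_module2_def M2.adjoint_M)
  have adj: "adjoint_on Q (compression Q mult_2) F = M2.adj F" if "F \<in> Q" for F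
    using that by (intro Q.adjoint_on_compression adj_mem M2.cinner_M)
  define P where "P = orth_proj Q"
  define L where "L F = P (mult_1 (P (mult_2 (M2.adj F))))" for F
  define R where "R F = M2.adj (P (mult_1 (P (mult_2 F))))" for F
  have phi: "phi_doubly_commuting Q \<longleftrightarrow> (\<forall>F\<in>Q. L F = R F)"
    unfolding phi_doubly_commuting_def Let_def L_def R_def
    by (intro ball_cong refl) (simp add: compression_def adj P_def Q.orth_proj_mem)
  have P_tensor: "P (tensor f g) = tensor (orth_proj Q1 f) (orth_proj Q2 g)" for f g
    unfolding P_def Q_def
    by (rule orth_proj_tensor_space)
      (use Q.closed_csubspace_axioms in \<open>simp_all add: Q_def Q1.closed_csubspace_axioms Q2.closed_csubspace_axioms\<close>)
  have L_tensor: "L (tensor f g) = tensor (Q1.compressed_shift f) (Q2.compressed_shift (backward_shift g))" if "f \<in> Q1" "g \<in> Q2" for f g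
    unfolding L_def adj_2_tensor mult_2_tensor P_tensor mult_1_tensor
    unfolding Q1.orth_proj_id[OF that(1)] Q1.compressed_shift_def[symmetric] Q2.compressed_shift_def[symmetric]
    by (simp only: Q2.orth_proj_id[OF Q2.compressed_shift_mem])
  have R_tensor: "R (tensor f g) = tensor (Q1.compressed_shift f) (backward_shift (Q2.compressed_shift g))" if "f \<in> Q1" "g \<in> Q2" for f g
    unfolding R_def mult_2_tensor P_tensor mult_1_tensor
    unfolding Q1.orth_proj_id[OF that(1)] Q1.compressed_shift_def[symmetric] Q2.compressed_shift_def[symmetric] adj_2_tensor
    by (simp only: Q2.orth_proj_id[OF Q2.compressed_shift_mem])
  have "(\<forall>F\<in>Q. L F = R F) \<longleftrightarrow> (\<forall>f\<in>Q1. \<forall>g\<in>Q2. L (tensor f g) = R (tensor f g))"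
  proof (intro iffI ballI)
    fix f g assume "\<forall>F\<in>Q. L F = R F" "f \<in> Q1" "g \<in> Q2"
    then show "L (tensor f g) = R (tensor f g)" using tensor_mem by (simp add: Q_def)
  next
    fix F assume eq: "\<forall>f\<in>Q1. \<forall>g\<in>Q2. L (tensor f g) = R (tensor f g)" and F: "F \<in> Q"
    have P: "bounded_linear P" unfolding P_def by (rule Q.bounded_linear_orth_proj)
    have "bounded_linear (\<lambda>F. L F)" unfolding L_def
      by (intro bounded_linear_compose[OF P] bounded_linear_compose[OF M1.bounded_linear_M]
          bounded_linear_compose[OF M2.bounded_linear_M] M2.bounded_linear_adj)
    moreover have "bounded_linear (\<lambda>F. R F)" unfolding R_def
      by (intro bounded_linear_compose[OF P] bounded_linear_compose[OF M1.bounded_linear_M]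
          bounded_linear_compose[OF M2.bounded_linear_adj] M2.bounded_linear_M)
    ultimately have "continuous_on UNIV (\<lambda>F. L F)" "continuous_on UNIV (\<lambda>F. R F)"
      by (simp_all add: linear_continuous_on)
    then have "closed {F. L F = R F}"
      by (rule closed_Collect_eq)
    moreover have "complex_vs.subspace {F. L F = R F}"
    proof -
      have "L (F + G) = L F + L G" "R (F + G) = R F + R G" "L (c *\<^sub>C F) = c *\<^sub>C L F" "R (c *\<^sub>C F) = c *\<^sub>C R F" for F G c
        by (simp_all add: L_def R_def P_def Q.orth_proj_add Q.orth_proj_scaleC M1.M_add M1.M_scaleC
            M2.M_add M2.M_scaleC M2.adj_add M2.adj_scaleC)
      moreover from this(3,4)[of 0 0] have "L 0 = 0" "R 0 = 0" by simp_all
      ultimately show ?thesis by (simp add: complex_vs.subspace_def)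
    qed
    ultimately have "tensor_space Q1 Q2 \<subseteq> {F. L F = R F}"
      using eq by (intro tensor_space_induct) simp_all
    then show "L F = R F" using F by (auto simp: Q_def)
  qed
  also have "\<dots> \<longleftrightarrow> (\<forall>f\<in>Q1. \<forall>g\<in>Q2. Q1.compressed_shift f = 0 \<or>
      Q2.compressed_shift (backward_shift g) = backward_shift (Q2.compressed_shift g))"
  proof (intro ball_cong refl)
    fix f g assume fg: "f \<in> Q1" "g \<in> Q2"
    have "L (tensor f g) - R (tensor f g) = tensor (Q1.compressed_shift f) (Q2.compressed_shift (backward_shift g) - backward_shift (Q2.compressed_shift g))"
      unfolding L_tensor[OF fg] R_tensor[OF fg] tensor_diff_right ..
    then show "L (tensor f g) = R (tensor f g) \<longleftrightarrow> Q1.compressed_shift f = 0 \<or>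
      Q2.compressed_shift (backward_shift g) = backward_shift (Q2.compressed_shift g)"
      using tensor_eq_0_iff by (metis eq_iff_diff_eq_0)
  qed
  also have "\<dots> \<longleftrightarrow> (\<forall>f\<in>Q1. Q1.compressed_shift f = 0) \<or>
      (\<forall>g\<in>Q2. Q2.compressed_shift (backward_shift g) = backward_shift (Q2.compressed_shift g))"
    by blast
  finally show ?thesis using phi unfolding Q_def by simp
qed

lemma tensor_space_zero:
  assumes "A = {0} \<or> C = {0}"
  shows "tensor_space A C \<subseteq> {0}"
  by (rule tensor_space_induct) (use assms in \<open>auto simp: tensor_eq_0_iff complex_vs.subspace_single_0\<close>)

theorem theorem3p8:
  fixes Q1 Q2 :: "hardy1 set" and Q :: "hardy2 set"
  assumes "quotient_module1 Q1" and "quotient_module1 Q2"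
    and "Q = tensor_space Q1 Q2"
    and "quotient_module2 Q" and "Q \<noteq> {0}" and "doubly_commuting Q"
  shows "phi_doubly_commuting Q \<longleftrightarrow>
      (Q1 = UNIV \<and>
        (\<exists>a c. cmod a < 1 \<and> cmod c = 1 \<and>
          Q2 = orth_complement (mult_range (disc_automorphism c a)))) \<or>
      ((\<exists>c. cmod c = 1 \<and> Q1 = orth_complement (mult_range (disc_automorphism c 0))) \<and>
        Q2 = UNIV) \<or>
      (\<exists>\<theta>\<^sub>1 \<theta>\<^sub>2.
        Q1 = orth_complement (mult_range \<theta>\<^sub>1) \<and> Q2 = orth_complement (mult_range \<theta>\<^sub>2) \<and>
        ((\<exists>c. cmod c = 1 \<and> \<theta>\<^sub>1 = disc_automorphism c 0) \<and> inner_function \<theta>\<^sub>2 \<or>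
         inner_function \<theta>\<^sub>1 \<and>
           (\<exists>a c. cmod a < 1 \<and> cmod c = 1 \<and> \<theta>\<^sub>2 = disc_automorphism c a)))"
    (is "_ \<longleftrightarrow> ?cases")
proof -
  interpret Q1: quotient_module Q1 by (rule quotient_moduleI[OF assms(1)])
  interpret Q2: quotient_module Q2 by (rule quotient_moduleI[OF assms(2)])
  have "0 \<in> Q"
    using assms(4) complex_vs.subspace_0 by (auto simp: quotient_module2_def)
  then have nz: "Q1 \<noteq> {0}" "Q2 \<noteq> {0}"
    using tensor_space_zero[of Q1 Q2] assms(3,5) by auto
  define K where "K = (\<lambda>a. range (\<lambda>s. s *\<^sub>C szego_kernel a))"
  have K: "orth_complement (mult_range (disc_automorphism c a)) = K a" if "cmod a < 1" "cmod c = 1" for a c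
    unfolding K_def by (rule orth_complement_disc_automorphism_range[OF that])
  have inner: "\<exists>\<theta>. inner_function \<theta> \<and> S = orth_complement (mult_range \<theta>)"
    if "quotient_module1 S" "S \<noteq> UNIV" for S
    by (rule beurling[OF that]) blast
  have "phi_doubly_commuting Q \<longleftrightarrow> Q1 = K 0 \<or> (\<exists>a. cmod a < 1 \<and> Q2 = K a)"
    using phi_doubly_commuting_tensor_iff[OF assms(1,2)] assms(3,4)
      Q1.compressed_shift_eq_0_iff[OF nz(1)] Q2.normal_iff[OF nz(2)] by (simp add: K_def)
  also have "\<dots> \<longleftrightarrow> ?cases"
  proof
    assume "Q1 = K 0 \<or> (\<exists>a. cmod a < 1 \<and> Q2 = K a)"
    then show ?cases
    proof
      assume "Q1 = K 0"
      then have Q1: "Q1 = orth_complement (mult_range (disc_automorphism 1 0))"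
        by (simp add: K)
      show ?cases
      proof (cases "Q2 = UNIV")
        case True
        have "cmod 1 = 1" by simp
        with Q1 True show ?thesis by blast
      next
        case False
        then obtain \<theta> where "inner_function \<theta>" "Q2 = orth_complement (mult_range \<theta>)"
          using inner[OF assms(2)] by blast
        moreover have "cmod 1 = 1" by simp
        ultimately show ?thesis using Q1 by blast
      qed
    next
      assume "\<exists>a. cmod a < 1 \<and> Q2 = K a"
      then obtain a where a: "cmod a < 1" and "Q2 = K a" by blast
      then have Q2: "Q2 = orth_complement (mult_range (disc_automorphism 1 a))"
        by (simp add: K)
      show ?cases
      proof (cases "Q1 = UNIV")
        case True
        have "cmod 1 = 1" by simp
        with Q2 a True show ?thesis by blast
      next
        case False
        then obtain \<theta> where "inner_function \<theta>" "Q1 = orth_complement (mult_range \<theta>)"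
          using inner[OF assms(1)] by blast
        moreover have "cmod 1 = 1" by simp
        ultimately show ?thesis using Q2 a by blast
      qed
    qed
  next
    assume ?cases
    then show "Q1 = K 0 \<or> (\<exists>a. cmod a < 1 \<and> Q2 = K a)"
      using K K[of 0] by (elim disjE conjE exE) auto
  qed
  finally show ?thesis .
qed

end
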